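(* Let $G$ be a connected simple Lie group with finite centre and $\mathrm{rank}_{\mathbb R}G\ge2$, and assume that $G$ has Kazhdan's property (T). For every discrete subgroup $\Gamma\le G$ there is a threshold $\epsilon_0=\epsilon_0(G,\Gamma)>0$ such that the following holds for every $\epsilon<\epsilon_0$. Suppose $\nu$ is a probability measure on $G/\Gamma$, absolutely continuous with respect to $m_{G/\Gamma}$, whose density ratios $f_{\nu,g}=\frac{d\nu}{d(g\nu)}$, $g\in G_1$, are bounded above and below and are Lipschitz outside a set of $\nu$-measure $\epsilon$. If $$W_1^{f_{\nu,g}}(g\nu,\nu)\le\epsilon\qquad\text{for every }g\in G_1,$$ then $\Gamma$ is a lattice in $G$. Conversely, a lattice $\Gamma$ carries a $G$-invariant probability measure on $G/\Gamma$, for which the displayed inequality holds with $\epsilon=0$.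
   Context: $d_G$ is a fixed right-invariant Riemannian metric on $G$, and $G_1=\{g\in G:d_G(e,g)<1\}$ is the unit ball. $m_{G/\Gamma}$ is the (possibly infinite) $G$-invariant measure on $G/\Gamma$ induced by Haar measure. $g\nu$ is the pushforward of $\nu$ under $x\mapsto gx$. With $\rho_\nu$ the density of $\nu$ with respect to $m_{G/\Gamma}$, $f_{\nu,g}(x)=\rho_\nu(x)/\rho_\nu(g^{-1}x)$. For a measurable $f:Y\to\mathbb R$ and probability measures $\lambda_1,\lambda_2$ on $Y$, $$W_1^{f}(\lambda_1,\lambda_2)=\sup\left\{|\lambda_1(\varphi\circ f)-\lambda_2(\varphi\circ f)|:\ \mathrm{Lip}(\varphi)\le1,\ \|\varphi\|_\infty\le 1\right\}.$$ The paper gives the following as the precise form of the nontrivial direction (with $G$ having property (T)): there exist $\epsilon_0=\epsilon_0(\Gamma)>0$ and $0<c_1(G)<c_2(G)$ such that, for every probability measure $\nu$ on $G/\Gamma$ for which the functions $f_{\nu,g}$, $g\in G_1$, are defined, and for every $\epsilon<\epsilon_0$: if (a) $\nu$ is absolutely continuous with respect to $m_{G/\Gamma}$ and for every $g\in G_1$ one has $c_1\le f_{\nu,g}\le c_2$ on a subset $X_0\subset G/\Gamma$ such that $\nu(gX_0)\ge1-\epsilon$ for every $g\in G_1$; (b) for every $g\in G_1$ the function $f_{\nu,g}$ is $L_G$-Lipschitz on $X_0$ for some $L_G>0$ depending only on $G$; and (c) $W_1^{f_{\nu,g}}(g\nu,\nu)\le\epsilon$ for every $g\in G_1$; then $\Gamma$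 is a lattice. *)

theory Defs
  imports "HOL-Analysis.Analysis" "HOL-Probability.Probability_Measure" "HOL-Algebra.Left_Coset"
begin

section \<open>Smooth maps and atlases\<close>

text \<open>Both predicates below are meant for open \<open>S\<close>. In finite dimension a map on an open set is
  \<open>C\<^sup>k\<^sup>+\<^sup>1\<close> iff it is differentiable with all directional derivatives of class \<open>C\<^sup>k\<close>.\<close>

primrec Ck_on :: "nat \<Rightarrow> 'a::euclidean_space set \<Rightarrow> ('a \<Rightarrow> 'b::real_normed_vector) \<Rightarrow> bool" where
  "Ck_on 0 S f \<longleftrightarrow> continuous_on S f"
| "Ck_on (Suc k) S f \<longleftrightarrow>
     f differentiable_on S \<and> (\<forall>v. Ck_on k S (\<lambda>x. frechet_derivative f (at x) v))"

definition smooth_on :: "'a::euclidean_space set \<Rightarrow> ('a \<Rightarrow> 'b::real_normed_vector) \<Rightarrow> bool" where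
  "smooth_on S f \<longleftrightarrow> (\<forall>k. Ck_on k S f)"

text \<open>A chart is a pair \<open>(U, \<phi>)\<close>; the values of \<open>\<phi>\<close> outside \<open>U\<close> are irrelevant.\<close>

type_synonym ('g, 'e) chart = "'g set \<times> ('g \<Rightarrow> 'e)"

definition is_chart :: "('g::topological_space, 'e::euclidean_space) chart \<Rightarrow> bool" where
  "is_chart c \<longleftrightarrow> open (fst c) \<and> open (snd c ` fst c) \<and>
     (\<exists>\<psi>. homeomorphism (fst c) (snd c ` fst c) (snd c) \<psi>)"

definition chart_inv :: "('g, 'e) chart \<Rightarrow> 'e \<Rightarrow> 'g" where
  "chart_inv c = the_inv_into (fst c) (snd c)"

definition smooth_atlas ::
    "('g::{second_countable_topology, t2_space}, 'e::euclidean_space) chart set \<Rightarrow> bool" where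
  "smooth_atlas A \<longleftrightarrow> (\<forall>c\<in>A. is_chart c) \<and> \<Union>(fst ` A) = UNIV \<and>
     (\<forall>c\<in>A. \<forall>c'\<in>A. smooth_on (snd c ` (fst c \<inter> fst c')) (snd c' \<circ> chart_inv c))"

text \<open>The derivative at \<open>p\<close> of \<open>F\<close>, read in the chart \<open>c\<close> around \<open>p\<close> and the chart \<open>c'\<close> around
  \<open>F p\<close>. The tangent space at a point is identified with the model space via a chart.\<close>

definition chart_deriv ::
    "('g, 'e::euclidean_space) chart \<Rightarrow> ('g, 'e) chart \<Rightarrow> ('g \<Rightarrow> 'g) \<Rightarrow> 'g \<Rightarrow> 'e \<Rightarrow> 'e" where
  "chart_deriv c c' F p = frechet_derivative (snd c' \<circ> F \<circ> chart_inv c) (at (snd c p))"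


section \<open>Lie groups\<close>

definition lie_group ::
    "'g::{second_countable_topology, t2_space} monoid \<Rightarrow> ('g, 'e::euclidean_space) chart set \<Rightarrow> bool"
  where
  "lie_group G A \<longleftrightarrow> group G \<and> carrier G = UNIV \<and> smooth_atlas A \<and>
     continuous_on UNIV (\<lambda>(x, y). x \<otimes>\<^bsub>G\<^esub> y) \<and> continuous_on UNIV (\<lambda>x. inv\<^bsub>G\<^esub> x) \<and>
     (\<forall>c\<in>A. \<forall>c'\<in>A. \<forall>c''\<in>A.
        smooth_on {(u, v). u \<in> snd c ` fst c \<and> v \<in> snd c' ` fst c' \<and>
                           chart_inv c u \<otimes>\<^bsub>G\<^esub> chart_inv c' v \<in> fst c''}
          (\<lambda>(u, v). snd c'' (chart_inv c u \<otimes>\<^bsub>G\<^esub> chart_inv c' v))) \<and>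
     (\<forall>c\<in>A. \<forall>c'\<in>A.
        smooth_on {u \<in> snd c ` fst c. inv\<^bsub>G\<^esub> (chart_inv c u) \<in> fst c'}
          (\<lambda>u. snd c' (inv\<^bsub>G\<^esub> (chart_inv c u))))"

text \<open>The Lie algebra is the tangent space at the identity, i.e. the model space via a chosen
  chart, with bracket \<open>[X, Y] = ad X Y\<close>, where \<open>Ad g\<close> is the derivative at the identity of
  conjugation by \<open>g\<close> and \<open>ad\<close> is the derivative of \<open>Ad\<close> at the identity. Another choice
  of chart gives an isomorphic Lie algebra.\<close>

definition id_chart :: "'g monoid \<Rightarrow> ('g, 'e) chart set \<Rightarrow> ('g, 'e) chart" where
  "id_chart G A = (SOME c. c \<in> A \<and> \<one>\<^bsub>G\<^esub> \<in> fst c)"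

definition Ad :: "'g monoid \<Rightarrow> ('g, 'e::euclidean_space) chart set \<Rightarrow> 'g \<Rightarrow> 'e \<Rightarrow> 'e" where
  "Ad G A g = chart_deriv (id_chart G A) (id_chart G A) (\<lambda>x. g \<otimes>\<^bsub>G\<^esub> x \<otimes>\<^bsub>G\<^esub> inv\<^bsub>G\<^esub> g) \<one>\<^bsub>G\<^esub>"

definition lie_bracket ::
    "'g monoid \<Rightarrow> ('g, 'e::euclidean_space) chart set \<Rightarrow> 'e \<Rightarrow> 'e \<Rightarrow> 'e" where
  "lie_bracket G A X Y =
     frechet_derivative (\<lambda>u. Ad G A (chart_inv (id_chart G A) u) Y)
       (at (snd (id_chart G A) \<one>\<^bsub>G\<^esub>)) X"

definition simple_lie_algebra :: "('e::euclidean_space \<Rightarrow> 'e \<Rightarrow> 'e) \<Rightarrow> bool" where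
  "simple_lie_algebra br \<longleftrightarrow> (\<exists>X Y. br X Y \<noteq> 0) \<and>
     (\<forall>I. subspace I \<and> (\<forall>X. \<forall>Y\<in>I. br X Y \<in> I) \<longrightarrow> I = {0} \<or> I = UNIV)"

definition connected_simple_lie_group ::
    "'g::{second_countable_topology, t2_space} monoid \<Rightarrow> ('g, 'e::euclidean_space) chart set \<Rightarrow> bool"
  where
  "connected_simple_lie_group G A \<longleftrightarrow>
     lie_group G A \<and> connected (carrier G) \<and> simple_lie_algebra (lie_bracket G A)"

definition group_centre :: "'g monoid \<Rightarrow> 'g set" where
  "group_centre G = {z \<in> carrier G. \<forall>g\<in>carrier G. z \<otimes>\<^bsub>G\<^esub> g = g \<otimes>\<^bsub>G\<^esub> z}"

definition real_diagonalizable :: "('e::euclidean_space \<Rightarrow> 'e) \<Rightarrow> bool" where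
  "real_diagonalizable T \<longleftrightarrow> span {v. \<exists>a::real. T v = a *\<^sub>R v} = UNIV"

text \<open>The real rank of a semisimple group: the largest dimension of an abelian subalgebra
  consisting of elements \<open>X\<close> with \<open>ad X\<close> diagonalizable over the reals (the Lie algebra of a
  maximal split torus of the adjoint group).\<close>

definition real_rank :: "'g monoid \<Rightarrow> ('g, 'e::euclidean_space) chart set \<Rightarrow> nat" where
  "real_rank G A = Max {dim V | V :: 'e set. subspace V \<and>
     (\<forall>X\<in>V. \<forall>Y\<in>V. lie_bracket G A X Y = 0) \<and>
     (\<forall>X\<in>V. real_diagonalizable (lie_bracket G A X))}"


section \<open>Right-invariant Riemannian metrics\<close>

text \<open>\<open>R c p u v\<close> is the inner product at \<open>p\<close> of the tangent vectors that have coordinates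
  \<open>u\<close> and \<open>v\<close> in the chart \<open>c\<close>.\<close>

definition riemannian_metric ::
    "('g::{second_countable_topology, t2_space}, 'e::euclidean_space) chart set \<Rightarrow>
     (('g, 'e) chart \<Rightarrow> 'g \<Rightarrow> 'e \<Rightarrow> 'e \<Rightarrow> real) \<Rightarrow> bool" where
  "riemannian_metric A R \<longleftrightarrow>
     (\<forall>c\<in>A. \<forall>p\<in>fst c. bilinear (R c p) \<and> (\<forall>u v. R c p u v = R c p v u) \<and>
        (\<forall>u. u \<noteq> 0 \<longrightarrow> 0 < R c p u u)) \<and>
     (\<forall>c\<in>A. \<forall>u v. smooth_on (snd c ` fst c) (\<lambda>x. R c (chart_inv c x) u v)) \<and>
     (\<forall>c\<in>A. \<forall>c'\<in>A. \<forall>p\<in>fst c \<inter> fst c'. \<forall>u v.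
        R c p u v = R c' p (chart_deriv c c' id p u) (chart_deriv c c' id p v))"

definition right_invariant_metric ::
    "'g monoid \<Rightarrow> ('g, 'e::euclidean_space) chart set \<Rightarrow>
     (('g, 'e) chart \<Rightarrow> 'g \<Rightarrow> 'e \<Rightarrow> 'e \<Rightarrow> real) \<Rightarrow> bool" where
  "right_invariant_metric G A R \<longleftrightarrow>
     (\<forall>h. \<forall>c\<in>A. \<forall>c'\<in>A. \<forall>p\<in>fst c. p \<otimes>\<^bsub>G\<^esub> h \<in> fst c' \<longrightarrow> (\<forall>u v.
        R c p u v = R c' (p \<otimes>\<^bsub>G\<^esub> h)
          (chart_deriv c c' (\<lambda>q. q \<otimes>\<^bsub>G\<^esub> h) p u) (chart_deriv c c' (\<lambda>q. q \<otimes>\<^bsub>G\<^esub> h) p v)))"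

text \<open>As for \<open>piecewise_C1_differentiable_on\<close>, the finitely many exceptional times may include
  the end points, and one-sided derivatives need not exist there.\<close>

definition piecewise_C1_path ::
    "('g::topological_space, 'e::euclidean_space) chart set \<Rightarrow> (real \<Rightarrow> 'g) \<Rightarrow> bool" where
  "piecewise_C1_path A \<gamma> \<longleftrightarrow> continuous_on {0..1} \<gamma> \<and>
     (\<exists>S. finite S \<and>
        (\<forall>c\<in>A. (snd c \<circ> \<gamma>) C1_differentiable_on {t \<in> {0..1} - S. \<gamma> t \<in> fst c}))"

definition path_speed ::
    "('g, 'e::euclidean_space) chart set \<Rightarrow> (('g, 'e) chart \<Rightarrow> 'g \<Rightarrow> 'e \<Rightarrow> 'e \<Rightarrow> real) \<Rightarrow>
     (real \<Rightarrow> 'g) \<Rightarrow> real \<Rightarrow> real" where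
  "path_speed A R \<gamma> t =
     (let c = SOME c. c \<in> A \<and> \<gamma> t \<in> fst c; v = vector_derivative (snd c \<circ> \<gamma>) (at t)
      in sqrt (R c (\<gamma> t) v v))"

definition path_length ::
    "('g, 'e::euclidean_space) chart set \<Rightarrow> (('g, 'e) chart \<Rightarrow> 'g \<Rightarrow> 'e \<Rightarrow> 'e \<Rightarrow> real) \<Rightarrow>
     (real \<Rightarrow> 'g) \<Rightarrow> ennreal" where
  "path_length A R \<gamma> = (\<integral>\<^sup>+t\<in>{0..1}. ennreal (path_speed A R \<gamma> t) \<partial>lborel)"

definition riemannian_dist ::
    "('g::topological_space, 'e::euclidean_space) chart set \<Rightarrow>
     (('g, 'e) chart \<Rightarrow> 'g \<Rightarrow> 'e \<Rightarrow> 'e \<Rightarrow> real) \<Rightarrow> 'g \<Rightarrow> 'g \<Rightarrow> real" where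
  "riemannian_dist A R g h =
     enn2real (INF \<gamma>\<in>{\<gamma>. piecewise_C1_path A \<gamma> \<and> \<gamma> 0 = g \<and> \<gamma> 1 = h}. path_length A R \<gamma>)"

definition unit_ball :: "'g monoid \<Rightarrow> ('g \<Rightarrow> 'g \<Rightarrow> real) \<Rightarrow> 'g set" where
  "unit_ball G d = {g \<in> carrier G. d \<one>\<^bsub>G\<^esub> g < 1}"


section \<open>Property (T)\<close>

text \<open>For a second countable group it suffices to test property (T) on separable Hilbert spaces,
  because the cyclic subrepresentation generated by a vector is separable. Every separable complex
  Hilbert space is isometric to a closed subspace of the space of square summable sequences.\<close>

definition l2 :: "(nat \<Rightarrow> complex) set" where
  "l2 = {x. summable (\<lambda>n. (cmod (x n))\<^sup>2)}"

definition l2_inner :: "(nat \<Rightarrow> complex) \<Rightarrow> (nat \<Rightarrow> complex) \<Rightarrow> complex" where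
  "l2_inner x y = (\<Sum>n. x n * cnj (y n))"

definition l2_dist :: "(nat \<Rightarrow> complex) \<Rightarrow> (nat \<Rightarrow> complex) \<Rightarrow> real" where
  "l2_dist x y = sqrt (\<Sum>n. (cmod (x n - y n))\<^sup>2)"

definition l2_norm :: "(nat \<Rightarrow> complex) \<Rightarrow> real" where
  "l2_norm x = l2_dist x (\<lambda>_. 0)"

definition closed_l2_subspace :: "(nat \<Rightarrow> complex) set \<Rightarrow> bool" where
  "closed_l2_subspace H \<longleftrightarrow> H \<subseteq> l2 \<and> (\<lambda>_. 0) \<in> H \<and>
     (\<forall>x\<in>H. \<forall>y\<in>H. (\<lambda>n. x n + y n) \<in> H) \<and> (\<forall>a. \<forall>x\<in>H. (\<lambda>n. a * x n) \<in> H) \<and>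
     (\<forall>x\<in>l2. (\<forall>e>0. \<exists>y\<in>H. l2_dist x y < e) \<longrightarrow> x \<in> H)"

definition unitary_rep ::
    "'g::topological_space monoid \<Rightarrow> (nat \<Rightarrow> complex) set \<Rightarrow>
     ('g \<Rightarrow> (nat \<Rightarrow> complex) \<Rightarrow> (nat \<Rightarrow> complex)) \<Rightarrow> bool" where
  "unitary_rep G H \<pi> \<longleftrightarrow> closed_l2_subspace H \<and>
     (\<forall>g\<in>carrier G. \<forall>x\<in>H. \<pi> g x \<in> H) \<and>
     (\<forall>g\<in>carrier G. \<forall>x\<in>H. \<forall>y\<in>H. \<pi> g (\<lambda>n. x n + y n) = (\<lambda>n. \<pi> g x n + \<pi> g y n)) \<and>
     (\<forall>g\<in>carrier G. \<forall>a. \<forall>x\<in>H. \<pi> g (\<lambda>n. a * x n) = (\<lambda>n. a * \<pi> g x n)) \<and>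
     (\<forall>g\<in>carrier G. \<forall>x\<in>H. \<forall>y\<in>H. l2_inner (\<pi> g x) (\<pi> g y) = l2_inner x y) \<and>
     (\<forall>x\<in>H. \<pi> \<one>\<^bsub>G\<^esub> x = x) \<and>
     (\<forall>g\<in>carrier G. \<forall>h\<in>carrier G. \<forall>x\<in>H. \<pi> (g \<otimes>\<^bsub>G\<^esub> h) x = \<pi> g (\<pi> h x)) \<and>
     (\<forall>x\<in>H. \<forall>h\<in>carrier G. ((\<lambda>g. l2_dist (\<pi> g x) (\<pi> h x)) \<longlongrightarrow> 0) (at h within carrier G))"

definition property_T :: "'g::topological_space monoid \<Rightarrow> bool" where
  "property_T G \<longleftrightarrow>
     (\<exists>K \<kappa>. K \<subseteq> carrier G \<and> compact K \<and> (0::real) < \<kappa> \<and>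
        (\<forall>H \<pi>. unitary_rep G H \<pi> \<and>
            (\<exists>x\<in>H. x \<noteq> (\<lambda>_. 0) \<and> (\<forall>g\<in>K. l2_dist (\<pi> g x) x < \<kappa> * l2_norm x)) \<longrightarrow>
          (\<exists>x\<in>H. x \<noteq> (\<lambda>_. 0) \<and> (\<forall>g\<in>carrier G. \<pi> g x = x))))"


section \<open>The homogeneous space of left cosets\<close>

definition discrete_subgroup :: "'g::topological_space monoid \<Rightarrow> 'g set \<Rightarrow> bool" where
  "discrete_subgroup G \<Gamma> \<longleftrightarrow> subgroup \<Gamma> G \<and> discrete \<Gamma>"

text \<open>A set \<open>O\<close> of cosets is open in the quotient topology iff its preimage in \<open>G\<close>, which is
  \<open>\<Union>O\<close>, is open. The following measure space only carries the Borel sigma-algebra.\<close>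

definition coset_borel :: "'g::topological_space monoid \<Rightarrow> 'g set \<Rightarrow> 'g set measure" where
  "coset_borel G \<Gamma> = sigma (lcosets\<^bsub>G\<^esub> \<Gamma>) {W. W \<subseteq> lcosets\<^bsub>G\<^esub> \<Gamma> \<and> open (\<Union>W)}"

text \<open>The distance on the coset space induced by a right-invariant distance on \<open>G\<close>.\<close>

definition coset_dist :: "('g \<Rightarrow> 'g \<Rightarrow> real) \<Rightarrow> 'g set \<Rightarrow> 'g set \<Rightarrow> real" where
  "coset_dist d x y = Inf {d a b | a b. a \<in> x \<and> b \<in> y}"

definition haar_measure :: "'g::topological_space monoid \<Rightarrow> 'g measure \<Rightarrow> bool" where
  "haar_measure G \<mu> \<longleftrightarrow> sets \<mu> = sets borel \<and>
     (\<forall>K. compact K \<longrightarrow> emeasure \<mu> K < \<infinity>) \<and>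
     (\<forall>U. open U \<and> U \<noteq> {} \<longrightarrow> 0 < emeasure \<mu> U) \<and>
     (\<forall>g\<in>carrier G. distr \<mu> borel (\<lambda>x. g \<otimes>\<^bsub>G\<^esub> x) = \<mu>)"

text \<open>Weil's formula \<open>\<integral>\<^sub>G f d\<mu> = \<integral>\<^sub>G\<^sub>/\<^sub>\<Gamma> (\<Sum>\<gamma>\<in>\<Gamma>. f (g \<gamma>)) dm(g\<Gamma>)\<close>. The inner sum runs over the
  coset, and is written as an integral for counting measure.\<close>

definition induced_measure ::
    "'g::topological_space monoid \<Rightarrow> 'g measure \<Rightarrow> 'g set \<Rightarrow> 'g set measure \<Rightarrow> bool" where
  "induced_measure G \<mu> \<Gamma> m \<longleftrightarrow> sets m = sets (coset_borel G \<Gamma>) \<and>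
     (\<forall>f\<in>borel_measurable borel.
        (\<integral>\<^sup>+g. f g \<partial>\<mu>) = (\<integral>\<^sup>+x. (\<integral>\<^sup>+g. f g \<partial>count_space x) \<partial>m))"

definition lattice_subgroup ::
    "'g::topological_space monoid \<Rightarrow> 'g measure \<Rightarrow> 'g set \<Rightarrow> bool" where
  "lattice_subgroup G \<mu> \<Gamma> \<longleftrightarrow> discrete_subgroup G \<Gamma> \<and>
     (\<exists>m. induced_measure G \<mu> \<Gamma> m \<and> emeasure m (space m) < \<infinity>)"

definition translate_measure ::
    "'g::topological_space monoid \<Rightarrow> 'g set \<Rightarrow> 'g \<Rightarrow> 'g set measure \<Rightarrow> 'g set measure" where
  "translate_measure G \<Gamma> g \<nu> = distr \<nu> (coset_borel G \<Gamma>) (\<lambda>x. g <#\<^bsub>G\<^esub> x)"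

text \<open>Densities are only determined up to null sets; \<open>\<rho>\<close> is a real-valued version.\<close>

definition density_version :: "'a measure \<Rightarrow> 'a measure \<Rightarrow> ('a \<Rightarrow> real) \<Rightarrow> bool" where
  "density_version m \<nu> \<rho> \<longleftrightarrow>
     \<rho> \<in> borel_measurable m \<and> (\<forall>x. 0 \<le> \<rho> x) \<and> \<nu> = density m (\<lambda>x. ennreal (\<rho> x))"

text \<open>The version of \<open>d\<nu>/d(g\<nu>)\<close> determined by a version \<open>\<rho>\<close> of the density of \<open>\<nu>\<close>. The set where
  the denominator vanishes is null for \<open>g\<nu>\<close>, hence for \<open>\<nu>\<close> when \<open>\<nu>\<close> is absolutely continuous
  with respect to \<open>g\<nu>\<close>.\<close>

definition density_ratio :: "'g monoid \<Rightarrow> ('g set \<Rightarrow> real) \<Rightarrow> 'g \<Rightarrow> 'g set \<Rightarrow> real" where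
  "density_ratio G \<rho> g x = \<rho> x / \<rho> (inv\<^bsub>G\<^esub> g <#\<^bsub>G\<^esub> x)"

definition W1 :: "('y \<Rightarrow> real) \<Rightarrow> 'y measure \<Rightarrow> 'y measure \<Rightarrow> real" where
  "W1 f \<alpha> \<beta> =
     (SUP \<phi>\<in>{\<phi> :: real \<Rightarrow> real. 1-lipschitz_on UNIV \<phi> \<and> (\<forall>t. \<bar>\<phi> t\<bar> \<le> 1)}.
        \<bar>(\<integral>y. \<phi> (f y) \<partial>\<alpha>) - (\<integral>y. \<phi> (f y) \<partial>\<beta>)\<bar>)"

end

theory Submission
  imports Defs
begin

text \<open>Let \<open>\<rho>\<close> be the density of \<open>\<nu>\<close> and \<open>v = \<surd>\<rho>\<close>, a unit vector of \<open>L\<^sup>2(G/\<Gamma>)\<close>. Under \<open>g\<nu>\<close> the ratio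
  \<open>t = d\<nu>/d(g\<nu>)\<close> satisfies \<open>\<integral>\<phi>(t) d\<nu> - \<integral>\<phi>(t) d(g\<nu>) = \<integral>\<phi>(t)(t - 1) d(g\<nu>)\<close>, and for \<open>\<phi>\<close> the truncation
  of \<open>t - 1\<close> to \<open>[-1, 1]\<close> the integrand is at least \<open>(\<surd>t - 1)\<^sup>2\<close>. So the hypothesis on \<open>W\<^sub>1\<close> bounds
  \<open>\<parallel>gv - v\<parallel>\<^sup>2\<close> by \<open>\<epsilon>\<close> on the unit ball, hence by a multiple of \<open>\<epsilon>\<close> on any compact set. For small
  \<open>\<epsilon>\<close> property (T) of the Koopman representation gives a nonzero invariant function in \<open>L\<^sup>2(G/\<Gamma>)\<close>.
  Its superlevel sets are invariant of finite measure, and since \<open>G\<close> acts transitively they are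
  null or conull; so \<open>G/\<Gamma>\<close> has finite measure.\<close>

section \<open>Square integrable functions\<close>

text \<open>\<open>property_T\<close> speaks only of unitary representations on closed subspaces of
  \<open>l2\<close>, so the Koopman representation has to be moved from functions on G/\<Gamma> to
  sequences. This needs separability: indicators of countably many finite-measure open sets of
  cosets form a total family, and orthonormalising it gives a coefficient map that is isometric
  modulo null sets. The same indicators make strong continuity checkable, since continuity on a
  total family extends to all of L2. A second obstacle is that \<open>m\<close> is known only
  through Weil's formula; its invariance and uniqueness are read off a Borel fundamental domain for
  \<Gamma>. An invariant vector yields a function that is invariant only almost everywhere, with a
  null set depending on the group element; the ergodicity argument is a Fubini computation that
  accepts exactly this. The threshold is \<open>\<kappa>\<^sup>2 / (C + 1)\<close>:
  \<open>\<kappa>\<close> belongs to the compact set \<open>K\<close> of property (T), and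
  \<open>C\<close> says how a bound on a neighbourhood of the identity inside the unit ball spreads
  to \<open>K\<close> by connectedness. Both are fixed before \<open>\<nu>\<close> appears.\<close>

definition sq_int :: "'a measure \<Rightarrow> ('a \<Rightarrow> complex) set" where
  "sq_int M = {f \<in> borel_measurable M. integrable M (\<lambda>x. (cmod (f x))\<^sup>2)}"

definition sq_ip :: "'a measure \<Rightarrow> ('a \<Rightarrow> complex) \<Rightarrow> ('a \<Rightarrow> complex) \<Rightarrow> complex" where
  "sq_ip M f g = (\<integral>x. f x * cnj (g x) \<partial>M)"

text \<open>The square of the L2 norm, without a root. Functions are not identified modulo null
  sets, so this vanishes exactly when a square integrable \<open>f\<close> is zero almost
  everywhere.\<close>

definition sq_norm :: "'a measure \<Rightarrow> ('a \<Rightarrow> complex) \<Rightarrow> real" where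
  "sq_norm M f = (\<integral>x. (cmod (f x))\<^sup>2 \<partial>M)"

lemma sq_intD:
  assumes "f \<in> sq_int M"
  shows "f \<in> borel_measurable M" "integrable M (\<lambda>x. (cmod (f x))\<^sup>2)"
  using assms by (auto simp: sq_int_def)

lemma sq_int_zero [simp]: "(\<lambda>_. 0) \<in> sq_int M"
  by (simp add: sq_int_def)

lemma sq_int_scale:
  assumes "f \<in> sq_int M"
  shows "(\<lambda>x. c * f x) \<in> sq_int M"
  using sq_intD[OF assms] by (auto simp: sq_int_def norm_mult power_mult_distrib)

text \<open>From 2|a||b| \<le> |a|^2 + |b|^2. Triangle inequalities are used for squared norms
  throughout, each at the price of a factor 2.\<close>

lemma cmod_add_sq_le: "(cmod (a + b))\<^sup>2 \<le> 2 * (cmod a)\<^sup>2 + 2 * (cmod b)\<^sup>2"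
proof -
  have "(cmod (a + b))\<^sup>2 \<le> (cmod a + cmod b)\<^sup>2"
    by (simp add: norm_triangle_ineq power_mono)
  also have "\<dots> \<le> 2 * (cmod a)\<^sup>2 + 2 * (cmod b)\<^sup>2"
    using sum_squares_bound[of "cmod a" "cmod b"] by (simp add: power2_sum)
  finally show ?thesis .
qed

lemma sq_int_add:
  assumes "f \<in> sq_int M" "g \<in> sq_int M"
  shows "(\<lambda>x. f x + g x) \<in> sq_int M"
proof -
  note [measurable] = sq_intD(1)[OF assms(1)] sq_intD(1)[OF assms(2)]
  have "integrable M (\<lambda>x. (cmod (f x + g x))\<^sup>2)"
    by (rule Bochner_Integration.integrable_bound[where f = "\<lambda>x. 2 * (cmod (f x))\<^sup>2 + 2 * (cmod (g x))\<^sup>2"])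
       (use sq_intD(2)[OF assms(1)] sq_intD(2)[OF assms(2)] cmod_add_sq_le in \<open>auto intro!: AE_I2\<close>)
  then show ?thesis
    by (simp add: sq_int_def)
qed

lemma sq_int_diff:
  assumes "f \<in> sq_int M" "g \<in> sq_int M"
  shows "(\<lambda>x. f x - g x) \<in> sq_int M"
  using sq_int_add[OF assms(1) sq_int_scale[OF assms(2), of "-1"]] by simp

lemma sq_int_sum:
  assumes "\<And>i. i \<in> I \<Longrightarrow> f i \<in> sq_int M"
  shows "(\<lambda>x. \<Sum>i\<in>I. f i x) \<in> sq_int M"
  using assms by (induction I rule: infinite_finite_induct) (auto intro: sq_int_add)

lemma borel_measurable_cnj:
  assumes "f \<in> borel_measurable M"
  shows "(\<lambda>x. cnj (f x)) \<in> borel_measurable M"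
  using measurable_compose[OF assms borel_measurable_continuous_onI[of cnj]]
  by (simp add: continuous_intros)

lemma sq_int_ip_integrable:
  assumes "f \<in> sq_int M" "g \<in> sq_int M"
  shows "integrable M (\<lambda>x. f x * cnj (g x))"
proof -
  note [measurable] = sq_intD(1)[OF assms(1)] sq_intD(1)[OF assms(2)]
  have le: "norm (f x * cnj (g x)) \<le> norm ((cmod (f x))\<^sup>2 + (cmod (g x))\<^sup>2)" for x
  proof -
    have "2 * (cmod (f x) * cmod (g x)) \<le> (cmod (f x))\<^sup>2 + (cmod (g x))\<^sup>2"
      using sum_squares_bound[of "cmod (f x)" "cmod (g x)"] by (simp only: mult.assoc)
    moreover have "0 \<le> cmod (f x) * cmod (g x)"
      by simp
    ultimately have "cmod (f x) * cmod (g x) \<le> (cmod (f x))\<^sup>2 + (cmod (g x))\<^sup>2"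
      by linarith
    then show ?thesis
      by (simp add: norm_mult)
  qed
  show ?thesis
  proof (rule Bochner_Integration.integrable_bound)
    show "integrable M (\<lambda>x. (cmod (f x))\<^sup>2 + (cmod (g x))\<^sup>2)"
      using sq_intD(2)[OF assms(1)] sq_intD(2)[OF assms(2)] by (rule Bochner_Integration.integrable_add)
    show "AE x in M. norm (f x * cnj (g x)) \<le> norm ((cmod (f x))\<^sup>2 + (cmod (g x))\<^sup>2)"
      using le by (intro AE_I2)
  qed (intro borel_measurable_times borel_measurable_cnj sq_intD(1)[OF assms(1)] sq_intD(1)[OF assms(2)])
qed

lemma sq_ip_add:
  assumes "f \<in> sq_int M" "f' \<in> sq_int M" "g \<in> sq_int M"
  shows "sq_ip M (\<lambda>x. f x + f' x) g = sq_ip M f g + sq_ip M f' g"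
  using sq_int_ip_integrable[OF assms(1,3)] sq_int_ip_integrable[OF assms(2,3)]
  by (simp add: sq_ip_def distrib_right)

lemma sq_ip_diff:
  assumes "f \<in> sq_int M" "f' \<in> sq_int M" "g \<in> sq_int M"
  shows "sq_ip M (\<lambda>x. f x - f' x) g = sq_ip M f g - sq_ip M f' g"
  using sq_int_ip_integrable[OF assms(1,3)] sq_int_ip_integrable[OF assms(2,3)]
  by (simp add: sq_ip_def left_diff_distrib)

lemma sq_ip_scale: "sq_ip M (\<lambda>x. c * f x) g = c * sq_ip M f g"
  by (simp add: sq_ip_def mult.assoc)

lemma sq_ip_commute: "sq_ip M g f = cnj (sq_ip M f g)"
proof -
  have "cnj (sq_ip M f g) = (\<integral>x. cnj (f x * cnj (g x)) \<partial>M)"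
    unfolding sq_ip_def by (rule Bochner_Integration.integral_cnj[symmetric])
  then show ?thesis
    by (simp add: sq_ip_def mult.commute)
qed

lemma sq_ip_sum:
  assumes "\<And>i. i \<in> I \<Longrightarrow> f i \<in> sq_int M" "g \<in> sq_int M"
  shows "sq_ip M (\<lambda>x. \<Sum>i\<in>I. f i x) g = (\<Sum>i\<in>I. sq_ip M (f i) g)"
  using assms
proof (induction I rule: infinite_finite_induct)
  case (insert i I)
  then show ?case
    using sq_ip_add[of "f i" M "\<lambda>x. \<Sum>i\<in>I. f i x" g] by (simp add: sq_int_sum)
qed (auto simp: sq_ip_def)

lemma sq_ip_self: "sq_ip M f f = of_real (sq_norm M f)"
proof -
  have "f x * cnj (f x) = of_real ((cmod (f x))\<^sup>2)" for x
    by (rule complex_norm_square[symmetric])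
  then show ?thesis
    unfolding sq_ip_def sq_norm_def by (simp only: integral_complex_of_real)
qed

lemma sq_norm_nonneg: "0 \<le> sq_norm M f"
  by (simp add: sq_norm_def)

lemma sq_norm_scale: "sq_norm M (\<lambda>x. c * f x) = (cmod c)\<^sup>2 * sq_norm M f"
  by (simp add: sq_norm_def norm_mult power_mult_distrib)

lemma sq_norm_zero_iff:
  assumes "f \<in> sq_int M"
  shows "sq_norm M f = 0 \<longleftrightarrow> (AE x in M. f x = 0)"
  unfolding sq_norm_def using integral_nonneg_eq_0_iff_AE[OF sq_intD(2)[OF assms]] by simp

lemma sq_norm_add_le:
  assumes "f \<in> sq_int M" "g \<in> sq_int M"
  shows "sq_norm M (\<lambda>x. f x + g x) \<le> 2 * sq_norm M f + 2 * sq_norm M g"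
proof -
  have "sq_norm M (\<lambda>x. f x + g x) \<le> (\<integral>x. 2 * (cmod (f x))\<^sup>2 + 2 * (cmod (g x))\<^sup>2 \<partial>M)"
    unfolding sq_norm_def
    using sq_intD(2)[OF sq_int_add[OF assms]] sq_intD(2)[OF assms(1)] sq_intD(2)[OF assms(2)]
    by (intro integral_mono) (auto intro: cmod_add_sq_le)
  also have "\<dots> = 2 * sq_norm M f + 2 * sq_norm M g"
    using sq_intD(2)[OF assms(1)] sq_intD(2)[OF assms(2)] by (simp add: sq_norm_def)
  finally show ?thesis .
qed

lemma sq_norm_diff_commute: "sq_norm M (\<lambda>x. f x - g x) = sq_norm M (\<lambda>x. g x - f x)"
  by (simp add: sq_norm_def norm_minus_commute)

lemma sq_norm_diff_le:
  assumes "f \<in> sq_int M" "g \<in> sq_int M" "h \<in> sq_int M"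
  shows "sq_norm M (\<lambda>x. f x - h x) \<le> 2 * sq_norm M (\<lambda>x. f x - g x) + 2 * sq_norm M (\<lambda>x. g x - h x)"
  using sq_norm_add_le[OF sq_int_diff[OF assms(1,2)] sq_int_diff[OF assms(2,3)]] by simp

lemma sq_norm_diff_expand:
  assumes "f \<in> sq_int M" "g \<in> sq_int M"
  shows "sq_norm M (\<lambda>x. f x - g x) = sq_norm M f + sq_norm M g - 2 * Re (sq_ip M f g)"
proof -
  have "(cmod (f x - g x))\<^sup>2 = (cmod (f x))\<^sup>2 + (cmod (g x))\<^sup>2 - 2 * Re (f x * cnj (g x))" for x
    unfolding cmod_power2 by (simp add: power2_eq_square algebra_simps)
  moreover have "Re (sq_ip M f g) = (\<integral>x. Re (f x * cnj (g x)) \<partial>M)"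
    unfolding sq_ip_def by (rule integral_Re[symmetric, OF sq_int_ip_integrable[OF assms]])
  moreover have "integrable M (\<lambda>x. Re (f x * cnj (g x)))"
    using sq_int_ip_integrable[OF assms] by (rule integrable_Re)
  ultimately show ?thesis
    unfolding sq_norm_def using sq_intD(2)[OF assms(1)] sq_intD(2)[OF assms(2)]
    by (simp del: times_complex.sel)
qed

text \<open>Each pair of squares differs by four times a real part, and replacing \<open>g\<close>
  by \<open>\<i> * g\<close> turns the real part into the imaginary part. This reduces preservation
  of inner products to preservation of norms.\<close>

lemma sq_ip_polarization:
  assumes "f \<in> sq_int M" "g \<in> sq_int M"
  shows "4 * sq_ip M f g =
    of_real (sq_norm M (\<lambda>x. f x + g x)) - of_real (sq_norm M (\<lambda>x. f x - g x))
    + \<i> * of_real (sq_norm M (\<lambda>x. f x + \<i> * g x)) - \<i> * of_real (sq_norm M (\<lambda>x. f x - \<i> * g x))"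
proof -
  note ig = sq_int_scale[OF assms(2), of \<i>]
  have p: "sq_norm M (\<lambda>x. f x + h x) - sq_norm M (\<lambda>x. f x - h x) = 4 * Re (sq_ip M f h)"
    if h: "h \<in> sq_int M" for h
  proof -
    have "sq_norm M (\<lambda>x. f x + h x) = sq_norm M f + sq_norm M h + 2 * Re (sq_ip M f h)"
    proof -
      \<comment> \<open>Scalars have been pulled out of the first argument only, so both sides are
        conjugated first.\<close>
      have "Re (sq_ip M f (\<lambda>x. - 1 * h x)) = - Re (sq_ip M f h)"
        by (subst (1 2) sq_ip_commute) (simp only: sq_ip_scale, simp)
      then show ?thesis
        using sq_norm_diff_expand[OF assms(1) sq_int_scale[OF h, of "-1"]] sq_norm_scale[of M "-1" h]
        by simp
    qed
    then show ?thesis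
      using sq_norm_diff_expand[OF assms(1) h] by simp
  qed
  have "Re (sq_ip M f (\<lambda>x. \<i> * g x)) = Im (sq_ip M f g)"
    by (subst (1 2) sq_ip_commute) (simp add: sq_ip_scale)
  then show ?thesis
    using p[OF assms(2)] p[OF ig] by (simp add: complex_eq_iff)
qed

text \<open>The classical argument: a subsequence whose squared increments decay like 4^-k converges
  almost everywhere, and Fatou's lemma turns the Cauchy bounds into bounds on the distance to its
  limit.\<close>

lemma sq_int_complete:
  assumes f: "\<And>n. f n \<in> sq_int M"
    and cauchy: "\<And>\<delta>. \<delta> > 0 \<Longrightarrow> \<exists>N. \<forall>i\<ge>N. \<forall>j\<ge>N. sq_norm M (\<lambda>x. f i x - f j x) < \<delta>"
  obtains g where "g \<in> sq_int M" "(\<lambda>n. sq_norm M (\<lambda>x. f n x - g x)) \<longlonglongrightarrow> 0"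
proof -
  note [measurable] = sq_intD(1)[OF f]
  have "\<exists>N. \<forall>k. (\<forall>i\<ge>N k. \<forall>j\<ge>N k. sq_norm M (\<lambda>x. f i x - f j x) < (1/4) ^ k) \<and> N k \<le> N (Suc k)"
  proof (rule dependent_nat_choice)
    show "\<exists>N. \<forall>i\<ge>N. \<forall>j\<ge>N. sq_norm M (\<lambda>x. f i x - f j x) < (1/4) ^ 0"
      using cauchy[of 1] by simp
  next
    fix N k
    obtain N' where "\<forall>i\<ge>N'. \<forall>j\<ge>N'. sq_norm M (\<lambda>x. f i x - f j x) < (1/4) ^ Suc k"
      using cauchy[of "(1/4) ^ Suc k"] by auto
    then show "\<exists>N'. (\<forall>i\<ge>N'. \<forall>j\<ge>N'. sq_norm M (\<lambda>x. f i x - f j x) < (1/4) ^ Suc k) \<and> N \<le> N'"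
      by (intro exI[of _ "max N N'"]) auto
  qed
  then obtain N where N: "\<And>k i j. i \<ge> N k \<Longrightarrow> j \<ge> N k \<Longrightarrow> sq_norm M (\<lambda>x. f i x - f j x) < (1/4) ^ k"
    and N_Suc: "\<And>k. N k \<le> N (Suc k)"
    by blast
  have N_mono: "i \<le> j \<Longrightarrow> N i \<le> N j" for i j
    using N_Suc by (rule lift_Suc_mono_le)
  have nn: "(\<integral>\<^sup>+x. ennreal ((cmod (f i x - f j x))\<^sup>2) \<partial>M) = ennreal (sq_norm M (\<lambda>x. f i x - f j x))" for i j
    unfolding sq_norm_def
    by (rule nn_integral_eq_integral) (use sq_intD(2)[OF sq_int_diff[OF f f]] in auto)
  \<comment> \<open>The weight 2^k used below serves two ends: the integrals of 2^k D^2 are at most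
    2^-k, hence summable, while 2 D \<le> 2^k D^2 + 2^-k turns finiteness of the weighted sum into
    summability of \<open>D\<close> itself.\<close>
  define D where "D k x = cmod (f (N (Suc k)) x - f (N k) x)" for k x
  have [measurable]: "D k \<in> borel_measurable M" for k
    unfolding D_def by measurable
  have "(\<integral>\<^sup>+x. (\<Sum>k. ennreal (2 ^ k * (D k x)\<^sup>2)) \<partial>M) = (\<Sum>k. \<integral>\<^sup>+x. ennreal (2 ^ k * (D k x)\<^sup>2) \<partial>M)"
    by (rule nn_integral_suminf) measurable
  also have "\<dots> \<le> (\<Sum>k. ennreal ((1/2) ^ k))"
  proof (rule suminf_le)
    fix k
    have "(\<integral>\<^sup>+x. ennreal (2 ^ k * (D k x)\<^sup>2) \<partial>M) = ennreal (2 ^ k) * (\<integral>\<^sup>+x. ennreal ((D k x)\<^sup>2) \<partial>M)"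
      by (simp add: ennreal_mult nn_integral_cmult)
    also have "\<dots> = ennreal (2 ^ k * sq_norm M (\<lambda>x. f (N (Suc k)) x - f (N k) x))"
      unfolding D_def nn by (simp add: ennreal_mult sq_norm_nonneg)
    also have "\<dots> \<le> ennreal (2 ^ k * (1/4) ^ k)"
      using N[of k "N (Suc k)" "N k"] N_Suc[of k] by (intro ennreal_leI mult_left_mono) auto
    also have "2 ^ k * (1/4) ^ k = ((1/2) ^ k :: real)"
      by (simp flip: power_mult_distrib)
    finally show "(\<integral>\<^sup>+x. ennreal (2 ^ k * (D k x)\<^sup>2) \<partial>M) \<le> ennreal ((1/2) ^ k)" .
  qed auto
  also have "\<dots> = ennreal (\<Sum>k. (1/2) ^ k)"
    by (rule suminf_ennreal2) (auto simp: summable_geometric)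
  finally have "(\<integral>\<^sup>+x. (\<Sum>k. ennreal (2 ^ k * (D k x)\<^sup>2)) \<partial>M) \<noteq> \<infinity>"
    by (metis ennreal_less_top infinity_ennreal_def leD top_neq_ennreal top.not_eq_extremum)
  then have "AE x in M. (\<Sum>k. ennreal (2 ^ k * (D k x)\<^sup>2)) \<noteq> \<infinity>"
    by (intro nn_integral_PInf_AE) auto
  then have conv: "AE x in M. convergent (\<lambda>k. f (N k) x)"
  proof eventually_elim
    case (elim x)
    have "summable (\<lambda>k. 2 ^ k * (D k x)\<^sup>2)"
      using elim by (intro summable_suminf_not_top) auto
    then have "summable (\<lambda>k. 2 ^ k * (D k x)\<^sup>2 + (1/2) ^ k)"
      by (intro summable_add summable_geometric) auto
    then have "summable (\<lambda>k. D k x)"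
    proof (rule summable_comparison_test'[where N = 0])
      fix k
      have "2 * (sqrt (2 ^ k) * D k x) * sqrt ((1/2) ^ k) \<le> (sqrt (2 ^ k) * D k x)\<^sup>2 + (sqrt ((1/2) ^ k))\<^sup>2"
        by (rule sum_squares_bound)
      moreover have "2 * (sqrt (2 ^ k) * D k x) * sqrt ((1/2) ^ k) = 2 * D k x"
      proof -
        have "sqrt (2 ^ k) * sqrt ((1/2) ^ k) = 1"
          by (simp flip: real_sqrt_mult power_mult_distrib)
        then show ?thesis by (simp add: mult_ac)
      qed
      ultimately have "2 * D k x \<le> 2 ^ k * (D k x)\<^sup>2 + (1/2) ^ k"
        by (simp add: power_mult_distrib)
      moreover have "0 \<le> D k x"
        by (simp add: D_def)
      ultimately show "norm (D k x) \<le> 2 ^ k * (D k x)\<^sup>2 + (1/2) ^ k"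
        by simp
    qed
    then have "summable (\<lambda>k. f (N (Suc k)) x - f (N k) x)"
      unfolding D_def by (rule summable_norm_cancel)
    then have "convergent (\<lambda>k. f (N k) x - f (N 0) x)"
      using sum_lessThan_telescope[of "\<lambda>k. f (N k) x"] by (simp add: summable_iff_convergent)
    then show ?case
      using convergent_diff_const_right_iff[of "\<lambda>k. f (N k) x" "f (N 0) x"] by simp
  qed
  \<comment> \<open>On the null set where the subsequence diverges, \<open>lim\<close> is an
    unspecified value; measurability is unaffected.\<close>
  define g where "g x = lim (\<lambda>k. f (N k) x)" for x
  have [measurable]: "g \<in> borel_measurable M"
    unfolding g_def by measurable
  have bound: "(\<integral>\<^sup>+x. ennreal ((cmod (f n x - g x))\<^sup>2) \<partial>M) \<le> ennreal ((1/4) ^ k)" if "n \<ge> N k" for n k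
  proof -
    have "(\<integral>\<^sup>+x. ennreal ((cmod (f n x - g x))\<^sup>2) \<partial>M)
        = (\<integral>\<^sup>+x. liminf (\<lambda>j. ennreal ((cmod (f n x - f (N j) x))\<^sup>2)) \<partial>M)"
    proof (rule nn_integral_cong_AE)
      show "AE x in M. ennreal ((cmod (f n x - g x))\<^sup>2) = liminf (\<lambda>j. ennreal ((cmod (f n x - f (N j) x))\<^sup>2))"
        using conv
      proof eventually_elim
        case (elim x)
        then have "(\<lambda>j. f (N j) x) \<longlonglongrightarrow> g x"
          by (simp add: g_def convergent_LIMSEQ_iff)
        then have "(\<lambda>j. ennreal ((cmod (f n x - f (N j) x))\<^sup>2)) \<longlonglongrightarrow> ennreal ((cmod (f n x - g x))\<^sup>2)"
          by (intro tendsto_intros tendsto_ennrealI)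
        then show ?case
          by (rule lim_imp_Liminf[symmetric, rotated]) simp
      qed
    qed
    also have "\<dots> \<le> liminf (\<lambda>j. \<integral>\<^sup>+x. ennreal ((cmod (f n x - f (N j) x))\<^sup>2) \<partial>M)"
      by (rule nn_integral_liminf) measurable
    also have "\<dots> \<le> ennreal ((1/4) ^ k)"
    proof (rule Liminf_le)
      have "(\<integral>\<^sup>+x. ennreal ((cmod (f n x - f (N j) x))\<^sup>2) \<partial>M) \<le> ennreal ((1/4) ^ k)" if "j \<ge> k" for j
        unfolding nn using N[OF \<open>n \<ge> N k\<close> N_mono[OF that]] by (intro ennreal_leI) simp
      then show "\<forall>\<^sub>F j in sequentially. (\<integral>\<^sup>+x. ennreal ((cmod (f n x - f (N j) x))\<^sup>2) \<partial>M) \<le> ennreal ((1/4) ^ k)"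
        by (auto simp: eventually_sequentially)
    qed simp
    finally show ?thesis .
  qed
  have diff: "(\<lambda>x. f n x - g x) \<in> sq_int M" if "n \<ge> N k" for n k
  proof -
    have "integrable M (\<lambda>x. (cmod (f n x - g x))\<^sup>2)"
      using bound[OF that] by (intro integrableI_nonneg) (auto simp: le_less_trans[OF _ ennreal_less_top])
    then show ?thesis
      by (simp add: sq_int_def)
  qed
  have le: "sq_norm M (\<lambda>x. f n x - g x) \<le> (1/4) ^ k" if "n \<ge> N k" for n k
  proof -
    have "ennreal (sq_norm M (\<lambda>x. f n x - g x)) = (\<integral>\<^sup>+x. ennreal ((cmod (f n x - g x))\<^sup>2) \<partial>M)"
      unfolding sq_norm_def
      by (rule nn_integral_eq_integral[symmetric]) (use sq_intD(2)[OF diff[OF that]] in auto)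
    then have "ennreal (sq_norm M (\<lambda>x. f n x - g x)) \<le> ennreal ((1/4) ^ k)"
      using bound[OF that] by simp
    then show ?thesis
      by (subst (asm) ennreal_le_iff) auto
  qed
  show ?thesis
  proof
    \<comment> \<open>Here \<open>g\<close> is written as f - (f - g) for the member
      \<open>f\<close> of index \<open>N 0\<close>, both terms being square integrable.\<close>
    show "g \<in> sq_int M"
      using sq_int_diff[OF f diff[of 0 "N 0"], of "N 0"] by simp
    show "(\<lambda>n. sq_norm M (\<lambda>x. f n x - g x)) \<longlonglongrightarrow> 0"
    proof (rule LIMSEQ_I)
      fix \<delta> :: real assume "\<delta> > 0"
      then obtain k where k: "(1/4) ^ k < \<delta>"
        using real_arch_pow_inv[of \<delta> "1/4"] by auto
      have "norm (sq_norm M (\<lambda>x. f n x - g x) - 0) < \<delta>" if "n \<ge> N k" for n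
        using le[OF that] k sq_norm_nonneg[of M "\<lambda>x. f n x - g x"] by simp
      then show "\<exists>n0. \<forall>n\<ge>n0. norm (sq_norm M (\<lambda>x. f n x - g x) - 0) < \<delta>"
        by blast
    qed
  qed
qed

section \<open>Orthonormalisation and the isometry onto a space of sequences\<close>

lemma sq_int_psum:
  assumes "\<And>i. e i \<in> sq_int M"
  shows "(\<lambda>t. \<Sum>i\<in>I. c i * e i t) \<in> sq_int M"
  by (intro sq_int_sum sq_int_scale assms)

lemma sq_ip_cong_AE:
  assumes "f \<in> sq_int M" "f' \<in> sq_int M" "g \<in> sq_int M" "AE x in M. f x = f' x"
  shows "sq_ip M f g = sq_ip M f' g"
  unfolding sq_ip_def
  by (rule integral_cong_AE) (use assms in \<open>auto intro!: borel_measurable_times borel_measurable_cnj dest: sq_intD(1)\<close>)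

lemma sq_norm_cong_AE:
  assumes "f \<in> sq_int M" "f' \<in> sq_int M" "AE x in M. f x = f' x"
  shows "sq_norm M f = sq_norm M f'"
  unfolding sq_norm_def
proof (rule integral_cong_AE)
  show "AE x in M. (cmod (f x))\<^sup>2 = (cmod (f' x))\<^sup>2"
    using assms(3) by eventually_elim simp
qed (use sq_intD(2)[OF assms(1)] sq_intD(2)[OF assms(2)] in auto)

text \<open>Totality is stated dually, by orthogonality, rather than as density of the span: this is
  the form that a pi-system argument can verify for indicators. Density is recovered from the
  orthonormal expansion.\<close>

locale total_family =
  fixes M :: "'x measure" and a :: "nat \<Rightarrow> 'x \<Rightarrow> complex"
  assumes fam_sq_int: "a n \<in> sq_int M"
    and fam_total: "\<lbrakk>f \<in> sq_int M; \<And>n. sq_ip M f (a n) = 0\<rbrakk> \<Longrightarrow> AE x in M. f x = 0"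
begin

text \<open>A vector that depends on its predecessors yields the zero function, because the normalisation
  then divides by \<open>0\<close>.\<close>

function gs :: "nat \<Rightarrow> 'x \<Rightarrow> complex" where
  "gs n = (let r = (\<lambda>x. a n x - (\<Sum>i<n. sq_ip M (a n) (gs i) * gs i x))
           in (\<lambda>x. of_real (1 / sqrt (sq_norm M r)) * r x))"
  by pat_completeness auto
termination by (relation less_than) auto

declare gs.simps [simp del]

definition gs_res :: "nat \<Rightarrow> 'x \<Rightarrow> complex" where
  "gs_res n = (\<lambda>x. a n x - (\<Sum>i<n. sq_ip M (a n) (gs i) * gs i x))"

lemma gs_eq: "gs n = (\<lambda>x. of_real (1 / sqrt (sq_norm M (gs_res n))) * gs_res n x)"
  by (subst gs.simps) (simp add: Let_def gs_res_def)

lemma gs_sq_int [simp]: "gs n \<in> sq_int M"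
proof (induction n rule: less_induct)
  case (less n)
  then have "gs_res n \<in> sq_int M"
    unfolding gs_res_def by (intro sq_int_diff fam_sq_int sq_int_sum sq_int_scale) auto
  then show ?case
    by (subst gs_eq) (rule sq_int_scale)
qed

lemma gs_res_sq_int: "gs_res n \<in> sq_int M"
  unfolding gs_res_def by (intro sq_int_diff fam_sq_int sq_int_psum gs_sq_int)

lemma gs_res_eq:
  assumes "sq_norm M (gs_res n) \<noteq> 0"
  shows "gs_res n = (\<lambda>x. of_real (sqrt (sq_norm M (gs_res n))) * gs n x)"
  by (subst gs_eq) (use assms in \<open>simp add: fun_eq_iff flip: mult.assoc of_real_mult\<close>)

lemma gs_zero_or_unit: "gs n = (\<lambda>_. 0) \<or> sq_norm M (gs n) = 1"
proof (cases "sq_norm M (gs_res n) = 0")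
  case True
  then show ?thesis by (subst gs_eq) simp
next
  case False
  have "sq_norm M (gs n) = 1"
    by (subst gs_eq, subst sq_norm_scale)
       (use False sq_norm_nonneg[of M "gs_res n"] in \<open>simp add: norm_divide power_divide\<close>)
  then show ?thesis ..
qed

text \<open>By strong induction and hermitian symmetry, only the term with index \<open>i\<close>
  survives in the inner product of the subtracted sum with \<open>gs i\<close>, and it cancels the
  component of \<open>a n\<close> along \<open>gs i\<close>.\<close>

lemma gs_orth_less: "i < n \<Longrightarrow> sq_ip M (gs n) (gs i) = 0"
proof (induction n arbitrary: i rule: less_induct)
  case (less n)
  have "sq_ip M (gs_res n) (gs i)
      = sq_ip M (a n) (gs i) - (\<Sum>k<n. sq_ip M (a n) (gs k) * sq_ip M (gs k) (gs i))"
    unfolding gs_res_def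
    by (subst sq_ip_diff) (auto simp: fam_sq_int sq_int_psum sq_ip_sum sq_int_scale sq_ip_scale)
  also have "(\<Sum>k<n. sq_ip M (a n) (gs k) * sq_ip M (gs k) (gs i))
      = (\<Sum>k\<in>{i}. sq_ip M (a n) (gs k) * sq_ip M (gs k) (gs i))"
  proof (rule sum.mono_neutral_right)
    show "\<forall>k\<in>{..<n} - {i}. sq_ip M (a n) (gs k) * sq_ip M (gs k) (gs i) = 0"
    proof
      fix k assume k: "k \<in> {..<n} - {i}"
      have "sq_ip M (gs k) (gs i) = 0"
      proof (cases "i < k")
        case True
        then show ?thesis using less.IH k by auto
      next
        case False
        then show ?thesis using less.IH[of i k] k less.prems sq_ip_commute[of M "gs k" "gs i"] by auto
      qed
      then show "sq_ip M (a n) (gs k) * sq_ip M (gs k) (gs i) = 0" by simp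
    qed
  qed (use less.prems in auto)
  \<comment> \<open>If \<open>gs i\<close> is a unit vector the second factor is 1; if it is the
    zero function both sides are 0.\<close>
  also have "\<dots> = sq_ip M (a n) (gs i)"
    using gs_zero_or_unit[of i] by (auto simp: sq_ip_self) (simp_all add: sq_ip_def)
  finally show ?case
    by (subst gs_eq, subst sq_ip_scale) simp
qed

lemma gs_orth: "i \<noteq> j \<Longrightarrow> sq_ip M (gs i) (gs j) = 0"
  using gs_orth_less[of i j] gs_orth_less[of j i] sq_ip_commute[of M "gs i" "gs j"]
  by (cases "i < j") auto

section \<open>The coefficient map and its image\<close>

definition coef :: "('x \<Rightarrow> complex) \<Rightarrow> nat \<Rightarrow> complex" where
  "coef f n = sq_ip M f (gs n)"

text \<open>The image of \<open>coef\<close>. An index at which orthonormalisation produced the zero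
  function carries no coordinate, so this may be a proper closed subspace of \<open>l2\<close>, even
  a finite-dimensional one.\<close>

definition coef_space :: "(nat \<Rightarrow> complex) set" where
  "coef_space = {x \<in> l2. \<forall>n. gs n = (\<lambda>_. 0) \<longrightarrow> x n = 0}"

lemma coef_zero: "gs n = (\<lambda>_. 0) \<Longrightarrow> coef f n = 0"
  by (simp add: coef_def sq_ip_def)

lemma coef_add: "f \<in> sq_int M \<Longrightarrow> g \<in> sq_int M \<Longrightarrow> coef (\<lambda>x. f x + g x) = (\<lambda>n. coef f n + coef g n)"
  by (simp add: coef_def sq_ip_add fun_eq_iff)

lemma coef_diff: "f \<in> sq_int M \<Longrightarrow> g \<in> sq_int M \<Longrightarrow> coef (\<lambda>x. f x - g x) = (\<lambda>n. coef f n - coef g n)"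
  by (simp add: coef_def sq_ip_diff fun_eq_iff)

lemma coef_scale: "coef (\<lambda>x. c * f x) = (\<lambda>n. c * coef f n)"
  by (simp add: coef_def sq_ip_scale fun_eq_iff)

text \<open>Up to multiples of earlier \<open>gs k\<close>, the function \<open>a n\<close> is
  \<open>gs_res n\<close>, which is either a multiple of \<open>gs n\<close> or null. So
  orthogonality to all \<open>gs n\<close> gives orthogonality to all \<open>a n\<close>, and
  totality applies.\<close>

lemma gs_complete:
  assumes f: "f \<in> sq_int M" and z: "\<And>n. coef f n = 0"
  shows "AE x in M. f x = 0"
proof (rule fam_total[OF f])
  fix n
  have "sq_ip M (gs_res n) f = 0"
  proof (cases "sq_norm M (gs_res n) = 0")
    case True
    then have "AE x in M. gs_res n x = 0"
      using sq_norm_zero_iff gs_res_sq_int by blast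
    then have "sq_ip M (gs_res n) f = sq_ip M (\<lambda>_. 0) f"
      using gs_res_sq_int f by (intro sq_ip_cong_AE) auto
    then show ?thesis by (simp add: sq_ip_def)
  next
    case False
    then show ?thesis
      by (subst gs_res_eq) (use z[of n] in \<open>auto simp: sq_ip_scale coef_def sq_ip_commute[of M "gs n" f]\<close>)
  qed
  moreover have "sq_ip M (gs_res n) f = sq_ip M (a n) f - (\<Sum>k<n. sq_ip M (a n) (gs k) * sq_ip M (gs k) f)"
    unfolding gs_res_def using f
    by (subst sq_ip_diff) (auto simp: fam_sq_int sq_int_psum sq_ip_sum sq_int_scale sq_ip_scale)
  moreover have "sq_ip M (gs k) f = 0" for k
    using z[of k] by (simp add: coef_def sq_ip_commute[of M "gs k" f])
  ultimately have "sq_ip M (a n) f = 0"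
    by simp
  then show "sq_ip M f (a n) = 0"
    by (simp add: sq_ip_commute[of M f])
qed

lemma coef_psum:
  assumes x: "\<And>n. gs n = (\<lambda>_. 0) \<Longrightarrow> x n = 0" and I: "finite I"
  shows "coef (\<lambda>t. \<Sum>i\<in>I. x i * gs i t) j = (if j \<in> I then x j else 0)"
proof -
  have "coef (\<lambda>t. \<Sum>i\<in>I. x i * gs i t) j = (\<Sum>i\<in>I. x i * sq_ip M (gs i) (gs j))"
    by (simp add: coef_def sq_ip_sum sq_int_scale sq_ip_scale)
  also have "\<dots> = (\<Sum>i\<in>I. if i = j then x j else 0)"
  proof (rule sum.cong[OF refl])
    fix i
    show "x i * sq_ip M (gs i) (gs j) = (if i = j then x j else 0)"
      using gs_zero_or_unit[of j] x[of j] gs_orth[of i j] by (auto simp: sq_ip_self)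
  qed
  finally show ?thesis
    using I by simp
qed

lemma sq_ip_psum:
  assumes "f \<in> sq_int M"
  shows "sq_ip M f (\<lambda>t. \<Sum>i\<in>I. x i * gs i t) = (\<Sum>i\<in>I. coef f i * cnj (x i))"
proof -
  have "sq_ip M (\<lambda>t. \<Sum>i\<in>I. x i * gs i t) f = (\<Sum>i\<in>I. x i * sq_ip M (gs i) f)"
    using assms by (simp add: sq_ip_sum sq_int_scale sq_ip_scale)
  then show ?thesis
    by (subst sq_ip_commute) (simp add: coef_def sq_ip_commute[of M _ f] mult.commute)
qed

lemma sq_norm_psum:
  assumes x: "\<And>n. gs n = (\<lambda>_. 0) \<Longrightarrow> x n = 0" and I: "finite I"
  shows "sq_norm M (\<lambda>t. \<Sum>i\<in>I. x i * gs i t) = (\<Sum>i\<in>I. (cmod (x i))\<^sup>2)"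
proof -
  let ?s = "\<lambda>t. \<Sum>i\<in>I. x i * gs i t"
  have "complex_of_real (sq_norm M ?s) = (\<Sum>i\<in>I. coef ?s i * cnj (x i))"
    unfolding sq_ip_self[symmetric] by (rule sq_ip_psum) (rule sq_int_psum, simp)
  also have "\<dots> = (\<Sum>i\<in>I. of_real ((cmod (x i))\<^sup>2))"
  proof (rule sum.cong[OF refl])
    fix i assume "i \<in> I"
    then have "coef ?s i = x i"
      using coef_psum[where x = x and I = I] x I by simp
    then show "coef ?s i * cnj (x i) = of_real ((cmod (x i))\<^sup>2)"
      by (simp only: complex_norm_square)
  qed
  finally show ?thesis
    by (simp only: of_real_sum[symmetric] of_real_eq_iff)
qed

lemma bessel_eq:
  assumes f: "f \<in> sq_int M" and I: "finite I"
  shows "sq_norm M (\<lambda>t. f t - (\<Sum>i\<in>I. coef f i * gs i t)) = sq_norm M f - (\<Sum>i\<in>I. (cmod (coef f i))\<^sup>2)"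
proof -
  have "sq_ip M f (\<lambda>t. \<Sum>i\<in>I. coef f i * gs i t) = of_real (\<Sum>i\<in>I. (cmod (coef f i))\<^sup>2)"
    unfolding sq_ip_psum[OF f] by (simp only: complex_norm_square of_real_sum)
  then have "Re (sq_ip M f (\<lambda>t. \<Sum>i\<in>I. coef f i * gs i t)) = (\<Sum>i\<in>I. (cmod (coef f i))\<^sup>2)"
    by (simp only: Re_complex_of_real)
  moreover have "sq_norm M (\<lambda>t. \<Sum>i\<in>I. coef f i * gs i t) = (\<Sum>i\<in>I. (cmod (coef f i))\<^sup>2)"
    by (rule sq_norm_psum[OF coef_zero I])
  ultimately show ?thesis
    using sq_norm_diff_expand[OF f sq_int_psum[where e = gs and I = I and c = "coef f"]] by simp
qed

lemma bessel:
  assumes "f \<in> sq_int M" "finite I"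
  shows "(\<Sum>i\<in>I. (cmod (coef f i))\<^sup>2) \<le> sq_norm M f"
  using bessel_eq[OF assms] sq_norm_nonneg[of M "\<lambda>t. f t - (\<Sum>i\<in>I. coef f i * gs i t)"] by simp

lemma coef_in_space: 
  assumes "f \<in> sq_int M"
  shows "coef f \<in> coef_space"
proof -
  have "summable (\<lambda>n. (cmod (coef f n))\<^sup>2)"
    by (rule summableI_nonneg_bounded[where x = "sq_norm M f"]) (use bessel[OF assms] in auto)
  then show ?thesis
    by (auto simp: coef_space_def l2_def coef_zero)
qed

text \<open>Squared distances of partial sums are blocks of the convergent series of squares, so
  completeness supplies a limit. Bessel's inequality for the single index \<open>j\<close>, applied
  to partial sum minus limit, identifies the coefficient of the limit there.\<close>

lemma riesz_fischer:
  assumes "x \<in> coef_space"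
  obtains f where "f \<in> sq_int M" "coef f = x"
    "(\<lambda>N. sq_norm M (\<lambda>t. (\<Sum>i<N. x i * gs i t) - f t)) \<longlonglongrightarrow> 0"
proof -
  have x0: "gs n = (\<lambda>_. 0) \<Longrightarrow> x n = 0" for n
    using assms by (auto simp: coef_space_def)
  have summ: "summable (\<lambda>n. (cmod (x n))\<^sup>2)"
    using assms by (auto simp: coef_space_def l2_def)
  define S where "S N t = (\<Sum>i<N. x i * gs i t)" for N t
  have S: "S N \<in> sq_int M" for N
    unfolding S_def by (rule sq_int_psum) simp
  have S_diff: "sq_norm M (\<lambda>t. S n t - S m t) = (\<Sum>i\<in>{m..<n}. (cmod (x i))\<^sup>2)" if "m \<le> n" for m n
  proof -
    have "S n t - S m t = (\<Sum>i\<in>{m..<n}. x i * gs i t)" for t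
      unfolding S_def using that by (simp add: sum_diff_nat_ivl flip: atLeast0LessThan)
    then show ?thesis
      using sq_norm_psum[where x = x, OF x0] by simp
  qed
  have "\<exists>N. \<forall>i\<ge>N. \<forall>j\<ge>N. sq_norm M (\<lambda>t. S i t - S j t) < \<delta>" if \<delta>: "\<delta> > 0" for \<delta>
  proof -
    obtain N where N: "\<And>m n. m \<ge> N \<Longrightarrow> norm (\<Sum>i\<in>{m..<n}. (cmod (x i))\<^sup>2) < \<delta>"
      using summ \<delta> unfolding summable_Cauchy by blast
    have "sq_norm M (\<lambda>t. S i t - S j t) < \<delta>" if "i \<ge> N" "j \<ge> N" for i j
    proof (cases "j \<le> i")
      case True
      then show ?thesis using S_diff N[of j i] that by simp
    next
      case False
      then show ?thesis
        using S_diff[of i j] N[of i j] that by (subst sq_norm_diff_commute) simp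
    qed
    then show ?thesis by blast
  qed
  then obtain f where f: "f \<in> sq_int M" and lim: "(\<lambda>N. sq_norm M (\<lambda>t. S N t - f t)) \<longlonglongrightarrow> 0"
    using sq_int_complete[of S M] S by blast
  have "coef f j = x j" for j
  proof -
    have "(\<lambda>N. (cmod (x j - coef f j))\<^sup>2) \<longlonglongrightarrow> 0"
    proof (rule Lim_null_comparison[OF _ lim])
      show "\<forall>\<^sub>F N in sequentially. norm ((cmod (x j - coef f j))\<^sup>2) \<le> sq_norm M (\<lambda>t. S N t - f t)"
        unfolding eventually_sequentially
      proof (intro exI allI impI)
        fix N assume "Suc j \<le> N"
        then have "coef (S N) j = x j"
          unfolding S_def using coef_psum[where x = x, OF x0] by simp
        then show "norm ((cmod (x j - coef f j))\<^sup>2) \<le> sq_norm M (\<lambda>t. S N t - f t)"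
          using bessel[OF sq_int_diff[OF S f], of "{j}" N] coef_diff[OF S f, of N] by simp
      qed
    qed
    then show ?thesis
      by (simp add: LIMSEQ_const_iff)
  qed
  then show ?thesis
    using that[OF f] lim unfolding S_def by blast
qed

text \<open>The expansion converges to some function with the coefficients of \<open>f\<close>; the
  difference has all coefficients zero, hence is null by \<open>gs_complete\<close>.\<close>

lemma psum_coef_tendsto:
  assumes f: "f \<in> sq_int M"
  shows "(\<lambda>N. sq_norm M (\<lambda>t. (\<Sum>i<N. coef f i * gs i t) - f t)) \<longlonglongrightarrow> 0"
proof -
  obtain f' where f': "f' \<in> sq_int M" "coef f' = coef f"
    and lim: "(\<lambda>N. sq_norm M (\<lambda>t. (\<Sum>i<N. coef f i * gs i t) - f' t)) \<longlonglongrightarrow> 0"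
    using riesz_fischer[OF coef_in_space[OF f]] by blast
  have "AE x in M. f' x - f x = 0"
    by (rule gs_complete) (use f f' in \<open>auto simp: coef_diff sq_int_diff\<close>)
  then have "sq_norm M (\<lambda>t. (\<Sum>i<N. coef f i * gs i t) - f' t)
      = sq_norm M (\<lambda>t. (\<Sum>i<N. coef f i * gs i t) - f t)" for N
    by (intro sq_norm_cong_AE sq_int_diff sq_int_psum gs_sq_int f f') (auto elim: AE_mp)
  then show ?thesis
    using lim by simp
qed

lemma parseval:
  assumes f: "f \<in> sq_int M"
  shows "(\<lambda>n. (cmod (coef f n))\<^sup>2) sums sq_norm M f"
proof -
  have "(\<lambda>N. sq_norm M f - (\<Sum>i<N. (cmod (coef f i))\<^sup>2)) \<longlonglongrightarrow> 0"
    using psum_coef_tendsto[OF f] unfolding sq_norm_diff_commute[of M _ f] by (simp add: bessel_eq[OF f])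
  from tendsto_diff[OF tendsto_const[of "sq_norm M f"] this] show ?thesis
    by (simp add: sums_def)
qed

text \<open>Orthonormalisation uses only linear combinations, so \<open>P\<close> reaches every
  \<open>gs n\<close>, then every partial expansion, then the limit. It serves to extend strong
  continuity from the family to all of L2.\<close>

lemma total_family_induct [consumes 1, case_names fam add scale lim]:
  assumes "f \<in> sq_int M"
    and fam: "\<And>n. P (a n)"
    and add: "\<And>f g. \<lbrakk>f \<in> sq_int M; g \<in> sq_int M; P f; P g\<rbrakk> \<Longrightarrow> P (\<lambda>x. f x + g x)"
    and scale: "\<And>c f. \<lbrakk>f \<in> sq_int M; P f\<rbrakk> \<Longrightarrow> P (\<lambda>x. c * f x)"
    and lim: "\<And>f g. \<lbrakk>\<And>n. g n \<in> sq_int M; \<And>n. P (g n); f \<in> sq_int M;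
                (\<lambda>n. sq_norm M (\<lambda>x. g n x - f x)) \<longlonglongrightarrow> 0\<rbrakk> \<Longrightarrow> P f"
  shows "P f"
proof -
  have zero: "P (\<lambda>_. 0)"
    using scale[OF fam_sq_int fam, of 0] by simp
  have sum: "P (\<lambda>x. \<Sum>i<N. c i * g i x)" if "\<And>i. i < N \<Longrightarrow> g i \<in> sq_int M \<and> P (g i)" for N :: nat and c g
    using that
  proof (induction N)
    case (Suc N)
    have "P (\<lambda>x. (\<Sum>i<N. c i * g i x) + c N * g N x)"
      using Suc by (intro add scale sq_int_sum sq_int_scale) auto
    then show ?case by simp
  qed (simp add: zero)
  have gs: "P (gs n)" for n
  proof (induction n rule: less_induct)
    case (less n)
    have "P (\<lambda>x. a n x + - 1 * (\<Sum>i<n. sq_ip M (a n) (gs i) * gs i x))"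
      by (intro add scale sum fam_sq_int fam sq_int_scale sq_int_sum) (auto simp: less)
    then have "P (gs_res n)"
      by (simp add: gs_res_def)
    then show ?case
      by (subst gs_eq) (rule scale[OF gs_res_sq_int])
  qed
  show ?thesis
    by (rule lim[OF _ _ assms(1) psum_coef_tendsto[OF assms(1)]]) (auto intro!: sum sq_int_psum simp: gs)
qed

lemma l2_dist_coef:
  assumes "f \<in> sq_int M" "g \<in> sq_int M"
  shows "l2_dist (coef f) (coef g) = sqrt (sq_norm M (\<lambda>x. f x - g x))"
  using parseval[OF sq_int_diff[OF assms]] by (simp add: l2_dist_def coef_diff[OF assms] sums_iff)

lemma l2_norm_coef:
  assumes "f \<in> sq_int M"
  shows "l2_norm (coef f) = sqrt (sq_norm M f)"
  using parseval[OF assms] by (simp add: l2_norm_def l2_dist_def sums_iff)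

text \<open>Polarisation holds both for complex numbers, coordinate by coordinate, and for
  functions; Parseval for the four combinations matches the two.\<close>

lemma l2_inner_coef:
  assumes f: "f \<in> sq_int M" and g: "g \<in> sq_int M"
  shows "l2_inner (coef f) (coef g) = sq_ip M f g"
proof -
  note ig = sq_int_scale[OF g, of \<i>]
  have *: "4 * (u * cnj v) = of_real ((cmod (u + v))\<^sup>2) - of_real ((cmod (u - v))\<^sup>2)
      + \<i> * of_real ((cmod (u + \<i> * v))\<^sup>2) - \<i> * of_real ((cmod (u - \<i> * v))\<^sup>2)" for u v
    unfolding cmod_power2 by (simp add: complex_eq_iff power2_eq_square algebra_simps)
  have "(\<lambda>n. of_real ((cmod (coef f n + coef g n))\<^sup>2) - of_real ((cmod (coef f n - coef g n))\<^sup>2)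
      + \<i> * of_real ((cmod (coef f n + \<i> * coef g n))\<^sup>2) - \<i> * of_real ((cmod (coef f n - \<i> * coef g n))\<^sup>2))
    sums (4 * sq_ip M f g)"
    unfolding sq_ip_polarization[OF f g]
    using parseval[OF sq_int_add[OF f g]] parseval[OF sq_int_diff[OF f g]]
      parseval[OF sq_int_add[OF f ig]] parseval[OF sq_int_diff[OF f ig]]
    unfolding coef_add[OF f g] coef_diff[OF f g] coef_add[OF f ig] coef_diff[OF f ig] coef_scale
    by (intro sums_add sums_diff sums_mult sums_of_real)
  then have "(\<lambda>n. 4 * (coef f n * cnj (coef g n))) sums (4 * sq_ip M f g)"
    by (simp only: *)
  then have "(\<lambda>n. coef f n * cnj (coef g n)) sums sq_ip M f g"
    by (subst (asm) sums_mult_iff) auto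
  then show ?thesis
    by (simp add: l2_inner_def sums_iff)
qed

lemma coef_eq_iff:
  assumes "f \<in> sq_int M" "g \<in> sq_int M"
  shows "coef f = coef g \<longleftrightarrow> sq_norm M (\<lambda>x. f x - g x) = 0"
proof
  assume "coef f = coef g"
  then show "sq_norm M (\<lambda>x. f x - g x) = 0"
    using parseval[OF sq_int_diff[OF assms]] coef_diff[OF assms] by (simp add: sums_iff)
next
  assume "sq_norm M (\<lambda>x. f x - g x) = 0"
  then have "cmod (coef f n - coef g n) = 0" for n
    using bessel[OF sq_int_diff[OF assms], of "{n}"] coef_diff[OF assms] by simp
  then show "coef f = coef g"
    by (auto simp: fun_eq_iff)
qed

lemma coef_image: "coef_space = coef ` sq_int M"
  using coef_in_space riesz_fischer by blast

lemma closed_coef_space: "closed_l2_subspace coef_space"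
  unfolding closed_l2_subspace_def
proof (intro conjI ballI allI impI)
  show "coef_space \<subseteq> l2" "(\<lambda>_. 0) \<in> coef_space"
    by (auto simp: coef_space_def l2_def)
next
  fix x y assume "x \<in> coef_space" "y \<in> coef_space"
  then show "(\<lambda>n. x n + y n) \<in> coef_space"
    unfolding coef_image by (auto simp: coef_add[symmetric] intro!: imageI sq_int_add)
next
  fix c x assume "x \<in> coef_space"
  then show "(\<lambda>n. c * x n) \<in> coef_space"
    unfolding coef_image by (auto simp: coef_scale[symmetric] intro!: imageI sq_int_scale)
next
  fix x assume x: "x \<in> l2" and approx: "\<forall>e>0. \<exists>y\<in>coef_space. l2_dist x y < e"
  \<comment> \<open>Every vector of the space vanishes at such an index, so its distance from
    \<open>x\<close> is at least the modulus of \<open>x n\<close>. The summability shown first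
    makes the infinite sum in \<open>l2_dist\<close> meaningful.\<close>
  have "x n = 0" if n: "gs n = (\<lambda>_. 0)" for n
  proof (rule ccontr)
    assume "x n \<noteq> 0"
    then obtain y where y: "y \<in> coef_space" "l2_dist x y < cmod (x n)"
      using approx by (metis zero_less_norm_iff)
    have "summable (\<lambda>n. 2 * (cmod (x n))\<^sup>2 + 2 * (cmod (y n))\<^sup>2)"
      using x y(1) by (intro summable_add summable_mult) (auto simp: l2_def coef_space_def)
    then have "summable (\<lambda>n. (cmod (x n - y n))\<^sup>2)"
      by (rule summable_comparison_test'[where N = 0]) (use cmod_add_sq_le[of "x _" "- y _"] in simp)
    then have "(\<Sum>k\<in>{n}. (cmod (x k - y k))\<^sup>2) \<le> (\<Sum>k. (cmod (x k - y k))\<^sup>2)"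
      by (intro sum_le_suminf) auto
    moreover have "y n = 0"
      using y(1) n by (simp add: coef_space_def)
    ultimately have "cmod (x n) \<le> l2_dist x y"
      unfolding l2_dist_def by (intro real_le_rsqrt) simp
    then show False
      using y(2) by simp
  qed
  then show "x \<in> coef_space"
    using x by (simp add: coef_space_def)
qed

end

section \<open>The Koopman representation\<close>

locale top_group = group G
  for G :: "'g::{second_countable_topology, t2_space} monoid" (structure) +
  assumes carrier_UNIV: "carrier G = UNIV"
    and continuous_mult: "continuous_on UNIV (\<lambda>(x, y). x \<otimes> y)"
    and continuous_inverse: "continuous_on UNIV (\<lambda>x. inv x)"
begin

lemma in_carrier [simp]: "g \<in> carrier G"
  by (simp add: carrier_UNIV)

lemma continuous_on_mult:
  assumes "continuous_on S f" "continuous_on S h"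
  shows "continuous_on S (\<lambda>x. f x \<otimes> h x)"
  using continuous_on_compose2[OF continuous_mult continuous_on_Pair[OF assms]] by simp

lemma continuous_on_inverse:
  assumes "continuous_on S f"
  shows "continuous_on S (\<lambda>x. inv (f x))"
  using continuous_on_compose2[OF continuous_inverse assms] by simp

lemmas continuous_group_intros = continuous_on_mult continuous_on_inverse continuous_on_const continuous_on_id

lemma continuous_translation: "continuous_on UNIV (\<lambda>x. h \<otimes> x)"
  by (intro continuous_group_intros)

end

text \<open>Continuity is asked for only at the identity, along sequences and on the total family.
  \<open>total_family_induct\<close> extends it to all functions, invariance of \<open>M\<close> to
  all group elements, and second countability makes sequences sufficient.\<close>

locale koopman = total_family M a + top_group G
  for M :: "'x measure" and a and G :: "'g::{second_countable_topology, t2_space} monoid" (structure) +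
  fixes act :: "'g \<Rightarrow> 'x \<Rightarrow> 'x"
  assumes act_measurable: "act g \<in> measurable M M"
    and act_preserves: "distr M M (act g) = M"
    and act_mult: "x \<in> space M \<Longrightarrow> act (g \<otimes> h) x = act g (act h x)"
    and act_one: "x \<in> space M \<Longrightarrow> act \<one> x = x"
    and fam_continuous:
      "s \<longlonglongrightarrow> \<one> \<Longrightarrow> (\<lambda>k. sq_norm M (\<lambda>x. a n (act (s k) x) - a n x)) \<longlonglongrightarrow> 0"
begin

lemma act_sq_int:
  assumes "f \<in> sq_int M"
  shows "(\<lambda>x. f (act g x)) \<in> sq_int M"
proof -
  note [measurable] = act_measurable sq_intD(1)[OF assms]
  have "integrable M (\<lambda>x. (cmod (f (act g x)))\<^sup>2)"
    using sq_intD(2)[OF assms] by (subst (asm) act_preserves[of g, symmetric]) (simp add: integrable_distr_eq)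
  then show ?thesis
    by (simp add: sq_int_def)
qed

lemma sq_ip_act:
  assumes "f \<in> sq_int M" "h \<in> sq_int M"
  shows "sq_ip M (\<lambda>x. f (act g x)) (\<lambda>x. h (act g x)) = sq_ip M f h"
proof -
  have "sq_ip M f h = sq_ip (distr M M (act g)) f h"
    by (simp add: act_preserves)
  also have "\<dots> = sq_ip M (\<lambda>x. f (act g x)) (\<lambda>x. h (act g x))"
    unfolding sq_ip_def using sq_intD(1)[OF assms(1)] sq_intD(1)[OF assms(2)] act_measurable
    by (subst integral_distr) (auto intro!: borel_measurable_times borel_measurable_cnj)
  finally show ?thesis ..
qed

lemma sq_norm_act:
  assumes "f \<in> sq_int M"
  shows "sq_norm M (\<lambda>x. f (act g x)) = sq_norm M f"
  using sq_ip_act[OF assms assms, of g] by (simp add: sq_ip_self)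

lemma act_continuous_one:
  assumes "f \<in> sq_int M" "s \<longlonglongrightarrow> \<one>"
  shows "(\<lambda>k. sq_norm M (\<lambda>x. f (act (s k) x) - f x)) \<longlonglongrightarrow> 0"
  using assms(1)
proof (induction rule: total_family_induct)
  case (fam n)
  show ?case by (rule fam_continuous[OF assms(2)])
next
  case (add f g)
  have "(\<lambda>k. 2 * sq_norm M (\<lambda>x. f (act (s k) x) - f x) + 2 * sq_norm M (\<lambda>x. g (act (s k) x) - g x)) \<longlonglongrightarrow> 0"
    using tendsto_add[OF tendsto_mult_right_zero[OF add(3), of 2] tendsto_mult_right_zero[OF add(4), of 2]] by simp
  then show ?case
  proof (rule Lim_null_comparison[rotated], intro always_eventually allI)
    fix k
    have "sq_norm M (\<lambda>x. (f (act (s k) x) - f x) + (g (act (s k) x) - g x))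
        \<le> 2 * sq_norm M (\<lambda>x. f (act (s k) x) - f x) + 2 * sq_norm M (\<lambda>x. g (act (s k) x) - g x)"
      using add by (intro sq_norm_add_le sq_int_diff act_sq_int)
    then show "norm (sq_norm M (\<lambda>x. f (act (s k) x) + g (act (s k) x) - (f x + g x)))
        \<le> 2 * sq_norm M (\<lambda>x. f (act (s k) x) - f x) + 2 * sq_norm M (\<lambda>x. g (act (s k) x) - g x)"
      using sq_norm_nonneg[of M "\<lambda>x. f (act (s k) x) + g (act (s k) x) - (f x + g x)"]
      by (simp add: algebra_simps)
  qed
next
  case (scale c f)
  have "sq_norm M (\<lambda>x. c * f (act (s k) x) - c * f x) = (cmod c)\<^sup>2 * sq_norm M (\<lambda>x. f (act (s k) x) - f x)" for k
    using sq_norm_scale[of M c "\<lambda>x. f (act (s k) x) - f x"] by (simp add: algebra_simps)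
  then show ?case
    using tendsto_mult_right_zero[OF scale(2), of "(cmod c)\<^sup>2"] by simp
next
  case (lim f g)
  show ?case
  proof (rule LIMSEQ_I)
    fix \<delta> :: real assume \<delta>: "\<delta> > 0"
    \<comment> \<open>Two triangle inequalities give 2a + 2(2b + 2a) = 6a + 4b, where a is the
      approximation error and b the displacement of the approximant; with both below \<delta>/12
      this stays under \<delta>.\<close>
    have "\<forall>\<^sub>F n in sequentially. sq_norm M (\<lambda>x. g n x - f x) < \<delta> / 12"
      using \<delta> by (intro order_tendstoD(2)[OF lim(3)]) auto
    then obtain n where n: "sq_norm M (\<lambda>x. g n x - f x) < \<delta> / 12"
      by (auto simp: eventually_sequentially)
    have "\<forall>\<^sub>F k in sequentially. sq_norm M (\<lambda>x. g n (act (s k) x) - g n x) < \<delta> / 12"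
      using \<delta> by (intro order_tendstoD(2)[OF lim(4)]) auto
    then have "\<forall>\<^sub>F k in sequentially. norm (sq_norm M (\<lambda>x. f (act (s k) x) - f x) - 0) < \<delta>"
    proof eventually_elim
      case (elim k)
      let ?T = "\<lambda>h x. h (act (s k) x)"
      have "sq_norm M (\<lambda>x. ?T f x - ?T (g n) x) = sq_norm M (\<lambda>x. g n x - f x)"
        using sq_norm_act[OF sq_int_diff[OF lim(2) lim(1)], of "s k" n] sq_norm_diff_commute[of M f "g n"] by simp
      moreover have "sq_norm M (\<lambda>x. ?T f x - f x)
          \<le> 2 * sq_norm M (\<lambda>x. ?T f x - ?T (g n) x) + 2 * sq_norm M (\<lambda>x. ?T (g n) x - f x)"
        by (intro sq_norm_diff_le act_sq_int lim)
      moreover have "sq_norm M (\<lambda>x. ?T (g n) x - f x)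
          \<le> 2 * sq_norm M (\<lambda>x. ?T (g n) x - g n x) + 2 * sq_norm M (\<lambda>x. g n x - f x)"
        by (intro sq_norm_diff_le act_sq_int lim)
      ultimately show ?case
        using n elim \<delta> sq_norm_nonneg[of M "\<lambda>x. ?T f x - f x"] by simp
    qed
    then show "\<exists>N. \<forall>k\<ge>N. norm (sq_norm M (\<lambda>x. f (act (s k) x) - f x) - 0) < \<delta>"
      by (simp add: eventually_sequentially)
  qed
qed

text \<open>Substituting \<open>act h x\<close> for \<open>x\<close> preserves the integral.
  Continuity at \<open>h\<close> is thereby reduced to continuity at the identity.\<close>

lemma act_diff_shift:
  assumes f: "f \<in> sq_int M"
  shows "sq_norm M (\<lambda>x. f (act g x) - f (act h x)) = sq_norm M (\<lambda>x. f (act (g \<otimes> inv h) x) - f x)"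
proof -
  have "sq_norm M (\<lambda>x. f (act (g \<otimes> inv h) x) - f x)
      = sq_norm M (\<lambda>x. f (act (g \<otimes> inv h) (act h x)) - f (act h x))"
    using sq_norm_act[OF sq_int_diff[OF act_sq_int[OF f, of "g \<otimes> inv h"] f], of h] by simp
  also have "\<dots> = sq_norm M (\<lambda>x. f (act g x) - f (act h x))"
    unfolding sq_norm_def
    by (rule Bochner_Integration.integral_cong) (simp_all add: m_assoc flip: act_mult)
  finally show ?thesis ..
qed

definition koop :: "'g \<Rightarrow> ('x \<Rightarrow> complex) \<Rightarrow> 'x \<Rightarrow> complex" where
  "koop g f = (\<lambda>x. f (act (inv g) x))"

lemma koop_sq_int: "f \<in> sq_int M \<Longrightarrow> koop g f \<in> sq_int M"
  unfolding koop_def by (rule act_sq_int)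

text \<open>The choice picks a preimage under \<open>coef\<close>, determined only up to null sets;
  \<open>rep_coef\<close> shows that the result does not depend on it. Off \<open>coef_space\<close>
  the value is unspecified, where \<open>unitary_rep\<close> imposes nothing.\<close>

definition rep :: "'g \<Rightarrow> (nat \<Rightarrow> complex) \<Rightarrow> nat \<Rightarrow> complex" where
  "rep g x = coef (koop g (SOME f. f \<in> sq_int M \<and> coef f = x))"

lemma rep_coef:
  assumes "f \<in> sq_int M"
  shows "rep g (coef f) = coef (koop g f)"
proof -
  define f' where "f' = (SOME f'. f' \<in> sq_int M \<and> coef f' = coef f)"
  have f': "f' \<in> sq_int M \<and> coef f' = coef f"
    unfolding f'_def by (rule someI[of _ f]) (simp add: assms)
  then have "sq_norm M (\<lambda>x. f' x - f x) = 0"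
    using coef_eq_iff assms by blast
  then have "sq_norm M (\<lambda>x. koop g f' x - koop g f x) = 0"
    using sq_norm_act[OF sq_int_diff[of f' M f], of "inv g"] f' assms by (simp add: koop_def)
  then have "coef (koop g f') = coef (koop g f)"
    using coef_eq_iff koop_sq_int f' assms by blast
  then show ?thesis
    by (simp add: rep_def f'_def)
qed

lemma koop_one:
  assumes "f \<in> sq_int M"
  shows "coef (koop \<one> f) = coef f"
proof -
  have "sq_norm M (\<lambda>x. koop \<one> f x - f x) = sq_norm M (\<lambda>_. 0)"
    unfolding sq_norm_def by (rule Bochner_Integration.integral_cong) (simp_all add: koop_def act_one)
  then show ?thesis
    using coef_eq_iff[OF koop_sq_int[OF assms] assms] by (simp add: sq_norm_def)
qed

lemma koop_mult:
  assumes "f \<in> sq_int M"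
  shows "coef (koop (g \<otimes> h) f) = coef (koop g (koop h f))"
proof -
  have "sq_norm M (\<lambda>x. koop (g \<otimes> h) f x - koop g (koop h f) x) = sq_norm M (\<lambda>_. 0)"
    unfolding sq_norm_def
    by (rule Bochner_Integration.integral_cong) (simp_all add: koop_def act_mult inv_mult_group)
  then show ?thesis
    using coef_eq_iff[OF koop_sq_int[OF assms] koop_sq_int[OF koop_sq_int[OF assms]]] by (simp add: sq_norm_def)
qed

lemma rep_continuous:
  assumes f: "f \<in> sq_int M"
  shows "((\<lambda>g. l2_dist (rep g (coef f)) (rep h (coef f))) \<longlongrightarrow> 0) (at h)"
  unfolding tendsto_at_iff_sequentially
proof (intro allI impI)
  fix s :: "nat \<Rightarrow> 'g" assume s: "\<forall>i. s i \<in> UNIV - {h}" "s \<longlonglongrightarrow> h"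
  \<comment> \<open>By \<open>act_diff_shift\<close>, the element whose displacement matters is
    \<open>inv (s k) \<otimes> h\<close>. It is the inverse of \<open>inv h \<otimes> s k\<close>,
    so continuity of left translation and inversion sends it to the identity.\<close>
  have "(\<lambda>k. inv h \<otimes> s k) \<longlonglongrightarrow> inv h \<otimes> h"
    by (rule isCont_tendsto_compose[OF _ s(2)])
       (use continuous_translation in \<open>simp add: continuous_on_eq_continuous_at\<close>)
  then have "(\<lambda>k. inv (inv h \<otimes> s k)) \<longlonglongrightarrow> inv (inv h \<otimes> h)"
    by (intro isCont_tendsto_compose[where g = "\<lambda>x. inv x"])
       (use continuous_inverse in \<open>simp add: continuous_on_eq_continuous_at\<close>)
  then have "(\<lambda>k. inv (s k) \<otimes> h) \<longlonglongrightarrow> \<one>"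
    by (simp add: inv_mult_group)
  from act_continuous_one[OF f this]
  have "(\<lambda>k. sqrt (sq_norm M (\<lambda>x. f (act (inv (s k) \<otimes> h) x) - f x))) \<longlonglongrightarrow> sqrt 0"
    by (rule tendsto_real_sqrt)
  moreover have "l2_dist (rep g (coef f)) (rep h (coef f)) = sqrt (sq_norm M (\<lambda>x. f (act (inv g \<otimes> h) x) - f x))" for g
    unfolding rep_coef[OF f] l2_dist_coef[OF koop_sq_int[OF f] koop_sq_int[OF f]]
    by (simp add: koop_def act_diff_shift[OF f])
  ultimately show "((\<lambda>g. l2_dist (rep g (coef f)) (rep h (coef f))) \<circ> s) \<longlonglongrightarrow> 0"
    by (simp only: comp_def real_sqrt_zero)
qed

lemma unitary_rep_koopman: "unitary_rep G coef_space rep"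
  unfolding unitary_rep_def
proof (intro conjI ballI allI)
  show "closed_l2_subspace coef_space"
    by (rule closed_coef_space)
next
  fix g x assume "x \<in> coef_space"
  then show "rep g x \<in> coef_space"
    unfolding coef_image by (auto simp: rep_coef koop_sq_int)
next
  fix g x y assume "x \<in> coef_space" "y \<in> coef_space"
  then obtain f h where fh: "f \<in> sq_int M" "h \<in> sq_int M" and xy: "x = coef f" "y = coef h"
    unfolding coef_image by blast
  have "rep g (coef (\<lambda>x. f x + h x)) = coef (\<lambda>x. koop g f x + koop g h x)"
    by (simp add: rep_coef sq_int_add fh) (simp add: koop_def)
  then show "rep g (\<lambda>n. x n + y n) = (\<lambda>n. rep g x n + rep g y n)"
    by (simp add: xy coef_add fh koop_sq_int rep_coef)
  show "l2_inner (rep g x) (rep g y) = l2_inner x y"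
    unfolding xy rep_coef[OF fh(1)] rep_coef[OF fh(2)]
    by (simp add: l2_inner_coef koop_sq_int fh) (simp add: koop_def sq_ip_act fh)
next
  fix g c x assume "x \<in> coef_space"
  then obtain f where f: "f \<in> sq_int M" and x: "x = coef f"
    unfolding coef_image by blast
  have "rep g (coef (\<lambda>x. c * f x)) = coef (\<lambda>x. c * koop g f x)"
    by (simp add: rep_coef sq_int_scale f) (simp add: koop_def)
  then show "rep g (\<lambda>n. c * x n) = (\<lambda>n. c * rep g x n)"
    by (simp add: x coef_scale f rep_coef)
next
  fix x assume "x \<in> coef_space"
  then show "rep \<one> x = x"
    unfolding coef_image by (auto simp: rep_coef koop_one)
next
  fix g h x assume "x \<in> coef_space"
  then show "rep (g \<otimes> h) x = rep g (rep h x)"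
    unfolding coef_image by (auto simp: rep_coef koop_mult koop_sq_int)
next
  fix x h assume "x \<in> coef_space"
  then show "((\<lambda>g. l2_dist (rep g x) (rep h x)) \<longlongrightarrow> 0) (at h within carrier G)"
    unfolding coef_image by (auto simp: carrier_UNIV rep_continuous)
qed

text \<open>The hypothesis on \<open>v\<close> makes \<open>coef v\<close> almost invariant for
  \<open>rep\<close>. The fixed vector obtained in return is a class modulo null sets, so invariance
  of \<open>f\<close> holds for each \<open>g\<close> off a null set that may depend on
  \<open>g\<close>.\<close>

lemma exists_invariant_function:
  assumes T: "\<And>H \<pi>. \<lbrakk>unitary_rep G H \<pi>;
      \<exists>x\<in>H. x \<noteq> (\<lambda>_. 0) \<and> (\<forall>g\<in>K. l2_dist (\<pi> g x) x < \<kappa> * l2_norm x)\<rbrakk> \<Longrightarrow>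
        \<exists>x\<in>H. x \<noteq> (\<lambda>_. 0) \<and> (\<forall>g\<in>carrier G. \<pi> g x = x)"
    and v: "v \<in> sq_int M" "sq_norm M v = 1"
    and almost: "\<And>g. g \<in> K \<Longrightarrow> sqrt (sq_norm M (\<lambda>x. koop g v x - v x)) < \<kappa>"
  obtains f where "f \<in> sq_int M" "sq_norm M f \<noteq> 0" "\<And>g. AE x in M. f (act g x) = f x"
proof -
  have "\<exists>x\<in>coef_space. x \<noteq> (\<lambda>_. 0) \<and> (\<forall>g\<in>K. l2_dist (rep g x) x < \<kappa> * l2_norm x)"
  proof (intro bexI[of _ "coef v"] conjI ballI)
    show "coef v \<noteq> (\<lambda>_. 0)"
    proof
      assume "coef v = (\<lambda>_. 0)"
      then have "l2_norm (coef v) = 0"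
        by (simp add: l2_norm_def l2_dist_def)
      then show False
        by (simp add: l2_norm_coef v)
    qed
  next
    fix g assume "g \<in> K"
    then show "l2_dist (rep g (coef v)) (coef v) < \<kappa> * l2_norm (coef v)"
      using almost by (simp add: rep_coef l2_dist_coef koop_sq_int l2_norm_coef v)
  qed (simp add: coef_in_space v)
  from T[OF unitary_rep_koopman this] obtain f where f: "f \<in> sq_int M" "coef f \<noteq> (\<lambda>_. 0)"
    and inv: "\<And>g. rep g (coef f) = coef f"
    unfolding coef_image by auto
  show ?thesis
  proof
    have "coef (\<lambda>_. 0) = (\<lambda>_. 0)"
      by (simp add: coef_def sq_ip_def fun_eq_iff)
    then show "sq_norm M f \<noteq> 0"
      using coef_eq_iff[OF f(1) sq_int_zero] f(2) by auto
    fix g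
    have "sq_norm M (\<lambda>x. f (act g x) - f x) = 0"
      using inv[of "inv g"] coef_eq_iff[OF koop_sq_int[OF f(1)] f(1), of "inv g"] f(1)
      by (simp add: rep_coef koop_def)
    then have "AE x in M. f (act g x) - f x = 0"
      using sq_norm_zero_iff[OF sq_int_diff[OF act_sq_int[OF f(1), of g] f(1)]] by simp
    then show "AE x in M. f (act g x) = f x"
      by simp
  qed (rule f(1))
qed

end

section \<open>Haar measure and the coset space\<close>

text \<open>\<open>haar_measure\<close> bounds only compact sets. Local finiteness comes from the
  charts of a Lie group, and with second countability it gives sigma-finiteness, hence
  Fubini.\<close>

locale haar_group = top_group G
  for G :: "'g::{second_countable_topology, t2_space} monoid" (structure) +
  fixes \<mu> :: "'g measure"
  assumes haar: "haar_measure G \<mu>"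
    and locally_finite: "\<exists>U. open U \<and> x \<in> U \<and> emeasure \<mu> U < \<infinity>"
begin

lemma inv_translate: "inv (inv g \<otimes> a) \<otimes> (inv g \<otimes> b) = inv a \<otimes> b"
proof -
  have "inv (inv g \<otimes> a) \<otimes> (inv g \<otimes> b) = inv a \<otimes> (g \<otimes> inv g) \<otimes> b"
    by (simp only: inv_mult_group m_assoc in_carrier inv_inv m_closed)
  then show ?thesis
    by simp
qed

lemma sets_\<mu> [measurable_cong]: "sets \<mu> = sets borel"
  using haar by (simp add: haar_measure_def)

lemma space_\<mu> [simp]: "space \<mu> = UNIV"
  using sets_eq_imp_space_eq[OF sets_\<mu>] by simp

lemma borel_measurable_translation: "(\<lambda>x. g \<otimes> x) \<in> borel_measurable borel"
  by (intro borel_measurable_continuous_onI continuous_translation)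

lemma borel_measurable_inverse: "(\<lambda>x. inv x) \<in> borel_measurable borel"
  by (intro borel_measurable_continuous_onI continuous_inverse)

lemma emeasure_translation:
  assumes "B \<in> sets borel"
  shows "emeasure \<mu> {a. g \<otimes> a \<in> B} = emeasure \<mu> B"
proof -
  have "emeasure \<mu> B = emeasure (distr \<mu> borel (\<lambda>x. g \<otimes> x)) B"
    using haar by (simp add: haar_measure_def)
  also have "\<dots> = emeasure \<mu> {a. g \<otimes> a \<in> B}"
    using assms borel_measurable_translation by (subst emeasure_distr) (auto simp: vimage_def measurable_cong_sets[OF sets_\<mu>])
  finally show ?thesis ..
qed

lemma finite_measure_basis:
  obtains \<B> where "countable \<B>" "\<And>B. B \<in> \<B> \<Longrightarrow> open B \<and> emeasure \<mu> B < \<infinity>"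
    "\<And>U x. open U \<Longrightarrow> x \<in> U \<Longrightarrow> \<exists>B\<in>\<B>. x \<in> B \<and> B \<subseteq> U"
proof -
  obtain \<B> :: "'g set set" where \<B>: "countable \<B>" "topological_basis \<B>"
    using ex_countable_basis by blast
  show ?thesis
  proof
    show "countable {B \<in> \<B>. emeasure \<mu> B < \<infinity>}"
      using \<B>(1) by auto
    show "open B \<and> emeasure \<mu> B < \<infinity>" if "B \<in> {B \<in> \<B>. emeasure \<mu> B < \<infinity>}" for B
      using that topological_basis_open[OF \<B>(2)] by auto
    fix U and x :: 'g assume U: "open U" "x \<in> U"
    obtain V where V: "open V" "x \<in> V" "emeasure \<mu> V < \<infinity>"
      using locally_finite by blast
    then obtain B where B: "B \<in> \<B>" "x \<in> B" "B \<subseteq> U \<inter> V"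
      using topological_basisE[OF \<B>(2), of "U \<inter> V" x] U by blast
    then have "emeasure \<mu> B \<le> emeasure \<mu> V"
      using V(1) by (intro emeasure_mono) (auto simp: sets_\<mu>)
    then show "\<exists>B\<in>{B \<in> \<B>. emeasure \<mu> B < \<infinity>}. x \<in> B \<and> B \<subseteq> U"
      using B V(3) by (intro bexI[of _ B]) auto
  qed
qed

lemma sigma_finite_\<mu>: "sigma_finite_measure \<mu>"
proof -
  obtain \<B> where \<B>: "countable \<B>" "\<And>B. B \<in> \<B> \<Longrightarrow> open B \<and> emeasure \<mu> B < \<infinity>"
    "\<And>U x. open U \<Longrightarrow> x \<in> U \<Longrightarrow> \<exists>B\<in>\<B>. x \<in> B \<and> B \<subseteq> U"
    using finite_measure_basis by blast
  show ?thesis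
  proof
    have "\<Union>\<B> = space \<mu>"
      using \<B>(3)[of UNIV] by auto
    then show "\<exists>A. countable A \<and> A \<subseteq> sets \<mu> \<and> \<Union>A = space \<mu> \<and> (\<forall>a\<in>A. emeasure \<mu> a \<noteq> \<infinity>)"
      using \<B>(1,2) by (intro exI[of _ \<B>]) (auto simp: sets_\<mu> less_top)
  qed
qed

lemma emeasure_UNIV_pos: "emeasure \<mu> UNIV > 0"
  using haar by (simp add: haar_measure_def)

lemma emeasure_inverse_slice:
  assumes "N \<in> sets borel"
  shows "emeasure \<mu> {g. inv g \<otimes> b \<in> N} = emeasure \<mu> {u. inv u \<in> N}"
proof -
  have "{u. inv u \<in> N} \<in> sets borel"
    using measurable_sets[OF borel_measurable_inverse assms] by (simp add: vimage_def)
  moreover have "inv (inv b \<otimes> g) = inv g \<otimes> b" for g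
    by (simp add: inv_mult_group)
  ultimately show ?thesis
    using emeasure_translation[of "{u. inv u \<in> N}" "inv b"] by simp
qed

text \<open>By Fubini, averaging \<open>N\<close> over all left translates gives its measure, and averaging over all
  right translates gives the measure of the inverse of \<open>N\<close>.\<close>

lemma nn_integral_inverse_swap:
  assumes "N \<in> sets borel" "P \<in> sets borel"
  shows "(\<integral>\<^sup>+g. emeasure \<mu> {b \<in> P. inv g \<otimes> b \<in> N} \<partial>\<mu>) = emeasure \<mu> {u. inv u \<in> N} * emeasure \<mu> P"
proof -
  interpret sigma_finite_measure \<mu> by (rule sigma_finite_\<mu>)
  interpret pair_sigma_finite \<mu> \<mu> ..
  have "(\<lambda>(g, b). inv g \<otimes> b) \<in> borel_measurable (borel \<Otimes>\<^sub>M borel)"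
    unfolding borel_prod split_beta
    by (intro borel_measurable_continuous_onI continuous_on_mult continuous_on_inverse continuous_intros)
  then have m: "(\<lambda>(g, b). inv g \<otimes> b) \<in> borel_measurable (\<mu> \<Otimes>\<^sub>M \<mu>)"
    by (simp add: measurable_cong_sets[OF sets_pair_measure_cong[OF sets_\<mu> sets_\<mu>] refl])
  have Psets: "P \<in> sets \<mu>"
    using assms(2) by (simp add: sets_\<mu>)
  define h where "h g b = (indicator P b * indicator N (inv g \<otimes> b) :: ennreal)" for g b
  have "(\<lambda>z. indicator N ((\<lambda>(g, b). inv g \<otimes> b) z) :: ennreal) \<in> borel_measurable (\<mu> \<Otimes>\<^sub>M \<mu>)"
    by (rule measurable_compose[OF m borel_measurable_indicator[OF assms(1)]])
  moreover have "(\<lambda>z. indicator P (snd z) :: ennreal) \<in> borel_measurable (\<mu> \<Otimes>\<^sub>M \<mu>)"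
    by (rule measurable_compose[OF measurable_snd borel_measurable_indicator[OF Psets]])
  ultimately have h: "case_prod h \<in> borel_measurable (\<mu> \<Otimes>\<^sub>M \<mu>)"
    unfolding h_def by (simp add: split_beta')
  have slice: "{b. inv g \<otimes> b \<in> N} \<in> sets \<mu>" for g
    using measurable_sets[OF borel_measurable_translation assms(1), of "inv g"]
    by (simp add: sets_\<mu> vimage_def)
  have slice': "{g. inv g \<otimes> b \<in> N} \<in> sets \<mu>" for b
  proof -
    have "(\<lambda>g. inv g \<otimes> b) \<in> borel_measurable borel"
      by (intro borel_measurable_continuous_onI continuous_group_intros)
    from measurable_sets[OF this assms(1)] show ?thesis
      by (simp add: sets_\<mu> vimage_def)
  qed
  have "(\<integral>\<^sup>+g. emeasure \<mu> {b \<in> P. inv g \<otimes> b \<in> N} \<partial>\<mu>) = (\<integral>\<^sup>+g. \<integral>\<^sup>+b. h g b \<partial>\<mu> \<partial>\<mu>)"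
  proof (rule nn_integral_cong)
    fix g
    have "(\<integral>\<^sup>+b. h g b \<partial>\<mu>) = (\<integral>\<^sup>+b. indicator (P \<inter> {b. inv g \<otimes> b \<in> N}) b \<partial>\<mu>)"
      by (rule nn_integral_cong) (auto simp: h_def split: split_indicator)
    also have "\<dots> = emeasure \<mu> (P \<inter> {b. inv g \<otimes> b \<in> N})"
      using slice[of g] Psets by (intro nn_integral_indicator) auto
    finally show "emeasure \<mu> {b \<in> P. inv g \<otimes> b \<in> N} = (\<integral>\<^sup>+b. h g b \<partial>\<mu>)"
      by (simp add: Collect_conj_eq)
  qed
  also have "\<dots> = (\<integral>\<^sup>+b. \<integral>\<^sup>+g. h g b \<partial>\<mu> \<partial>\<mu>)"
    by (rule Fubini'[OF h, symmetric])
  also have "\<dots> = (\<integral>\<^sup>+b. emeasure \<mu> {u. inv u \<in> N} * indicator P b \<partial>\<mu>)"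
  proof (rule nn_integral_cong)
    fix b
    have "(\<integral>\<^sup>+g. h g b \<partial>\<mu>) = (\<integral>\<^sup>+g. indicator P b * indicator {g. inv g \<otimes> b \<in> N} g \<partial>\<mu>)"
      by (rule nn_integral_cong) (auto simp: h_def split: split_indicator)
    also have "\<dots> = indicator P b * emeasure \<mu> {g. inv g \<otimes> b \<in> N}"
      by (rule nn_integral_cmult_indicator[OF slice'])
    finally show "(\<integral>\<^sup>+g. h g b \<partial>\<mu>) = emeasure \<mu> {u. inv u \<in> N} * indicator P b"
      by (simp add: emeasure_inverse_slice[OF assms(1)] mult.commute)
  qed
  also have "\<dots> = emeasure \<mu> {u. inv u \<in> N} * emeasure \<mu> P"
    by (rule nn_integral_cmult_indicator[OF Psets])
  finally show ?thesis .
qed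

text \<open>Inversion need not preserve a left-invariant measure, but it respects null sets. In the
  swap formula with \<open>P = UNIV\<close> the right side is 0 times the total mass, which is 0
  even for infinite mass, while the left integrand is constantly the measure of
  \<open>N\<close>.\<close>

lemma emeasure_inverse_null:
  assumes N: "N \<in> sets borel" and null: "emeasure \<mu> {u. inv u \<in> N} = 0"
  shows "emeasure \<mu> N = 0"
proof -
  have "(\<integral>\<^sup>+g. emeasure \<mu> N \<partial>\<mu>) = (\<integral>\<^sup>+g. emeasure \<mu> {b \<in> UNIV. inv g \<otimes> b \<in> N} \<partial>\<mu>)"
    by (simp add: emeasure_translation[OF N])
  also have "\<dots> = 0"
    by (subst nn_integral_inverse_swap[OF N]) (simp_all add: null)
  finally show ?thesis
    using emeasure_UNIV_pos by auto
qed

text \<open>In the swap formula with \<open>N = E\<close> and \<open>P = - E\<close> the integrand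
  vanishes for every \<open>g\<close>, by almost everywhere invariance. So the inverse of
  \<open>E\<close> or the complement of \<open>E\<close> is null; no strictly invariant version of
  \<open>E\<close> is constructed.\<close>

lemma invariant_null_or_conull:
  assumes E: "E \<in> sets borel" and inv: "\<And>g. AE b in \<mu>. g \<otimes> b \<in> E \<longleftrightarrow> b \<in> E"
  shows "emeasure \<mu> E = 0 \<or> emeasure \<mu> (- E) = 0"
proof -
  have "emeasure \<mu> {b \<in> - E. inv g \<otimes> b \<in> E} = 0" for g
  proof -
    have "AE b in \<mu>. b \<notin> {b \<in> - E. inv g \<otimes> b \<in> E}"
      using inv[of "inv g"] by eventually_elim auto
    then show ?thesis
      by (rule AE_iff_measurable[THEN iffD1, rotated 2])
         (use measurable_sets[OF borel_measurable_translation E, of "inv g"] E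
           in \<open>auto simp: sets_\<mu> vimage_def Collect_conj_eq\<close>)
  qed
  then have "emeasure \<mu> {u. inv u \<in> E} * emeasure \<mu> (- E) = 0"
    using nn_integral_inverse_swap[OF E, of "- E"] E by (simp add: borel_comp)
  then show ?thesis
    using emeasure_inverse_null[OF E] by auto
qed

end

locale coset_action = haar_group G \<mu>
  for G :: "'g::{second_countable_topology, t2_space} monoid" (structure) and \<mu> +
  fixes \<Gamma> :: "'g set" and m :: "'g set measure"
  assumes discrete: "discrete_subgroup G \<Gamma>"
    and induced: "induced_measure G \<mu> \<Gamma> m"
begin

section \<open>Cosets and Borel sets of the quotient\<close>

lemma subgroup_\<Gamma>: "subgroup \<Gamma> G"
  using discrete by (simp add: discrete_subgroup_def)

lemma mem_coset_iff: "b \<in> a <# \<Gamma> \<longleftrightarrow> inv a \<otimes> b \<in> \<Gamma>"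
  using subgroup.lcos_module_rev[OF subgroup_\<Gamma> is_group, of a b]
    subgroup.lcos_module_imp[OF subgroup_\<Gamma> is_group, of a b] by auto

lemma mem_own_coset: "a \<in> a <# \<Gamma>"
  by (rule lcos_self) (simp_all add: subgroup_\<Gamma>)

lemma coset_in [simp]: "a <# \<Gamma> \<in> lcosets \<Gamma>"
  by (auto simp: LCOSETS_def)

lemma coset_eqI: "x \<in> lcosets \<Gamma> \<Longrightarrow> a \<in> x \<Longrightarrow> x = a <# \<Gamma>"
  using l_repr_independence[OF _ in_carrier subgroup_\<Gamma>] by (auto simp: LCOSETS_def)

lemma coset_translate: "g <# (a <# \<Gamma>) = (g \<otimes> a) <# \<Gamma>"
  by (rule lcos_m_assoc) (auto simp: carrier_UNIV)

lemma cosetE: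
  assumes "x \<in> lcosets \<Gamma>"
  obtains a where "x = a <# \<Gamma>"
  using assms by (auto simp: LCOSETS_def)

lemma translate_in: "x \<in> lcosets \<Gamma> \<Longrightarrow> g <# x \<in> lcosets \<Gamma>"
  by (auto elim!: cosetE simp: coset_translate)

lemma mem_Union_iff:
  assumes "W \<subseteq> lcosets \<Gamma>"
  shows "a \<in> \<Union>W \<longleftrightarrow> a <# \<Gamma> \<in> W"
proof
  assume "a \<in> \<Union>W"
  then obtain x where "x \<in> W" "a \<in> x" by blast
  then show "a <# \<Gamma> \<in> W"
    using coset_eqI[of x a] assms by auto
next
  assume "a <# \<Gamma> \<in> W"
  then show "a \<in> \<Union>W"
    using mem_own_coset by blast
qed

lemma sets_m: "sets m = sigma_sets (lcosets \<Gamma>) {W. W \<subseteq> lcosets \<Gamma> \<and> open (\<Union>W)}"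
  using induced unfolding induced_measure_def coset_borel_def by (subst (asm) sets_measure_of) auto

lemma sets_m_coset_borel: "sets m = sets (coset_borel G \<Gamma>)"
  using induced by (simp add: induced_measure_def)

lemma space_m [simp]: "space m = lcosets \<Gamma>"
proof -
  have "space m = space (coset_borel G \<Gamma>)"
    by (rule sets_eq_imp_space_eq[OF sets_m_coset_borel])
  then show ?thesis
    unfolding coset_borel_def by (subst (asm) space_measure_of) auto
qed

lemma weil:
  assumes "f \<in> borel_measurable borel"
  shows "(\<integral>\<^sup>+g. f g \<partial>\<mu>) = (\<integral>\<^sup>+x. (\<integral>\<^sup>+g. f g \<partial>count_space x) \<partial>m)"
  using induced assms by (auto simp: induced_measure_def)

lemma sets_subset: "W \<in> sets m \<Longrightarrow> W \<subseteq> lcosets \<Gamma>"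
  using sets.sets_into_space[of W m] by simp

lemma open_sets_m: "W \<subseteq> lcosets \<Gamma> \<Longrightarrow> open (\<Union>W) \<Longrightarrow> W \<in> sets m"
  by (auto simp: sets_m)

lemma measurable_proj: "(\<lambda>a. a <# \<Gamma>) \<in> measurable borel m"
proof (rule measurable_sigma_sets[OF sets_m])
  fix W assume W: "W \<in> {W. W \<subseteq> lcosets \<Gamma> \<and> open (\<Union>W)}"
  then have "(\<lambda>a. a <# \<Gamma>) -` W = \<Union>W"
    using mem_Union_iff[of W] by auto
  then show "(\<lambda>a. a <# \<Gamma>) -` W \<inter> space borel \<in> sets borel"
    using W by auto
qed auto

lemma Union_sets_borel:
  assumes "W \<in> sets m"
  shows "\<Union>W \<in> sets borel"
proof -
  have "\<Union>W = (\<lambda>a. a <# \<Gamma>) -` W \<inter> space borel"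
    using mem_Union_iff[OF sets_subset[OF assms]] by auto
  then show ?thesis
    using measurable_sets[OF measurable_proj assms] by simp
qed

lemma measurable_translate: "(\<lambda>x. g <# x) \<in> measurable m m"
proof (rule measurable_sigma_sets[OF sets_m])
  fix W assume "W \<in> {W. W \<subseteq> lcosets \<Gamma> \<and> open (\<Union>W)}"
  then have W: "W \<subseteq> lcosets \<Gamma>" "open (\<Union>W)" by auto
  let ?V = "(\<lambda>x. g <# x) -` W \<inter> space m"
  have "\<Union>?V = (\<lambda>a. g \<otimes> a) -` \<Union>W"
  proof (rule Set.set_eqI)
    fix a
    have "a \<in> \<Union>?V \<longleftrightarrow> a <# \<Gamma> \<in> ?V"
      by (rule mem_Union_iff) auto
    then show "a \<in> \<Union>?V \<longleftrightarrow> a \<in> (\<lambda>a. g \<otimes> a) -` \<Union>W"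
      using mem_Union_iff[OF W(1), of "g \<otimes> a"] by (simp add: coset_translate)
  qed
  moreover have "open ((\<lambda>a. g \<otimes> a) -` \<Union>W)"
    using continuous_translation W(2) by (simp add: continuous_on_open_vimage)
  ultimately show "?V \<in> sets m"
    by (intro open_sets_m) auto
qed (auto simp: translate_in)

section \<open>Borel fundamental domains and invariance of the induced measure\<close>

definition fundamental :: "'g set \<Rightarrow> bool" where
  "fundamental F \<longleftrightarrow> F \<in> sets borel \<and> (\<forall>x\<in>lcosets \<Gamma>. \<exists>!a. a \<in> x \<inter> F)"

text \<open>Weil's formula for the indicator of \<open>F \<inter> \<Union>W\<close>: the inner count
  is 1 on the cosets in \<open>W\<close> and 0 on the others. This expresses \<open>m\<close>
  through Haar measure on any fundamental domain.\<close>

lemma emeasure_fundamental: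
  assumes F: "fundamental F" and W: "W \<in> sets m"
  shows "emeasure m W = emeasure \<mu> (F \<inter> \<Union>W)"
proof -
  have FW: "F \<inter> \<Union>W \<in> sets borel"
    using F Union_sets_borel[OF W] by (auto simp: fundamental_def)
  have "emeasure \<mu> (F \<inter> \<Union>W) = (\<integral>\<^sup>+g. indicator (F \<inter> \<Union>W) g \<partial>\<mu>)"
    using FW by (simp add: sets_\<mu>)
  also have "\<dots> = (\<integral>\<^sup>+x. (\<integral>\<^sup>+g. indicator (F \<inter> \<Union>W) g \<partial>count_space x) \<partial>m)"
    by (rule weil) (use FW in simp)
  also have "\<dots> = (\<integral>\<^sup>+x. indicator W x \<partial>m)"
  proof (rule nn_integral_cong)
    fix x assume "x \<in> space m"
    then have x: "x \<in> lcosets \<Gamma>" by simp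
    then obtain a where a: "x \<inter> F = {a}"
      using F unfolding fundamental_def by (metis (no_types, opaque_lifting) empty_iff insertI1 subsetI subset_singleton_iff)
    have "(F \<inter> \<Union>W) \<inter> x = (if x \<in> W then {a} else {})"
    proof (cases "x \<in> W")
      case False
      have "\<Union>W \<inter> x = {}"
      proof (rule ccontr)
        assume "\<Union>W \<inter> x \<noteq> {}"
        then obtain b where "b \<in> \<Union>W" "b \<in> x" by blast
        then show False
          using mem_Union_iff[OF sets_subset[OF W], of b] coset_eqI[OF x, of b] False by simp
      qed
      then show ?thesis using False by auto
    qed (use a in auto)
    moreover have "(\<integral>\<^sup>+g. indicator (F \<inter> \<Union>W) g \<partial>count_space x) = emeasure (count_space x) ((F \<inter> \<Union>W) \<inter> x)"
      by (subst nn_integral_indicator') auto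
    moreover have "a \<in> x"
      using a by auto
    ultimately show "(\<integral>\<^sup>+g. indicator (F \<inter> \<Union>W) g \<partial>count_space x) = indicator W x"
      by (auto simp: emeasure_count_space)
  qed
  also have "\<dots> = emeasure m W"
    using W by simp
  finally show ?thesis ..
qed

text \<open>The set is gF. Left translation permutes the cosets and so carries unique
  representatives to unique representatives.\<close>

lemma fundamental_translate:
  assumes "fundamental F"
  shows "fundamental {a. inv g \<otimes> a \<in> F}"
  unfolding fundamental_def
proof (intro conjI ballI)
  show "{a. inv g \<otimes> a \<in> F} \<in> sets borel"
    using measurable_sets[OF borel_measurable_translation, of F "inv g"] assms
    by (simp add: fundamental_def vimage_def)
  fix x assume "x \<in> lcosets \<Gamma>"
  then obtain b where b: "x = b <# \<Gamma>"
    by (rule cosetE)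
  have mem: "a \<in> x \<longleftrightarrow> inv g \<otimes> a \<in> (inv g \<otimes> b) <# \<Gamma>" for a
  proof -
    have "inv (inv g \<otimes> b) \<otimes> (inv g \<otimes> a) = inv b \<otimes> a"
      by (rule inv_translate)
    then show ?thesis
      by (simp add: b mem_coset_iff)
  qed
  obtain c where c: "c \<in> ((inv g \<otimes> b) <# \<Gamma>) \<inter> F"
    and uniq: "\<And>c'. c' \<in> ((inv g \<otimes> b) <# \<Gamma>) \<inter> F \<Longrightarrow> c' = c"
  proof -
    have "\<exists>!c. c \<in> ((inv g \<otimes> b) <# \<Gamma>) \<inter> F"
      by (rule bspec[OF conjunct2[OF assms[unfolded fundamental_def]] coset_in])
    then show ?thesis
      using that by (elim ex1E) blast
  qed
  have gc: "inv g \<otimes> (g \<otimes> c) = c"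
    by (simp flip: m_assoc)
  show "\<exists>!a. a \<in> x \<inter> {a. inv g \<otimes> a \<in> F}"
  proof (rule ex1I[of _ "g \<otimes> c"])
    show "g \<otimes> c \<in> x \<inter> {a. inv g \<otimes> a \<in> F}"
      using c mem[of "g \<otimes> c"] by (simp add: gc)
    fix a assume "a \<in> x \<inter> {a. inv g \<otimes> a \<in> F}"
    then have "inv g \<otimes> a = c"
      using uniq[of "inv g \<otimes> a"] mem[of a] by simp
    then show "a = g \<otimes> c"
      by (auto simp flip: m_assoc)
  qed
qed

text \<open>The set is U\<Gamma>, a union of the right translates of \<open>U\<close> by elements of
  \<Gamma>.\<close>

lemma open_saturation:
  assumes "open U"
  shows "open {b. \<exists>u\<in>U. inv u \<otimes> b \<in> \<Gamma>}"
proof -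
  have "{b. \<exists>u\<in>U. inv u \<otimes> b \<in> \<Gamma>} = (\<Union>\<gamma>\<in>\<Gamma>. (\<lambda>b. b \<otimes> inv \<gamma>) -` U)"
  proof (intro Set.set_eqI iffI)
    fix b assume "b \<in> {b. \<exists>u\<in>U. inv u \<otimes> b \<in> \<Gamma>}"
    then obtain u where u: "u \<in> U" "inv u \<otimes> b \<in> \<Gamma>" by blast
    have "b \<otimes> inv (inv u \<otimes> b) = u"
      by (simp add: inv_mult_group flip: m_assoc)
    then show "b \<in> (\<Union>\<gamma>\<in>\<Gamma>. (\<lambda>b. b \<otimes> inv \<gamma>) -` U)"
      using u by (intro UN_I[of "inv u \<otimes> b"]) auto
  next
    fix b assume "b \<in> (\<Union>\<gamma>\<in>\<Gamma>. (\<lambda>b. b \<otimes> inv \<gamma>) -` U)"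
    then obtain \<gamma> where \<gamma>: "\<gamma> \<in> \<Gamma>" "b \<otimes> inv \<gamma> \<in> U" by blast
    have "inv (b \<otimes> inv \<gamma>) \<otimes> b = \<gamma>"
      by (simp add: inv_mult_group m_assoc)
    then show "b \<in> {b. \<exists>u\<in>U. inv u \<otimes> b \<in> \<Gamma>}"
      using \<gamma> by (intro CollectI bexI[of _ "b \<otimes> inv \<gamma>"]) auto
  qed
  moreover have "open ((\<lambda>b. b \<otimes> inv \<gamma>) -` U)" for \<gamma>
    by (intro open_vimage[OF assms] continuous_group_intros)
  ultimately show ?thesis
    by auto
qed

text \<open>If \<open>U\<^sup>-\<^sup>1 U\<close> meets \<open>\<Gamma>\<close> only in the identity, each translate of \<open>U\<close> contains at most one point of
  every coset. Countably many translates cover \<open>G\<close>; in each coset keep the point lying in the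
  first translate that meets it.\<close>

lemma fundamental_exists: "\<exists>F. fundamental F"
proof -
  have "\<one> \<in> \<Gamma>"
    using subgroup.one_closed[OF subgroup_\<Gamma>] .
  then obtain N where N: "open N" "N \<inter> \<Gamma> = {\<one>}"
    using discrete unfolding discrete_subgroup_def discrete_def isolated_in_def by blast
  have "continuous_on UNIV (\<lambda>z. inv (fst z) \<otimes> snd z)"
    by (intro continuous_on_mult continuous_on_inverse continuous_intros)
  then have "open ((\<lambda>(x, y). inv x \<otimes> y) -` N)"
    unfolding split_beta by (rule open_vimage[OF N(1)])
  moreover have "(\<one>, \<one>) \<in> (\<lambda>(x, y). inv x \<otimes> y) -` N"
    using N(2) by auto
  ultimately obtain A B where AB: "open A" "open B" "\<one> \<in> A" "\<one> \<in> B"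
    "A \<times> B \<subseteq> (\<lambda>(x, y). inv x \<otimes> y) -` N"
    by (rule open_prod_elim) auto
  define T where "T g = (\<lambda>a. inv g \<otimes> a) -` (A \<inter> B)" for g
  have T_open: "open (T g)" for g
    unfolding T_def using AB continuous_translation by (intro open_vimage) (auto intro: open_Int)
  have T_unique: "a = b" if "a \<in> T g" "b \<in> T g" "inv a \<otimes> b \<in> \<Gamma>" for a b g
  proof -
    have "inv (inv g \<otimes> a) \<otimes> (inv g \<otimes> b) = inv a \<otimes> b"
      by (rule inv_translate)
    moreover have "inv (inv g \<otimes> a) \<otimes> (inv g \<otimes> b) \<in> N"
      using that(1,2) AB(5) by (auto simp: T_def)
    ultimately have "inv a \<otimes> b = \<one>"
      using that(3) N(2) by auto
    moreover have "a \<otimes> (inv a \<otimes> b) = b"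
      by (simp flip: m_assoc)
    ultimately show ?thesis
      by simp
  qed
  have "g \<in> T g" for g
    using AB by (simp add: T_def)
  then have cover: "\<Union>(range T) = UNIV"
    by blast
  obtain \<T> where \<T>: "\<T> \<subseteq> range T" "countable \<T>" "\<Union>\<T> = UNIV"
    using Lindelof[of "range T"] T_open cover by (metis imageE)
  have "\<T> \<noteq> {}"
    using \<T>(3) by auto
  then obtain t :: "nat \<Rightarrow> 'g set" where t: "range t = \<T>"
    using range_from_nat_into[OF _ \<T>(2)] by blast
  \<comment> \<open>The saturation of \<open>t n\<close>, that is, the union of the cosets meeting
    \<open>t n\<close>. Removing the earlier saturations leaves in \<open>t n\<close> only the
    cosets that no earlier set has met.\<close>
  define S where "S n = {b. \<exists>u\<in>t n. inv u \<otimes> b \<in> \<Gamma>}" for n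
  have t_open: "open (t n)" for n
    using t \<T>(1) T_open by (metis image_iff rangeI subsetD)
  have S_sets: "S n \<in> sets borel" for n
    unfolding S_def using open_saturation[OF t_open[of n]] by simp
  define F where "F = (\<Union>n. t n - (\<Union>k<n. S k))"
  have "F \<in> sets borel"
    unfolding F_def using S_sets t_open by (intro sets.countable_UN'' sets.Diff) auto
  moreover have "\<exists>!a. a \<in> x \<inter> F" if x: "x \<in> lcosets \<Gamma>" for x
  proof -
    obtain a where a: "x = a <# \<Gamma>"
      using x by (rule cosetE)
    have S_iff: "b \<in> S n \<longleftrightarrow> t n \<inter> x \<noteq> {}" if "b \<in> x" for b n
    proof -
      have "x = b <# \<Gamma>"
        by (rule coset_eqI[OF x that])
      then have "u \<in> x \<longleftrightarrow> inv b \<otimes> u \<in> \<Gamma>" for u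
        by (simp add: mem_coset_iff)
      moreover have "inv b \<otimes> u \<in> \<Gamma> \<longleftrightarrow> inv u \<otimes> b \<in> \<Gamma>" for u
        using subgroup.m_inv_closed[OF subgroup_\<Gamma>, of "inv b \<otimes> u"]
          subgroup.m_inv_closed[OF subgroup_\<Gamma>, of "inv u \<otimes> b"] by (auto simp: inv_mult_group)
      ultimately show ?thesis
        unfolding S_def by auto
    qed
    define n where "n = (LEAST n. t n \<inter> x \<noteq> {})"
    have "a \<in> \<Union>(range t)" "a \<in> x"
      using \<T>(3) t mem_own_coset a by auto
    then have "\<exists>n. t n \<inter> x \<noteq> {}"
      by blast
    then have n: "t n \<inter> x \<noteq> {}"
      unfolding n_def by (rule LeastI_ex)
    have less: "t k \<inter> x = {}" if "k < n" for k
      using not_less_Least[of k "\<lambda>n. t n \<inter> x \<noteq> {}"] that unfolding n_def by auto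
    have "x \<inter> F = t n \<inter> x"
    proof (intro Set.set_eqI iffI)
      fix b assume b: "b \<in> x \<inter> F"
      then obtain k where k: "b \<in> t k" "\<And>j. j < k \<Longrightarrow> b \<notin> S j"
        unfolding F_def by blast
      have "\<not> k < n"
        using less k(1) b by blast
      moreover have "\<not> n < k"
        using k(2) S_iff n b by blast
      ultimately show "b \<in> t n \<inter> x"
        using k b by (metis IntI IntD1 linorder_neqE_nat)
    next
      fix b assume b: "b \<in> t n \<inter> x"
      then have "b \<notin> S k" if "k < n" for k
        using S_iff less that by blast
      then show "b \<in> x \<inter> F"
        using b unfolding F_def by blast
    qed
    moreover have "b = c" if "b \<in> t n \<inter> x" "c \<in> t n \<inter> x" for b c
    proof -
      obtain g where "t n = T g"
        using t \<T>(1) by blast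
      moreover have "inv b \<otimes> c \<in> \<Gamma>"
        using coset_eqI[OF x, of b] that mem_coset_iff[of c b] by auto
      ultimately show ?thesis
        using T_unique that by auto
    qed
    ultimately show ?thesis
      using n by auto
  qed
  ultimately show ?thesis
    unfolding fundamental_def by (intro exI[of _ F] conjI ballI)
qed

text \<open>Measuring the preimage of \<open>W\<close> on \<open>F\<close> amounts, after left
  translation by \<open>g\<close>, to measuring \<open>W\<close> on the fundamental domain gF, and
  the value of \<open>m\<close> does not depend on the domain.\<close>

lemma translate_preserves: "distr m m (\<lambda>x. g <# x) = m"
proof (rule measure_eqI)
  fix W assume "W \<in> sets (distr m m (\<lambda>x. g <# x))"
  then have W: "W \<in> sets m" by simp
  obtain F where F: "fundamental F"
    using fundamental_exists by blast
  let ?V = "(\<lambda>x. g <# x) -` W \<inter> space m"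
  let ?F = "{a. inv g \<otimes> a \<in> F}"
  have F': "fundamental ?F"
    by (rule fundamental_translate[OF F])
  have V: "?V \<in> sets m"
    by (rule measurable_sets[OF measurable_translate W])
  have "F \<inter> \<Union>?V = {a. g \<otimes> a \<in> ?F \<inter> \<Union>W}"
  proof (rule Set.set_eqI)
    fix a
    have "a \<in> \<Union>?V \<longleftrightarrow> g \<otimes> a \<in> \<Union>W"
      using mem_Union_iff[OF sets_subset[OF V], of a] mem_Union_iff[OF sets_subset[OF W], of "g \<otimes> a"]
      by (simp add: coset_translate)
    moreover have "inv g \<otimes> (g \<otimes> a) = a"
      by (simp flip: m_assoc)
    ultimately show "a \<in> F \<inter> \<Union>?V \<longleftrightarrow> a \<in> {a. g \<otimes> a \<in> ?F \<inter> \<Union>W}"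
      by simp
  qed
  moreover have "?F \<inter> \<Union>W \<in> sets borel"
    using F' Union_sets_borel[OF W] by (auto simp: fundamental_def)
  ultimately have "emeasure m ?V = emeasure m W"
    using emeasure_fundamental[OF F V] emeasure_fundamental[OF F' W] emeasure_translation[of "?F \<inter> \<Union>W" g]
    by simp
  then show "emeasure (distr m m (\<lambda>x. g <# x)) W = emeasure m W"
    using W by (simp add: emeasure_distr measurable_translate)
qed simp

section \<open>Null sets and ergodicity\<close>

lemma null_Union:
  assumes "W \<in> sets m" "emeasure m W = 0"
  shows "emeasure \<mu> (\<Union>W) = 0"
proof -
  have "emeasure \<mu> (\<Union>W) = (\<integral>\<^sup>+g. indicator (\<Union>W) g \<partial>\<mu>)"
    using Union_sets_borel[OF assms(1)] by (simp add: sets_\<mu>)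
  also have "\<dots> = (\<integral>\<^sup>+x. (\<integral>\<^sup>+g. indicator (\<Union>W) g \<partial>count_space x) \<partial>m)"
    by (rule weil) (use Union_sets_borel[OF assms(1)] in simp)
  also have "\<dots> = (\<integral>\<^sup>+x. 0 \<partial>m)"
  proof (rule nn_integral_cong_AE, rule AE_I)
    show "{x \<in> space m. (\<integral>\<^sup>+g. indicator (\<Union>W) g \<partial>count_space x) \<noteq> 0} \<subseteq> W"
    proof (rule subsetI, rule ccontr)
      fix x assume x: "x \<in> {x \<in> space m. (\<integral>\<^sup>+g. indicator (\<Union>W) g \<partial>count_space x) \<noteq> 0}" and "x \<notin> W"
      have "g \<notin> \<Union>W" if "g \<in> x" for g
        using mem_Union_iff[OF sets_subset[OF assms(1)], of g] coset_eqI[of x g] x \<open>x \<notin> W\<close> that by auto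
      then have "(\<integral>\<^sup>+g. indicator (\<Union>W) g \<partial>count_space x) = (\<integral>\<^sup>+g. 0 \<partial>count_space x)"
        by (intro nn_integral_cong) auto
      then show False
        using x by simp
    qed
  qed (use assms in auto)
  finally show ?thesis by simp
qed

lemma AE_lift:
  assumes "AE x in m. P x"
  shows "AE a in \<mu>. P (a <# \<Gamma>)"
proof -
  obtain N where N: "{x \<in> space m. \<not> P x} \<subseteq> N" "emeasure m N = 0" "N \<in> sets m"
    using AE_E[OF assms] by blast
  show ?thesis
  proof (rule AE_I)
    show "emeasure \<mu> (\<Union>N) = 0"
      by (rule null_Union[OF N(3,2)])
    show "{a \<in> space \<mu>. \<not> P (a <# \<Gamma>)} \<subseteq> \<Union>N"
    proof
      fix a assume "a \<in> {a \<in> space \<mu>. \<not> P (a <# \<Gamma>)}"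
      then have "a <# \<Gamma> \<in> N"
        using N(1) by auto
      then show "a \<in> \<Union>N"
        using mem_own_coset by blast
    qed
  qed (use Union_sets_borel[OF N(3)] in \<open>simp add: sets_\<mu>\<close>)
qed

text \<open>The union of \<open>E\<close> in the group is almost invariant under left translations,
  so \<open>invariant_null_or_conull\<close> applies upstairs. Restricting to a fundamental domain
  brings both alternatives back to \<open>m\<close>.\<close>

lemma ergodic:
  assumes E: "E \<in> sets m" and inv: "\<And>g. AE x in m. g <# x \<in> E \<longleftrightarrow> x \<in> E"
    and pos: "emeasure m E \<noteq> 0"
  shows "emeasure m (space m) = emeasure m E"
proof -
  obtain F where F: "fundamental F"
    using fundamental_exists by blast
  have mem: "a <# \<Gamma> \<in> E \<longleftrightarrow> a \<in> \<Union>E" for a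
    using mem_Union_iff[OF sets_subset[OF E]] by simp
  have borel: "\<Union>E \<in> sets borel"
    by (rule Union_sets_borel[OF E])
  have "AE a in \<mu>. g \<otimes> a \<in> \<Union>E \<longleftrightarrow> a \<in> \<Union>E" for g
    using AE_lift[OF inv[of g]] by (simp add: coset_translate mem)
  from invariant_null_or_conull[OF borel this]
  have "emeasure \<mu> (\<Union>E) = 0 \<or> emeasure \<mu> (- \<Union>E) = 0" .
  moreover have "emeasure \<mu> (\<Union>E) \<noteq> 0"
  proof
    assume "emeasure \<mu> (\<Union>E) = 0"
    moreover have "emeasure \<mu> (F \<inter> \<Union>E) \<le> emeasure \<mu> (\<Union>E)"
      using borel by (intro emeasure_mono) (auto simp: sets_\<mu>)
    ultimately show False
      using pos emeasure_fundamental[OF F E] by simp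
  qed
  ultimately have "emeasure \<mu> (- \<Union>E) = 0"
    by blast
  moreover have "emeasure \<mu> (F \<inter> \<Union>(space m - E)) \<le> emeasure \<mu> (- \<Union>E)"
  proof (intro emeasure_mono)
    show "F \<inter> \<Union>(space m - E) \<subseteq> - \<Union>E"
      using mem mem_Union_iff[of "space m - E"] by auto
  qed (use borel in \<open>simp add: sets_\<mu> borel_comp\<close>)
  ultimately have "emeasure m (space m - E) = 0"
    using emeasure_fundamental[OF F sets.compl_sets[OF E]] by simp
  then show ?thesis
    using emeasure_Un_null_set[of E m "space m - E"] E sets.compl_sets[OF E]
    by (simp add: null_sets_def Un_absorb1 sets_subset)
qed

text \<open>Each coset meeting \<open>B\<close> contributes at least one point to the inner count in
  Weil's formula. Thus small open sets of the group project to open sets of finite measure.\<close>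

lemma emeasure_proj_le:
  assumes "open B"
  shows "(\<lambda>a. a <# \<Gamma>) ` B \<in> sets m" "open (\<Union>((\<lambda>a. a <# \<Gamma>) ` B))"
    "emeasure m ((\<lambda>a. a <# \<Gamma>) ` B) \<le> emeasure \<mu> B"
proof -
  let ?W = "(\<lambda>a. a <# \<Gamma>) ` B"
  have "\<Union>?W = {b. \<exists>u\<in>B. inv u \<otimes> b \<in> \<Gamma>}"
    by (auto simp: mem_coset_iff)
  then show op: "open (\<Union>?W)"
    using open_saturation[OF assms] by simp
  then show W: "?W \<in> sets m"
    by (intro open_sets_m) auto
  have "emeasure m ?W = (\<integral>\<^sup>+x. indicator ?W x \<partial>m)"
    using W by simp
  also have "\<dots> \<le> (\<integral>\<^sup>+x. (\<integral>\<^sup>+g. indicator B g \<partial>count_space x) \<partial>m)"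
  proof (rule nn_integral_mono)
    fix x
    show "indicator ?W x \<le> (\<integral>\<^sup>+g. indicator B g \<partial>count_space x)"
    proof (cases "x \<in> ?W")
      case True
      then obtain a where a: "a \<in> B" "x = a <# \<Gamma>" by blast
      have "a \<in> x"
        using a(2) mem_own_coset by simp
      then have "1 = (\<integral>\<^sup>+g. indicator {a} g \<partial>count_space x)"
        by (subst nn_integral_indicator) (auto simp: emeasure_count_space)
      also have "\<dots> \<le> (\<integral>\<^sup>+g. indicator B g \<partial>count_space x)"
        using a(1) by (intro nn_integral_mono) (auto split: split_indicator)
      finally show ?thesis
        using True by simp
    qed simp
  qed
  also have "\<dots> = emeasure \<mu> B"
    using weil[of "indicator B"] assms by (simp add: sets_\<mu>)
  finally show "emeasure m ?W \<le> emeasure \<mu> B" .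
qed

end

section \<open>The Koopman representation of the coset space\<close>

context coset_action
begin

lemma emeasure_act:
  assumes "W \<in> sets m"
  shows "emeasure m {x \<in> space m. g <# x \<in> W} = emeasure m W"
proof -
  have "emeasure m W = emeasure (distr m m (\<lambda>x. g <# x)) W"
    by (simp only: translate_preserves)
  also have "\<dots> = emeasure m {x \<in> space m. g <# x \<in> W}"
    using assms by (subst emeasure_distr[OF measurable_translate]) (auto intro: arg_cong[where f = "emeasure m"])
  finally show ?thesis ..
qed

text \<open>Separability of the coset space. Projections of a finite-measure basis generate the
  sigma-algebra; closing them under finite intersections gives stability while keeping countability,
  openness and finite measure.\<close>

lemma countable_pi_system:
  obtains \<P> where "countable \<P>" "Int_stable \<P>" "\<And>W. W \<in> \<P> \<Longrightarrow> W \<in> sets m \<and> open (\<Union>W) \<and> emeasure m W < \<infinity>"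
    "sets m = sigma_sets (lcosets \<Gamma>) \<P>" "\<Union>\<P> = lcosets \<Gamma>"
proof -
  obtain \<B> where \<B>: "countable \<B>" "\<And>B. B \<in> \<B> \<Longrightarrow> open B \<and> emeasure \<mu> B < \<infinity>"
    "\<And>U x. open U \<Longrightarrow> x \<in> U \<Longrightarrow> \<exists>B\<in>\<B>. x \<in> B \<and> B \<subseteq> U"
    using finite_measure_basis by blast
  define \<S> where "\<S> = (\<lambda>B. (\<lambda>a. a <# \<Gamma>) ` B) ` \<B>"
  \<comment> \<open>Empty \<open>T\<close> is excluded because its intersection would be the
    universal set.\<close>
  define \<P> where "\<P> = Inter ` {T. T \<subseteq> \<S> \<and> finite T \<and> T \<noteq> {}}"
  have S: "W \<in> sets m \<and> open (\<Union>W) \<and> emeasure m W < \<infinity>" if W: "W \<in> \<S>" for W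
  proof -
    obtain B where B: "B \<in> \<B>" "W = (\<lambda>a. a <# \<Gamma>) ` B"
      using W unfolding \<S>_def by blast
    then show ?thesis
      using emeasure_proj_le[of B] \<B>(2)[OF B(1)] by (auto intro: le_less_trans)
  qed
  have S_sub_P: "\<S> \<subseteq> \<P>"
  proof
    fix W assume "W \<in> \<S>"
    then show "W \<in> \<P>"
      unfolding \<P>_def by (intro image_eqI[of _ _ "{W}"]) auto
  qed
  have P: "W \<in> sets m \<and> open (\<Union>W) \<and> emeasure m W < \<infinity>" if "W \<in> \<P>" for W
  proof -
    obtain T where T: "T \<subseteq> \<S>" "finite T" "T \<noteq> {}" "W = \<Inter>T"
      using \<open>W \<in> \<P>\<close> unfolding \<P>_def by blast
    obtain V where V: "V \<in> T" using T(3) by blast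
    have W: "W \<in> sets m"
      unfolding T(4) using T S by (intro sets.finite_INT[of T "\<lambda>x. x", simplified]) auto
    \<comment> \<open>Union commutes with intersection here because every group element lies in
      exactly one coset.\<close>
    have "\<Union>W = \<Inter>(Union ` T)"
    proof (rule Set.set_eqI)
      fix a
      have "a \<in> \<Union>W \<longleftrightarrow> (\<forall>V\<in>T. a <# \<Gamma> \<in> V)"
        using mem_Union_iff[OF sets_subset[OF W], of a] T(4) by simp
      also have "\<dots> \<longleftrightarrow> (\<forall>V\<in>T. a \<in> \<Union>V)"
        using mem_Union_iff[OF sets_subset] S T(1) by (intro ball_cong refl) blast
      finally show "a \<in> \<Union>W \<longleftrightarrow> a \<in> \<Inter>(Union ` T)"
        by simp
    qed
    moreover have "open (\<Inter>(Union ` T))"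
      using S T by (intro open_Inter) auto
    moreover have "emeasure m W \<le> emeasure m V"
      using S T V by (intro emeasure_mono) auto
    ultimately show ?thesis
      using W S[of V] V T(1) by (metis le_less_trans subsetD)
  qed
  have gen: "W \<in> sigma_sets (lcosets \<Gamma>) \<P>" if W: "W \<subseteq> lcosets \<Gamma>" "open (\<Union>W)" for W
  proof -
    have "W = \<Union>{V \<in> \<S>. V \<subseteq> W}"
    proof (intro Set.set_eqI iffI)
      fix x assume x: "x \<in> W"
      then obtain a where a: "x = a <# \<Gamma>"
        using W(1) by (blast elim: cosetE)
      then have "a \<in> \<Union>W"
        using x mem_own_coset by blast
      then obtain B where B: "B \<in> \<B>" "a \<in> B" "B \<subseteq> \<Union>W"
        using \<B>(3)[OF W(2)] by blast
      have "(\<lambda>a. a <# \<Gamma>) ` B \<subseteq> W"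
        using B(3) mem_Union_iff[OF W(1)] by blast
      then show "x \<in> \<Union>{V \<in> \<S>. V \<subseteq> W}"
        using B(1,2) a unfolding \<S>_def by blast
    qed auto
    moreover have "countable {V \<in> \<S>. V \<subseteq> W}"
      using \<B>(1) unfolding \<S>_def by auto
    moreover have "{V \<in> \<S>. V \<subseteq> W} \<subseteq> sigma_sets (lcosets \<Gamma>) \<P>"
      using S_sub_P by (auto intro: sigma_sets.Basic)
    moreover have "\<P> \<subseteq> Pow (lcosets \<Gamma>)"
      using P sets_subset by auto
    ultimately show ?thesis
      using sigma_algebra.countable_Union[OF sigma_algebra_sigma_sets, of \<P> "lcosets \<Gamma>" "{V \<in> \<S>. V \<subseteq> W}"] by simp
  qed
  show ?thesis
  proof
    show "countable \<P>"
      unfolding \<P>_def using countable_Collect_finite_subset[of \<S>] \<B>(1)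
      by (intro countable_image countable_subset[OF _ countable_Collect_finite_subset[of \<S>]]) (auto simp: \<S>_def)
    show "Int_stable \<P>"
    proof (rule Int_stableI)
      fix V W assume "V \<in> \<P>" "W \<in> \<P>"
      then obtain S T where ST: "S \<subseteq> \<S>" "finite S" "S \<noteq> {}" "V = \<Inter>S" "T \<subseteq> \<S>" "finite T" "T \<noteq> {}" "W = \<Inter>T"
        unfolding \<P>_def by blast
      then have "V \<inter> W = \<Inter>(S \<union> T)"
        by (simp add: Inter_Un_distrib)
      then show "V \<inter> W \<in> \<P>"
        unfolding \<P>_def using ST by (intro image_eqI[of _ _ "S \<union> T"]) auto
    qed
    show "W \<in> sets m \<and> open (\<Union>W) \<and> emeasure m W < \<infinity>" if "W \<in> \<P>" for W
      by (rule P[OF that])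
    show "sets m = sigma_sets (lcosets \<Gamma>) \<P>"
    proof (rule antisym)
      show "sets m \<subseteq> sigma_sets (lcosets \<Gamma>) \<P>"
        unfolding sets_m using gen by (intro sigma_sets_mono) auto
      show "sigma_sets (lcosets \<Gamma>) \<P> \<subseteq> sets m"
        using P sets.sigma_sets_subset[of \<P> m] by auto
    qed
    show "\<Union>\<P> = lcosets \<Gamma>"
    proof
      show "\<Union>\<P> \<subseteq> lcosets \<Gamma>"
        using P sets_subset by blast
      show "lcosets \<Gamma> \<subseteq> \<Union>\<P>"
      proof
        fix x assume "x \<in> lcosets \<Gamma>"
        then obtain a where a: "x = a <# \<Gamma>"
          by (rule cosetE)
        obtain B where "B \<in> \<B>" "a \<in> B"
          using \<B>(3)[of UNIV a] by auto
        then show "x \<in> \<Union>\<P>"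
          using a S_sub_P unfolding \<S>_def by blast
      qed
    qed
  qed
qed

lemma coset_space_nonempty: "lcosets \<Gamma> \<noteq> {}"
  using coset_in by blast

lemma pi_system_sequence:
  obtains W :: "nat \<Rightarrow> 'g set set" where "Int_stable (range W)"
    "\<And>n. W n \<in> sets m" "\<And>n. open (\<Union>(W n))" "\<And>n. emeasure m (W n) < \<infinity>"
    "sets m = sigma_sets (lcosets \<Gamma>) (range W)" "(\<Union>n. W n) = lcosets \<Gamma>"
proof -
  obtain \<P> where \<P>: "countable \<P>" "Int_stable \<P>" "\<And>W. W \<in> \<P> \<Longrightarrow> W \<in> sets m \<and> open (\<Union>W) \<and> emeasure m W < \<infinity>"
    "sets m = sigma_sets (lcosets \<Gamma>) \<P>" "\<Union>\<P> = lcosets \<Gamma>"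
    using countable_pi_system by blast
  have "\<P> \<noteq> {}"
    using \<P>(5) coset_space_nonempty by auto
  then have r: "range (from_nat_into \<P>) = \<P>"
    using \<P>(1) by (rule range_from_nat_into)
  then have "from_nat_into \<P> n \<in> \<P>" for n
    by blast
  then show ?thesis
    using that[of "from_nat_into \<P>"] \<P> by (simp add: r)
qed

lemma sigma_finite_m: "sigma_finite_measure m"
proof -
  obtain W :: "nat \<Rightarrow> 'g set set" where W: "\<And>n. W n \<in> sets m" "\<And>n. emeasure m (W n) < \<infinity>"
    "(\<Union>n. W n) = lcosets \<Gamma>"
    by (rule pi_system_sequence) (rule that)
  show ?thesis
  proof
    show "\<exists>A. countable A \<and> A \<subseteq> sets m \<and> \<Union>A = space m \<and> (\<forall>a\<in>A. emeasure m a \<noteq> \<infinity>)"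
      using W by (intro exI[of _ "range W"]) (auto simp: less_top)
  qed
qed

text \<open>Since \<open>ennreal\<close> sends negative reals to 0, \<open>?P\<close> and
  \<open>?N\<close> have the positive and the negative part of \<open>u\<close> as densities. They
  agree on the pi-system and are finite there, hence coincide, and densities are unique over a
  sigma-finite measure.\<close>

lemma AE_zero_if_integrals_zero:
  fixes u :: "'g set \<Rightarrow> real"
  assumes W: "Int_stable (range W)" "\<And>n::nat. W n \<in> sets m"
    "sets m = sigma_sets (lcosets \<Gamma>) (range W)" "(\<Union>n. W n) = lcosets \<Gamma>"
    and u: "u \<in> borel_measurable m" "\<And>n. integrable m (\<lambda>x. indicator (W n) x * u x)"
    "\<And>n. (\<integral>x. indicator (W n) x * u x \<partial>m) = 0"
  shows "AE x in m. u x = 0"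
proof -
  interpret sigma_finite_measure m by (rule sigma_finite_m)
  note [measurable] = u(1) W(2)
  let ?P = "density m (\<lambda>x. ennreal (u x))" and ?N = "density m (\<lambda>x. ennreal (- u x))"
  have part: "emeasure (density m (\<lambda>x. ennreal (v x))) (W n) = (\<integral>\<^sup>+x. ennreal (indicator (W n) x * v x) \<partial>m)"
    if "v \<in> borel_measurable m" for v n
  proof -
    have "emeasure (density m (\<lambda>x. ennreal (v x))) (W n) = (\<integral>\<^sup>+x. ennreal (v x) * indicator (W n) x \<partial>m)"
      using that by (intro emeasure_density) auto
    also have "\<dots> = (\<integral>\<^sup>+x. ennreal (indicator (W n) x * v x) \<partial>m)"
      by (intro nn_integral_cong) (auto split: split_indicator)
    finally show ?thesis .
  qed
  have P: "emeasure ?P (W n) = (\<integral>\<^sup>+x. ennreal (indicator (W n) x * u x) \<partial>m)" for n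
    by (rule part) (rule u(1))
  have N: "emeasure ?N (W n) = (\<integral>\<^sup>+x. ennreal (- (indicator (W n) x * u x)) \<partial>m)" for n
    using part[of "\<lambda>x. - u x" n] by simp
  have fin: "(\<integral>\<^sup>+x. ennreal (indicator (W n) x * u x) \<partial>m) \<noteq> \<infinity>"
       "(\<integral>\<^sup>+x. ennreal (- (indicator (W n) x * u x)) \<partial>m) \<noteq> \<infinity>" for n
    using u(2)[of n] unfolding real_integrable_def by auto
  have eq: "emeasure ?P (W n) = emeasure ?N (W n)" for n
  proof -
    have "enn2real (emeasure ?P (W n)) = enn2real (emeasure ?N (W n))"
      using u(3)[of n] unfolding real_lebesgue_integral_def[OF u(2)] P N by simp
    moreover have "emeasure ?P (W n) < \<infinity>" "emeasure ?N (W n) < \<infinity>"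
      using fin[of n] unfolding P N by (simp_all add: less_top)
    ultimately show ?thesis
      by (metis ennreal_enn2real infinity_ennreal_def)
  qed
  have "?P = ?N"
  proof (intro measure_eqI_generator_eq[OF W(1), of "lcosets \<Gamma>" _ _ W])
    show "range W \<subseteq> Pow (lcosets \<Gamma>)"
      using sets_subset[OF W(2)] by blast
    show "emeasure ?P V = emeasure ?N V" if "V \<in> range W" for V
      using that eq by blast
    show "emeasure ?P (W n) \<noteq> \<infinity>" for n
      using fin(1) P by simp
  qed (simp_all add: W)
  then have "AE x in m. ennreal (u x) = ennreal (- u x)"
    by (subst (asm) density_unique_iff) auto
  then show ?thesis
  proof eventually_elim
    case (elim x)
    then show ?case
      by (cases "u x \<ge> 0") (auto simp: ennreal_neg ennreal_eq_0_iff dest: sym)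
  qed
qed

lemma indicator_sq_int:
  assumes "W \<in> sets m" "emeasure m W < \<infinity>"
  shows "indicator W \<in> sq_int m"
proof -
  have "(\<lambda>x. (cmod (indicator W x))\<^sup>2) = (indicator W :: 'g set \<Rightarrow> real)"
    by (auto simp: fun_eq_iff split: split_indicator)
  then show ?thesis
    using assms by (simp add: sq_int_def integrable_real_indicator)
qed

text \<open>Expanding the square, both pure terms integrate to the measure of \<open>W\<close> by
  invariance. In the mixed term only points of \<open>W\<close> count; since \<open>W\<close> is
  open they stay in \<open>W\<close> under \<open>s k\<close> for large \<open>k\<close>, so
  dominated convergence applies without any condition on the boundary.\<close>

lemma sq_norm_indicator_translate:
  assumes W: "W \<in> sets m" "open (\<Union>W)" "emeasure m W < \<infinity>" and s: "s \<longlonglongrightarrow> \<one>"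
  shows "(\<lambda>k. sq_norm m (\<lambda>x. indicator W (s k <# x) - indicator W x)) \<longlonglongrightarrow> 0"
proof -
  define p where "p k x = (indicator W (s k <# x) :: real)" for k x
  have pre: "{x \<in> space m. s k <# x \<in> W} \<in> sets m" for k
    using measurable_sets[OF measurable_translate W(1), of "s k"] by (simp add: vimage_def Collect_conj_eq Int_commute)
  have p_eq: "p k x = indicator {x \<in> space m. s k <# x \<in> W} x" if "x \<in> space m" for k x
    using that by (auto simp: p_def split: split_indicator)
  have int_p: "integrable m (p k)" for k
  proof -
    have "integrable m (indicator {x \<in> space m. s k <# x \<in> W} :: 'g set \<Rightarrow> real)"
      using pre W by (intro integrable_real_indicator) (simp_all add: emeasure_act[OF W(1), unfolded space_m])
    then show ?thesis
      by (subst Bochner_Integration.integrable_cong[OF refl p_eq])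
  qed
  have eq_p: "(\<integral>x. p k x \<partial>m) = measure m W" for k
  proof -
    have "(\<integral>x. p k x \<partial>m) = (\<integral>x. indicator {x \<in> space m. s k <# x \<in> W} x \<partial>m)"
      by (rule Bochner_Integration.integral_cong[OF refl p_eq])
    also have "\<dots> = measure m W"
      using pre[of k] W by (simp add: measure_def emeasure_act[OF W(1), unfolded space_m] Int_absorb2 sets.sets_into_space)
    finally show ?thesis .
  qed
  have int_W: "integrable m (indicator W :: 'g set \<Rightarrow> real)"
    using W by (intro integrable_real_indicator) auto
  have int_pW: "integrable m (\<lambda>x. p k x * indicator W x)" for k
    using W(1) int_p by (intro integrable_mult_indicator[of W m "p k", simplified, unfolded mult.commute[of "indicator _ _"]]) auto
  have "(\<lambda>k. \<integral>x. p k x * indicator W x \<partial>m) \<longlonglongrightarrow> (\<integral>x. indicator W x \<partial>m)"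
  proof (rule integral_dominated_convergence[where w = "indicator W"])
    show "AE x in m. (\<lambda>k. p k x * indicator W x) \<longlonglongrightarrow> indicator W x"
    proof (rule AE_I2)
      fix x assume "x \<in> space m"
      then obtain a where a: "x = a <# \<Gamma>"
        by (auto elim: cosetE)
      show "(\<lambda>k. p k x * indicator W x) \<longlonglongrightarrow> indicator W x"
      proof (cases "x \<in> W")
        case True
        have "(\<lambda>k. s k \<otimes> a) \<longlonglongrightarrow> \<one> \<otimes> a"
          using continuous_on_mult[OF continuous_on_id continuous_on_const, of UNIV a]
          by (intro isCont_tendsto_compose[OF _ s, of "\<lambda>x. x \<otimes> a"]) (simp add: continuous_on_eq_continuous_at)
        moreover have "\<one> \<otimes> a \<in> \<Union>W"
          using True a mem_own_coset by auto
        ultimately have "\<forall>\<^sub>F k in sequentially. s k \<otimes> a \<in> \<Union>W"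
          using topological_tendstoD[OF _ W(2)] by blast
        then have "\<forall>\<^sub>F k in sequentially. p k x * indicator W x = indicator W x"
          by eventually_elim
             (use True mem_Union_iff[OF sets_subset[OF W(1)]] in \<open>simp add: p_def a coset_translate\<close>)
        then show ?thesis
          by (rule tendsto_eventually)
      qed simp
    qed
    show "AE x in m. norm (p k x * indicator W x) \<le> indicator W x" for k
      by (auto simp: p_def split: split_indicator)
  qed (use int_W int_pW in auto)
  then have "(\<lambda>k. \<integral>x. p k x * indicator W x \<partial>m) \<longlonglongrightarrow> measure m W"
    using W by (simp add: Int_absorb2 sets.sets_into_space sets_subset)
  from tendsto_diff[OF tendsto_const[of "2 * measure m W"] tendsto_mult[OF tendsto_const[of 2] this]]
  have "(\<lambda>k. 2 * measure m W - 2 * (\<integral>x. p k x * indicator W x \<partial>m)) \<longlonglongrightarrow> 0"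
    by simp
  moreover have "sq_norm m (\<lambda>x. indicator W (s k <# x) - indicator W x)
      = 2 * measure m W - 2 * (\<integral>x. p k x * indicator W x \<partial>m)" for k
  proof -
    have "sq_norm m (\<lambda>x. indicator W (s k <# x) - indicator W x)
        = (\<integral>x. p k x + indicator W x - 2 * (p k x * indicator W x) \<partial>m)"
      unfolding sq_norm_def
      by (rule Bochner_Integration.integral_cong) (auto simp: p_def split: split_indicator)
    also have "\<dots> = 2 * measure m W - 2 * (\<integral>x. p k x * indicator W x \<partial>m)"
      using int_p int_W int_pW W(1) by (simp add: eq_p Int_absorb2 sets.sets_into_space sets_subset)
    finally show ?thesis .
  qed
  ultimately show ?thesis
    by simp
qed

lemma koopman_coset_space:
  obtains a where "koopman m a G (\<lambda>g x. g <# x)"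
proof -
  obtain W :: "nat \<Rightarrow> 'g set set" where W: "Int_stable (range W)"
    "\<And>n. W n \<in> sets m" "\<And>n. open (\<Union>(W n))" "\<And>n. emeasure m (W n) < \<infinity>"
    "sets m = sigma_sets (lcosets \<Gamma>) (range W)" "(\<Union>n. W n) = lcosets \<Gamma>"
    by (rule pi_system_sequence) (rule that)
  have "koopman m (\<lambda>n. indicator (W n)) G (\<lambda>g x. g <# x)"
  proof
    show sq: "indicator (W n) \<in> sq_int m" for n
      by (rule indicator_sq_int[OF W(2,4)])
    show "AE x in m. f x = 0" if f: "f \<in> sq_int m" and orth: "\<And>n. sq_ip m f (indicator (W n)) = 0" for f
    proof -
      have cnj: "f x * cnj (indicator (W n) x) = indicator (W n) x * f x" for n x
        by (simp split: split_indicator)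
      have int: "integrable m (\<lambda>x. indicator (W n) x * f x)" for n
        using sq_int_ip_integrable[OF f sq[of n]] by (simp only: cnj)
      have zero: "(\<integral>x. indicator (W n) x * f x \<partial>m) = 0" for n
        using orth[of n] by (simp only: sq_ip_def cnj)
      have Re: "Re (indicator (W n) x * f x) = indicator (W n) x * Re (f x)"
        and Im: "Im (indicator (W n) x * f x) = indicator (W n) x * Im (f x)" for n x
        by (simp_all split: split_indicator)
      have "AE x in m. Re (f x) = 0"
      proof (rule AE_zero_if_integrals_zero[OF W(1,2,5,6)])
        show "integrable m (\<lambda>x. indicator (W n) x * Re (f x))" for n
          using integrable_Re[OF int[of n]] by (simp only: Re)
        show "(\<integral>x. indicator (W n) x * Re (f x) \<partial>m) = 0" for n
          using integral_Re[OF int[of n]] zero[of n] by (simp only: Re zero_complex.sel)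
      qed (use sq_intD(1)[OF f] in measurable)
      moreover have "AE x in m. Im (f x) = 0"
      proof (rule AE_zero_if_integrals_zero[OF W(1,2,5,6)])
        show "integrable m (\<lambda>x. indicator (W n) x * Im (f x))" for n
          using integrable_Im[OF int[of n]] by (simp only: Im)
        show "(\<integral>x. indicator (W n) x * Im (f x) \<partial>m) = 0" for n
          using integral_Im[OF int[of n]] zero[of n] by (simp only: Im zero_complex.sel)
      qed (use sq_intD(1)[OF f] in measurable)
      ultimately show ?thesis
        by eventually_elim (simp add: complex_eq_iff)
    qed
    show "(\<lambda>x. g <# x) \<in> measurable m m" for g
      by (rule measurable_translate)
    show "distr m m (\<lambda>x. g <# x) = m" for g
      by (rule translate_preserves)
    show "(g \<otimes> h) <# x = g <# (h <# x)" if "x \<in> space m" for g h x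
      using that by (auto elim!: cosetE simp: coset_translate m_assoc)
    show "\<one> <# x = x" if "x \<in> space m" for x
      using that by (auto elim!: cosetE simp: coset_translate)
    show "(\<lambda>k. sq_norm m (\<lambda>x. indicator (W n) (s k <# x) - indicator (W n) x)) \<longlonglongrightarrow> 0"
      if "s \<longlonglongrightarrow> \<one>" for s n
      by (rule sq_norm_indicator_translate[OF W(2,3,4) that])
  qed
  then show ?thesis
    by (rule that)
qed

lemma finite_if_invariant_function:
  assumes f: "f \<in> sq_int m" "sq_norm m f \<noteq> 0" and inv: "\<And>g. AE x in m. f (g <# x) = f x"
  shows "emeasure m (space m) < \<infinity>"
proof -
  note [measurable] = sq_intD(1)[OF f(1)]
  \<comment> \<open>The thresholds decrease to 0, so the sets exhaust the support of
    \<open>f\<close> and one of them is not null; \<open>Suc k\<close> keeps every threshold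
    positive, as the Chebyshev bound on the measure requires.\<close>
  define E where "E k = {x \<in> space m. 1 / real (Suc k) < (cmod (f x))\<^sup>2}" for k
  have E: "E k \<in> sets m" for k
    unfolding E_def by measurable
  have "\<exists>k. emeasure m (E k) \<noteq> 0"
  proof (rule ccontr)
    assume "\<not> ?thesis"
    then have "AE x in m. x \<notin> E k" for k
      using E[of k] by (intro AE_not_in) (auto simp: null_sets_def)
    then have "AE x in m. \<forall>k. x \<notin> E k"
      by (subst AE_all_countable) simp
    then have "AE x in m. f x = 0"
    proof (rule AE_mp, intro AE_I2 impI)
      fix x assume x: "x \<in> space m" "\<forall>k. x \<notin> E k"
      show "f x = 0"
      proof (rule ccontr)
        assume "f x \<noteq> 0"
        then have "0 < (cmod (f x))\<^sup>2" by simp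
        then obtain k where "1 / real (Suc k) < (cmod (f x))\<^sup>2"
          using nat_approx_posE by blast
        then show False
          using x by (auto simp: E_def)
      qed
    qed
    then show False
      using f sq_norm_zero_iff by blast
  qed
  then obtain k where k: "emeasure m (E k) \<noteq> 0" ..
  have "AE x in m. g <# x \<in> E k \<longleftrightarrow> x \<in> E k" for g
    using inv[of g]
  proof (rule AE_mp, intro AE_I2 impI)
    fix x assume "x \<in> space m" "f (g <# x) = f x"
    then show "g <# x \<in> E k \<longleftrightarrow> x \<in> E k"
      by (simp add: E_def translate_in)
  qed
  from ergodic[OF E this k] have "emeasure m (space m) = emeasure m (E k)" .
  also have "\<dots> < \<infinity>"
  proof -
    have "emeasure m (E k) = (\<integral>\<^sup>+x. indicator (E k) x \<partial>m)"
      using E by simp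
    also have "\<dots> \<le> (\<integral>\<^sup>+x. ennreal (real (Suc k) * (cmod (f x))\<^sup>2) \<partial>m)"
    proof (rule nn_integral_mono)
      fix x
      have "1 \<le> real (Suc k) * (cmod (f x))\<^sup>2" if "x \<in> E k"
        using that by (simp add: E_def field_simps)
      then show "indicator (E k) x \<le> ennreal (real (Suc k) * (cmod (f x))\<^sup>2)"
        by (auto simp: ennreal_ge_1 simp del: of_nat_Suc split: split_indicator)
    qed
    also have "\<dots> < \<infinity>"
      using integrable_mult_right[OF sq_intD(2)[OF f(1)], of "real (Suc k)"]
      by (subst nn_integral_eq_integral) auto
    finally show ?thesis .
  qed
  finally show ?thesis .
qed

end

section \<open>Lengths on the group and Riemannian balls\<close>

text \<open>Applied to squared displacements \<open>\<parallel>gv - v\<parallel>\<^sup>2\<close>, whence the factors \<open>2\<close>.\<close>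

lemma (in top_group) quasi_length_bounded_on_compact:
  assumes conn: "connected (UNIV :: 'g set)" and V: "open V" "\<one> \<in> V" and K: "compact K"
  obtains C :: real where "C \<ge> 0"
    "\<And>q a. \<lbrakk>\<And>g. 0 \<le> q g; \<And>g h. q (g \<otimes> h) \<le> 2 * q g + 2 * q h; \<And>g. g \<in> V \<Longrightarrow> q g \<le> a\<rbrakk>
      \<Longrightarrow> \<forall>g\<in>K. q g \<le> C * a"
proof -
  define adm where "adm q a \<longleftrightarrow> (\<forall>g. 0 \<le> q g) \<and> (\<forall>g h. q (g \<otimes> h) \<le> 2 * q g + 2 * q h) \<and> (\<forall>g\<in>V. q g \<le> a)"
    for q :: "'g \<Rightarrow> real" and a
  \<comment> \<open>One constant must serve all admissible \<open>q\<close> at once: the final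
    constant may depend on \<open>V\<close> and \<open>K\<close> but not on the vector whose
    displacement is measured.\<close>
  define bounded where "bounded C g \<longleftrightarrow> C \<ge> 0 \<and> (\<forall>q a. adm q a \<longrightarrow> q g \<le> C * a)" for C :: real and g
  have a_nonneg: "0 \<le> a" if "adm q a" for q a
    using that V(2) unfolding adm_def by (meson order_trans)
  have step: "bounded (2 * C + 2) h" if "bounded C g" "inv g \<otimes> h \<in> V" for C g h
  proof -
    have "q h \<le> (2 * C + 2) * a" if q: "adm q a" for q a
    proof -
      have "g \<otimes> (inv g \<otimes> h) = h"
        by (simp flip: m_assoc)
      then have "q h \<le> 2 * q g + 2 * q (inv g \<otimes> h)"
        using q unfolding adm_def by metis
      moreover have "q g \<le> C * a" "q (inv g \<otimes> h) \<le> a"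
        using q \<open>bounded C g\<close> \<open>inv g \<otimes> h \<in> V\<close> unfolding adm_def bounded_def by auto
      ultimately show ?thesis
        by (simp add: algebra_simps)
    qed
    then show ?thesis
      using \<open>bounded C g\<close> by (simp add: bounded_def)
  qed
  \<comment> \<open>By \<open>step\<close> a point with a constant passes one to all points of its
    translate of \<open>V\<close>, and a point without one has a neighbourhood of points without
    one. So \<open>?S\<close> is clopen, and it contains the identity.\<close>
  let ?S = "{g. \<exists>C. bounded C g}"
  have open_right: "open {h. inv g \<otimes> h \<in> V}" for g
    using open_vimage[OF V(1) continuous_translation, of "inv g"] by (simp add: vimage_def)
  have "open ?S"
    unfolding open_subopen[of ?S]
  proof
    fix g assume "g \<in> ?S"
    then have "{h. inv g \<otimes> h \<in> V} \<subseteq> ?S"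
      using step by blast
    then show "\<exists>T. open T \<and> g \<in> T \<and> T \<subseteq> ?S"
      using open_right[of g] V(2) by (intro exI[of _ "{h. inv g \<otimes> h \<in> V}"]) simp
  qed
  moreover have "open (- ?S)"
    unfolding open_subopen[of "- ?S"]
  proof
    fix g assume g: "g \<in> - ?S"
    have "open {h. inv h \<otimes> g \<in> V}"
      using open_vimage[OF V(1) continuous_on_mult[OF continuous_inverse continuous_on_const], of g]
      by (simp add: vimage_def)
    moreover have "{h. inv h \<otimes> g \<in> V} \<subseteq> - ?S"
      using step g by blast
    ultimately show "\<exists>T. open T \<and> g \<in> T \<and> T \<subseteq> - ?S"
      using V(2) by (intro exI[of _ "{h. inv h \<otimes> g \<in> V}"]) simp
  qed
  moreover have "\<forall>T::'g set. open T \<and> open (- T) \<longrightarrow> T = {} \<or> T = UNIV"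
    using conn by (simp add: connected_clopen[of UNIV] closed_def)
  ultimately have "?S = {} \<or> ?S = UNIV"
    by blast
  moreover have "bounded 1 \<one>"
    using V(2) by (simp add: bounded_def adm_def)
  ultimately have "\<forall>g. \<exists>C. bounded C g"
    by blast
  then obtain b where b: "\<And>g. bounded (b g) g"
    by metis
  obtain D where D: "D \<subseteq> K" "finite D" "K \<subseteq> (\<Union>g\<in>D. {h. inv g \<otimes> h \<in> V})"
    by (rule compactE_image[OF K, of K "\<lambda>g. {h. inv g \<otimes> h \<in> V}"]) (use open_right V(2) in auto)
  \<comment> \<open>The value \<open>2 * b g + 2\<close> bounds \<open>q\<close> on the translate of
    \<open>V\<close> at \<open>g\<close>; the sum over the finite cover dominates each of its
    nonnegative terms.\<close>
  define C where "C = (\<Sum>g\<in>D. 2 * b g + 2)"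
  have b_nonneg: "0 \<le> b g" for g
    using b[of g] by (simp add: bounded_def)
  show ?thesis
  proof
    show "C \<ge> 0"
      unfolding C_def using b_nonneg by (intro sum_nonneg) simp
    fix q :: "'g \<Rightarrow> real" and a
    assume "\<And>g. 0 \<le> q g" "\<And>g h. q (g \<otimes> h) \<le> 2 * q g + 2 * q h" "\<And>g. g \<in> V \<Longrightarrow> q g \<le> a"
    then have q: "adm q a"
      by (simp add: adm_def)
    show "\<forall>g\<in>K. q g \<le> C * a"
    proof
      fix h assume "h \<in> K"
      then obtain g where g: "g \<in> D" "inv g \<otimes> h \<in> V"
        using D(3) by blast
      have "q h \<le> (2 * b g + 2) * a"
        using step[OF b g(2)] q by (simp add: bounded_def)
      also have "\<dots> \<le> C * a"
        unfolding C_def using g(1) D(2) b_nonneg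
        by (intro mult_right_mono[OF _ a_nonneg[OF q]] member_le_sum[where f = "\<lambda>g. 2 * b g + 2"]) (auto simp: add_nonneg_nonneg)
      finally show "q h \<le> C * a" .
    qed
  qed
qed

section \<open>Charts and small Riemannian balls\<close>

lemma chart_inv_simps:
  assumes "is_chart c"
  shows "x \<in> fst c \<Longrightarrow> chart_inv c (snd c x) = x"
    and "y \<in> snd c ` fst c \<Longrightarrow> chart_inv c y \<in> fst c"
    and "y \<in> snd c ` fst c \<Longrightarrow> snd c (chart_inv c y) = y"
    and "continuous_on (fst c) (snd c)"
    and "continuous_on (snd c ` fst c) (chart_inv c)"
proof -
  obtain \<psi> where \<psi>: "homeomorphism (fst c) (snd c ` fst c) (snd c) \<psi>"
    using assms by (auto simp: is_chart_def)
  have inj: "inj_on (snd c) (fst c)"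
    by (rule inj_on_inverseI[of _ \<psi>]) (use \<psi> in \<open>simp add: homeomorphism_def\<close>)
  show 1: "x \<in> fst c \<Longrightarrow> chart_inv c (snd c x) = x" for x
    unfolding chart_inv_def by (rule the_inv_into_f_f[OF inj])
  show "y \<in> snd c ` fst c \<Longrightarrow> chart_inv c y \<in> fst c"
    "y \<in> snd c ` fst c \<Longrightarrow> snd c (chart_inv c y) = y"
    using 1 by auto
  show "continuous_on (fst c) (snd c)"
    using \<psi> by (simp add: homeomorphism_def)
  have "continuous_on (snd c ` fst c) \<psi>"
    using \<psi> by (simp add: homeomorphism_def)
  then show "continuous_on (snd c ` fst c) (chart_inv c)"
    by (rule continuous_on_eq) (use \<psi> 1 in \<open>auto simp: homeomorphism_def\<close>)
qed

lemma open_chart_preimage: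
  assumes "is_chart c" "open T"
  shows "open {x \<in> fst c. snd c x \<in> T}"
proof -
  have "open (fst c \<inter> snd c -` T)"
    using assms chart_inv_simps(4)[OF assms(1)]
    by (intro continuous_open_preimage) (auto simp: is_chart_def)
  moreover have "fst c \<inter> snd c -` T = {x \<in> fst c. snd c x \<in> T}"
    by auto
  ultimately show ?thesis
    by simp
qed

text \<open>A closed ball inside the open chart image pulls back to a compact neighbourhood. It
  provides the neighbourhoods of finite Haar measure.\<close>

lemma smooth_atlas_locally_compact:
  fixes A :: "('g::{second_countable_topology, t2_space}, 'e::euclidean_space) chart set" and x :: 'g
  assumes "smooth_atlas A"
  obtains U K where "open U" "x \<in> U" "U \<subseteq> K" "compact K"
proof -
  obtain c where c: "c \<in> A" "x \<in> fst c"
    using assms unfolding smooth_atlas_def by (metis UNIV_I UN_E)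
  have ch: "is_chart c"
    using assms c by (simp add: smooth_atlas_def)
  have "open (snd c ` fst c)" "snd c x \<in> snd c ` fst c"
    using ch c by (auto simp: is_chart_def)
  then obtain r where r: "r > 0" "cball (snd c x) r \<subseteq> snd c ` fst c"
    unfolding open_contains_cball by blast
  show ?thesis
  proof
    show "open {y \<in> fst c. snd c y \<in> ball (snd c x) r}"
      by (rule open_chart_preimage[OF ch]) simp
    show "x \<in> {y \<in> fst c. snd c y \<in> ball (snd c x) r}"
      using c r by simp
    show "{y \<in> fst c. snd c y \<in> ball (snd c x) r} \<subseteq> chart_inv c ` cball (snd c x) r"
    proof
      fix y assume "y \<in> {y \<in> fst c. snd c y \<in> ball (snd c x) r}"
      then show "y \<in> chart_inv c ` cball (snd c x) r"
        using chart_inv_simps(1)[OF ch, of y] by (intro image_eqI[of _ _ "snd c y"]) auto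
    qed
    show "compact (chart_inv c ` cball (snd c x) r)"
      using chart_inv_simps(5)[OF ch] r(2)
      by (intro compact_continuous_image) (auto intro: continuous_on_subset)
  qed
qed

text \<open>A point near \<open>p\<close> is joined to \<open>p\<close> by a segment in a chart. Its length does not exceed the
  supremum of its speed, which is small because the metric coefficients are bounded near \<open>p\<close>.\<close>

lemma riemannian_ball_neighbourhood:
  fixes A :: "('g::{second_countable_topology, t2_space}, 'e::euclidean_space) chart set" and p :: 'g
  assumes A: "smooth_atlas A" and R: "riemannian_metric A R"
  obtains V where "open V" "p \<in> V" "\<And>h. h \<in> V \<Longrightarrow> riemannian_dist A R p h < 1"
proof -
  obtain c where c: "c \<in> A" "p \<in> fst c"
    using A unfolding smooth_atlas_def by (metis UNIV_I UN_E)
  have charts: "is_chart c'" if "c' \<in> A" for c'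
    using A that by (simp add: smooth_atlas_def)
  note ch = charts[OF c(1)]
  note cs = chart_inv_simps[OF ch]
  define x0 where "x0 = snd c p"
  have "open (snd c ` fst c)" "x0 \<in> snd c ` fst c"
    using ch c by (auto simp: is_chart_def x0_def)
  then obtain r where r: "r > 0" "cball x0 r \<subseteq> snd c ` fst c"
    unfolding open_contains_cball by blast
  have bounded: "\<exists>B. \<forall>x\<in>cball x0 r. \<bar>R c (chart_inv c x) u v\<bar> \<le> B" for u v
  proof -
    have "smooth_on (snd c ` fst c) (\<lambda>x. R c (chart_inv c x) u v)"
      using R c(1) unfolding riemannian_metric_def by blast
    then have "Ck_on 0 (snd c ` fst c) (\<lambda>x. R c (chart_inv c x) u v)"
      unfolding smooth_on_def by blast
    then have "continuous_on (cball x0 r) (\<lambda>x. R c (chart_inv c x) u v)"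
      using r(2) by (auto intro: continuous_on_subset)
    then have "compact ((\<lambda>x. R c (chart_inv c x) u v) ` cball x0 r)"
      by (intro compact_continuous_image) auto
    from compact_imp_bounded[OF this] show ?thesis
      unfolding bounded_real by blast
  qed
  then obtain B where B: "\<And>u v x. x \<in> cball x0 r \<Longrightarrow> \<bar>R c (chart_inv c x) u v\<bar> \<le> B u v"
    by metis
  \<comment> \<open>Each pair of coordinates of \<open>w\<close> has product at most the squared
    norm, so the sum of coefficient bounds controls the quadratic form; adding 1 makes
    \<open>M\<close> positive for the division below.\<close>
  define M where "M = (\<Sum>i\<in>Basis. \<Sum>j\<in>Basis. \<bar>B i j\<bar>) + 1"
  have M_pos: "M > 0"
    unfolding M_def by (intro add_nonneg_pos sum_nonneg) auto
  have quad: "R c (chart_inv c x) w w \<le> M * (norm w)\<^sup>2" if x: "x \<in> cball x0 r" for x w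
  proof -
    let ?b = "R c (chart_inv c x)"
    have bil: "bilinear ?b"
    proof -
      have "chart_inv c x \<in> fst c"
        using cs(2) r(2) x by blast
      then show ?thesis
        by (rule conjunct1[OF bspec[OF bspec[OF conjunct1[OF R[unfolded riemannian_metric_def]] c(1)]]])
    qed
    have "?b w w = (\<Sum>i\<in>Basis. \<Sum>j\<in>Basis. (w \<bullet> i) * (w \<bullet> j) * ?b i j)"
    proof -
      have "?b w w = ?b (\<Sum>i\<in>Basis. (w \<bullet> i) *\<^sub>R i) (\<Sum>j\<in>Basis. (w \<bullet> j) *\<^sub>R j)"
        by (simp only: euclidean_representation)
      also have "\<dots> = (\<Sum>(i, j)\<in>Basis \<times> Basis. ?b ((w \<bullet> i) *\<^sub>R i) ((w \<bullet> j) *\<^sub>R j))"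
        by (rule bilinear_sum[OF bil])
      also have "\<dots> = (\<Sum>i\<in>Basis. \<Sum>j\<in>Basis. (w \<bullet> i) * (w \<bullet> j) * ?b i j)"
        by (simp add: sum.cartesian_product bilinear_lmul[OF bil] bilinear_rmul[OF bil] mult_ac)
      finally show ?thesis .
    qed
    also have "\<dots> \<le> (\<Sum>i\<in>Basis. \<Sum>j\<in>Basis. (norm w)\<^sup>2 * \<bar>B i j\<bar>)"
    proof (intro sum_mono)
      fix i j :: 'e assume ij: "i \<in> Basis" "j \<in> Basis"
      have "(w \<bullet> i) * (w \<bullet> j) * ?b i j \<le> \<bar>w \<bullet> i\<bar> * \<bar>w \<bullet> j\<bar> * \<bar>?b i j\<bar>"
        by (metis abs_ge_self abs_mult)
      also have "\<dots> \<le> norm w * norm w * \<bar>B i j\<bar>"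
        using ij B[OF x, of i j] by (intro mult_mono Basis_le_norm) auto
      finally show "(w \<bullet> i) * (w \<bullet> j) * ?b i j \<le> (norm w)\<^sup>2 * \<bar>B i j\<bar>"
        by (simp add: power2_eq_square)
    qed
    also have "\<dots> = (norm w)\<^sup>2 * (M - 1)"
      by (simp add: M_def sum_distrib_left)
    also have "\<dots> \<le> M * (norm w)\<^sup>2"
      by (simp add: algebra_simps)
    finally show ?thesis .
  qed
  \<comment> \<open>The first entry keeps the segment inside the ball where \<open>M\<close> is
    valid; the second makes the speed at most 1/2, which leaves room for a strict
    inequality.\<close>
  define \<delta> where "\<delta> = min r (1 / (2 * sqrt M))"
  have \<delta>: "\<delta> > 0" "\<delta> \<le> r" "sqrt M * \<delta> \<le> 1/2"
    using r M_pos by (auto simp: \<delta>_def min_def field_simps)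
  have "riemannian_dist A R p h < 1" if h: "h \<in> fst c" "snd c h \<in> ball x0 \<delta>" for h
  proof -
    define w where "w = snd c h - x0"
    \<comment> \<open>The segment is defined for all real \<open>t\<close>, as
      \<open>C1_differentiable_on\<close> asks for two-sided derivatives even at 0 and 1; slightly
      beyond the end points it still lies in the open chart image.\<close>
    define l where "l t = x0 + t *\<^sub>R w" for t
    define \<gamma> where "\<gamma> t = chart_inv c (l t)" for t
    have norm_w: "norm w < \<delta>"
      using h(2) by (simp add: w_def dist_norm norm_minus_commute)
    have l_in: "l t \<in> cball x0 r" if "t \<in> {0..1}" for t
    proof -
      have "\<bar>t\<bar> * norm w \<le> 1 * norm w"
        using that by (intro mult_right_mono) auto
      then show ?thesis
        using norm_w \<delta>(2) by (simp add: l_def dist_norm)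
    qed
    have l_img: "l t \<in> snd c ` fst c" if "t \<in> {0..1}" for t
      using l_in[OF that] r(2) by blast
    have \<gamma>_in: "\<gamma> t \<in> fst c" and \<gamma>_chart: "snd c (\<gamma> t) = l t" if "t \<in> {0..1}" for t
      unfolding \<gamma>_def using cs(2,3)[OF l_img[OF that]] by auto
    have l_cont: "continuous_on S l" for S
      unfolding l_def by (intro continuous_intros)
    have \<gamma>_cont: "continuous_on {0..1} \<gamma>"
      unfolding \<gamma>_def by (rule continuous_on_compose2[OF cs(5) l_cont]) (use l_img in blast)
    have \<gamma>0: "\<gamma> 0 = p" and \<gamma>1: "\<gamma> 1 = h"
      using cs(1) c h by (simp_all add: \<gamma>_def l_def w_def x0_def)
    \<comment> \<open>Transition maps are needed because regularity of a path is tested in every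
      chart, and \<open>path_speed\<close> measures in an arbitrarily chosen one. The transformation
      law of the metric brings that speed back to \<open>c\<close>.\<close>
    define tr where "tr c' = snd c' \<circ> chart_inv c" for c' :: "('g, 'e) chart"
    have tr: "tr c' differentiable (at (l t))"
      "continuous_on (snd c ` (fst c \<inter> fst c')) (\<lambda>x. frechet_derivative (tr c') (at x) w)"
      "l t \<in> snd c ` (fst c \<inter> fst c')"
      if c': "c' \<in> A" "t \<in> {0..1}" "\<gamma> t \<in> fst c'" for c' t
    proof -
      have "smooth_on (snd c ` (fst c \<inter> fst c')) (tr c')"
        using A c(1) c'(1) unfolding smooth_atlas_def tr_def by blast
      then have 1: "Ck_on (Suc 0) (snd c ` (fst c \<inter> fst c')) (tr c')"
        unfolding smooth_on_def by blast
      then show "continuous_on (snd c ` (fst c \<inter> fst c')) (\<lambda>x. frechet_derivative (tr c') (at x) w)"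
        by simp
      show in_S: "l t \<in> snd c ` (fst c \<inter> fst c')"
        using \<gamma>_in[OF c'(2)] \<gamma>_chart[OF c'(2)] c'(3) by (metis IntI imageI)
      have "snd c ` (fst c \<inter> fst c') = {y \<in> snd c ` fst c. chart_inv c y \<in> fst c'}"
        using cs(1) by auto
      also have "open \<dots>"
      proof -
        have "open (snd c ` fst c \<inter> chart_inv c -` fst c')"
          using ch charts[OF c'(1)] cs(5) by (intro continuous_open_preimage) (auto simp: is_chart_def)
        moreover have "snd c ` fst c \<inter> chart_inv c -` fst c' = {y \<in> snd c ` fst c. chart_inv c y \<in> fst c'}"
          by auto
        ultimately show ?thesis
          by simp
      qed
      finally have "open (snd c ` (fst c \<inter> fst c'))" .
      then show "tr c' differentiable (at (l t))"
        using 1 in_S differentiable_on_eq_differentiable_at[of "snd c ` (fst c \<inter> fst c')" "tr c'"]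
        unfolding Ck_on.simps by blast
    qed
    have vd: "((snd c' \<circ> \<gamma>) has_vector_derivative frechet_derivative (tr c') (at (l t)) w) (at t)"
      if c': "c' \<in> A" "t \<in> {0..1}" "\<gamma> t \<in> fst c'" for c' t
    proof -
      have l: "(l has_derivative (\<lambda>s. s *\<^sub>R w)) (at t)"
        unfolding l_def by (auto intro!: derivative_eq_intros)
      have tr': "(tr c' has_derivative frechet_derivative (tr c') (at (l t))) (at (l t))"
        using tr(1)[OF c'] frechet_derivative_works by blast
      have "(tr c' \<circ> l has_derivative frechet_derivative (tr c') (at (l t)) \<circ> (\<lambda>s. s *\<^sub>R w)) (at t)"
        by (rule diff_chain_at[OF l tr'])
      moreover have "frechet_derivative (tr c') (at (l t)) \<circ> (\<lambda>s. s *\<^sub>R w)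
          = (\<lambda>s. s *\<^sub>R frechet_derivative (tr c') (at (l t)) w)"
        using linear_frechet_derivative[OF tr(1)[OF c']] by (auto simp: fun_eq_iff linear_scale)
      moreover have "tr c' \<circ> l = snd c' \<circ> \<gamma>"
        by (simp add: tr_def \<gamma>_def fun_eq_iff)
      ultimately show ?thesis
        by (simp add: has_vector_derivative_def)
    qed
    have path: "piecewise_C1_path A \<gamma>"
      unfolding piecewise_C1_path_def
    proof (intro conjI \<gamma>_cont exI[of _ "{}"] ballI)
      fix c' assume c': "c' \<in> A"
      show "(snd c' \<circ> \<gamma>) C1_differentiable_on {t \<in> {0..1} - {}. \<gamma> t \<in> fst c'}"
        unfolding C1_differentiable_on_def
      proof (intro exI[of _ "\<lambda>t. frechet_derivative (tr c') (at (l t)) w"] conjI ballI)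
        fix t assume "t \<in> {t \<in> {0..1} - {}. \<gamma> t \<in> fst c'}"
        then show "((snd c' \<circ> \<gamma>) has_vector_derivative frechet_derivative (tr c') (at (l t)) w) (at t)"
          using vd[OF c'] by simp
      next
        show "continuous_on {t \<in> {0..1} - {}. \<gamma> t \<in> fst c'} (\<lambda>t. frechet_derivative (tr c') (at (l t)) w)"
        proof (cases "{t \<in> {0..1}. \<gamma> t \<in> fst c'} = {}")
          case True
          then have "{t \<in> {0..1} - {}. \<gamma> t \<in> fst c'} = {}" by simp
          then show ?thesis by (simp only: continuous_on_empty)
        next
          case False
          then have "continuous_on (snd c ` (fst c \<inter> fst c')) (\<lambda>x. frechet_derivative (tr c') (at x) w)"
            using tr(2)[OF c'] by blast
          then show ?thesis
            by (rule continuous_on_compose2[OF _ l_cont]) (use tr(3)[OF c'] in auto)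
        qed
      qed
    qed simp
    have speed: "path_speed A R \<gamma> t \<le> 1/2" if t: "t \<in> {0..1}" for t
    proof -
      define c' where "c' = (SOME c'. c' \<in> A \<and> \<gamma> t \<in> fst c')"
      have c': "c' \<in> A \<and> \<gamma> t \<in> fst c'"
        unfolding c'_def by (rule someI[of _ c]) (use c \<gamma>_in t in auto)
      let ?v = "vector_derivative (snd c' \<circ> \<gamma>) (at t)"
      have "?v = frechet_derivative (tr c') (at (l t)) w"
        using vd[of c' t] c' t by (intro vector_derivative_at) auto
      also have "\<dots> = chart_deriv c c' id (\<gamma> t) w"
        using \<gamma>_chart[OF t] by (simp add: chart_deriv_def tr_def)
      finally have "R c' (\<gamma> t) ?v ?v = R c (\<gamma> t) w w"
        using R c(1) c' \<gamma>_in[OF t] unfolding riemannian_metric_def by (metis IntI)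
      then have "path_speed A R \<gamma> t = sqrt (R c (\<gamma> t) w w)"
        by (simp add: path_speed_def Let_def flip: c'_def)
      also have "\<dots> \<le> sqrt (M * (norm w)\<^sup>2)"
        using quad[OF l_in[OF t], of w] by (simp add: \<gamma>_def)
      also have "\<dots> = sqrt M * norm w"
        by (simp add: real_sqrt_mult)
      also have "\<dots> \<le> sqrt M * \<delta>"
        using norm_w M_pos by (intro mult_left_mono) auto
      finally show ?thesis
        using \<delta>(3) by simp
    qed
    have "path_length A R \<gamma> \<le> (\<integral>\<^sup>+t. ennreal (1/2) * indicator {0..1::real} t \<partial>lborel)"
      unfolding path_length_def
    proof (rule nn_integral_mono)
      fix t
      show "ennreal (path_speed A R \<gamma> t) * indicator {0..1} t \<le> ennreal (1/2) * indicator {0..1} t"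
      proof (cases "t \<in> {0..1}")
        case True
        then show ?thesis
          by (intro mult_right_mono ennreal_leI speed) auto
      qed simp
    qed
    also have "\<dots> = ennreal (1/2)"
      by (subst nn_integral_cmult_indicator) auto
    finally have "(INF \<gamma>\<in>{\<gamma>. piecewise_C1_path A \<gamma> \<and> \<gamma> 0 = p \<and> \<gamma> 1 = h}. path_length A R \<gamma>) \<le> ennreal (1/2)"
      using path \<gamma>0 \<gamma>1 by (intro INF_lower2[of \<gamma>]) auto
    then have "riemannian_dist A R p h \<le> enn2real (ennreal (1/2))"
      unfolding riemannian_dist_def by (rule enn2real_mono) (rule ennreal_less_top)
    also have "\<dots> = 1/2"
      by (rule enn2real_ennreal) simp
    finally show ?thesis
      by simp
  qed
  moreover have "open {h \<in> fst c. snd c h \<in> ball x0 \<delta>}"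
    by (rule open_chart_preimage[OF ch]) simp
  moreover have "p \<in> {h \<in> fst c. snd c h \<in> ball x0 \<delta>}"
    using c \<delta>(1) by (simp add: x0_def)
  ultimately show ?thesis
    using that[of "{h \<in> fst c. snd c h \<in> ball x0 \<delta>}"] by blast
qed

section \<open>Almost invariant densities\<close>

text \<open>A non-integrable function has integral 0 by default, so the bound covers every pointwise
  bounded \<open>h\<close>. Consequently the supremum in \<open>W1\<close> is over a set bounded by
  2.\<close>

lemma prob_integral_abs_le:
  assumes "prob_space \<alpha>" "\<And>y. \<bar>h y\<bar> \<le> 1"
  shows "\<bar>\<integral>y. h y \<partial>\<alpha>\<bar> \<le> (1 :: real)"
proof (cases "integrable \<alpha> h")
  case True
  interpret prob_space \<alpha> by fact
  have "\<bar>\<integral>y. h y \<partial>\<alpha>\<bar> \<le> (\<integral>y. \<bar>h y\<bar> \<partial>\<alpha>)"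
    by (rule integral_abs_bound)
  also have "\<dots> \<le> (\<integral>y. 1 \<partial>\<alpha>)"
    using True assms(2) by (intro integral_mono) auto
  finally show ?thesis
    by (simp add: prob_space)
qed (simp add: not_integrable_integral_eq)

lemma W1_upper:
  assumes "prob_space \<alpha>" "prob_space \<beta>" "1-lipschitz_on UNIV \<phi>" "\<And>t. \<bar>\<phi> t\<bar> \<le> 1"
  shows "\<bar>(\<integral>y. \<phi> (f y) \<partial>\<alpha>) - (\<integral>y. \<phi> (f y) \<partial>\<beta>)\<bar> \<le> W1 f \<alpha> \<beta>"
  unfolding W1_def
proof (rule cSUP_upper)
  show "bdd_above ((\<lambda>\<phi> :: real \<Rightarrow> real. \<bar>(\<integral>y. \<phi> (f y) \<partial>\<alpha>) - (\<integral>y. \<phi> (f y) \<partial>\<beta>)\<bar>) `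
      {\<phi>. 1-lipschitz_on UNIV \<phi> \<and> (\<forall>t. \<bar>\<phi> t\<bar> \<le> 1)})"
  proof (rule bdd_aboveI[where M = "2::real"], elim imageE CollectE conjE)
    fix x :: real and \<psi> :: "real \<Rightarrow> real"
    assume "x = \<bar>(\<integral>y. \<psi> (f y) \<partial>\<alpha>) - (\<integral>y. \<psi> (f y) \<partial>\<beta>)\<bar>" "\<forall>t. \<bar>\<psi> t\<bar> \<le> 1"
    then show "x \<le> 2"
      using prob_integral_abs_le[OF assms(1), of "\<lambda>y. \<psi> (f y)"]
        prob_integral_abs_le[OF assms(2), of "\<lambda>y. \<psi> (f y)"] by auto
  qed
qed (use assms in auto)

text \<open>All entries of the supremum are 0; the zero test function shows that the index set is
  nonempty, without which a real supremum would be unspecified.\<close>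

lemma W1_self: "W1 f \<alpha> \<alpha> = 0"
proof -
  have "(\<lambda>_. 0) \<in> {\<phi> :: real \<Rightarrow> real. 1-lipschitz_on UNIV \<phi> \<and> (\<forall>t. \<bar>\<phi> t\<bar> \<le> 1)}"
    by (auto simp: lipschitz_on_def)
  then have "{\<phi> :: real \<Rightarrow> real. 1-lipschitz_on UNIV \<phi> \<and> (\<forall>t. \<bar>\<phi> t\<bar> \<le> 1)} \<noteq> {}"
    by blast
  then show ?thesis
    by (simp add: W1_def)
qed

definition clamp_test :: "real \<Rightarrow> real" where
  "clamp_test t = max (- 1) (min 1 (t - 1))"

lemma clamp_test_lipschitz: "1-lipschitz_on UNIV clamp_test"
  by (rule lipschitz_onI) (auto simp: clamp_test_def dist_real_def max_def min_def)

lemma clamp_test_bounded: "\<bar>clamp_test t\<bar> \<le> 1"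
  by (auto simp: clamp_test_def)

text \<open>With s = sqrt (p/q) and after division by q, the claim compares (s - 1)^2 with the clamp
  times s^2 - 1. For s^2 \<le> 2 the right side is (s - 1)^2 (s + 1)^2, where s + 1 \<ge> 1; beyond
  that the clamp is 1 and the difference is 2(s - 1) \<ge> 0.\<close>

lemma hellinger_le_clamp_test:
  fixes p q :: real
  assumes "p \<ge> 0" "q > 0"
  shows "(sqrt q - sqrt p)\<^sup>2 \<le> clamp_test (p / q) * (p - q)"
proof -
  define s where "s = sqrt (p / q)"
  have s: "s \<ge> 0" "p / q = s\<^sup>2"
    using assms by (simp_all add: s_def)
  have "(s - 1)\<^sup>2 \<le> clamp_test (s\<^sup>2) * (s\<^sup>2 - 1)"
  proof (cases "s\<^sup>2 \<le> 2")
    case True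
    then have "clamp_test (s\<^sup>2) = s\<^sup>2 - 1"
      by (auto simp: clamp_test_def)
    moreover have "(s - 1)\<^sup>2 * 1 \<le> (s - 1)\<^sup>2 * (s + 1)\<^sup>2"
      using s(1) by (intro mult_left_mono) auto
    moreover have "(s - 1)\<^sup>2 * (s + 1)\<^sup>2 = (s\<^sup>2 - 1) * (s\<^sup>2 - 1)"
      by (simp add: power2_eq_square algebra_simps)
    ultimately show ?thesis
      by simp
  next
    case False
    then have "clamp_test (s\<^sup>2) = 1"
      by (auto simp: clamp_test_def)
    moreover have "s \<ge> 1"
    proof (rule ccontr)
      assume "\<not> s \<ge> 1"
      then have "s\<^sup>2 \<le> 1\<^sup>2"
        using s(1) by (intro power_mono) auto
      then show False
        using False by simp
    qed
    ultimately show ?thesis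
      by (simp add: power2_diff)
  qed
  then have "q * (s - 1)\<^sup>2 \<le> q * (clamp_test (s\<^sup>2) * (s\<^sup>2 - 1))"
    using assms by (intro mult_left_mono) auto
  moreover have "q * (s - 1)\<^sup>2 = (sqrt q - sqrt p)\<^sup>2"
  proof -
    have "sqrt p = sqrt q * s"
      using assms by (simp add: s_def real_sqrt_divide)
    then have "(sqrt q - sqrt p)\<^sup>2 = (sqrt q)\<^sup>2 * (1 - s)\<^sup>2"
      by (simp add: power2_eq_square algebra_simps)
    then show ?thesis
      using assms by (simp add: power2_commute)
  qed
  moreover have "q * (clamp_test (s\<^sup>2) * (s\<^sup>2 - 1)) = clamp_test (p / q) * (p - q)"
    using assms unfolding s(2)[symmetric] by (simp add: field_simps)
  ultimately show ?thesis
    by simp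
qed

context coset_action
begin

text \<open>A change of variables, with \<open>translate_preserves\<close> absorbing the effect on
  \<open>m\<close>.\<close>

lemma translate_density:
  assumes "\<rho> \<in> borel_measurable m"
  shows "translate_measure G \<Gamma> g (density m (\<lambda>x. ennreal (\<rho> x))) = density m (\<lambda>x. ennreal (\<rho> (inv g <# x)))"
proof (rule measure_eqI)
  note [measurable] = assms measurable_translate
  have meas: "(\<lambda>x. g <# x) \<in> measurable (density m (\<lambda>x. ennreal (\<rho> x))) (coset_borel G \<Gamma>)"
    using measurable_translate[of g] by (simp cong: measurable_cong_sets add: measurable_cong_sets[OF refl sets_m_coset_borel])
  show "sets (translate_measure G \<Gamma> g (density m (\<lambda>x. ennreal (\<rho> x)))) = sets (density m (\<lambda>x. ennreal (\<rho> (inv g <# x))))"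
    by (simp add: translate_measure_def sets_m_coset_borel)
  fix W assume "W \<in> sets (translate_measure G \<Gamma> g (density m (\<lambda>x. ennreal (\<rho> x))))"
  then have W: "W \<in> sets m"
    by (simp add: translate_measure_def sets_m_coset_borel)
  have pre: "(\<lambda>x. g <# x) -` W \<inter> space m \<in> sets m"
    by (rule measurable_sets[OF measurable_translate W])
  have "emeasure (translate_measure G \<Gamma> g (density m (\<lambda>x. ennreal (\<rho> x)))) W
      = emeasure (density m (\<lambda>x. ennreal (\<rho> x))) ((\<lambda>x. g <# x) -` W \<inter> space m)"
    unfolding translate_measure_def using W sets_m_coset_borel by (subst emeasure_distr[OF meas]) simp_all
  also have "\<dots> = (\<integral>\<^sup>+x. ennreal (\<rho> x) * indicator ((\<lambda>x. g <# x) -` W \<inter> space m) x \<partial>m)"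
    using pre by (intro emeasure_density) auto
  also have "\<dots> = (\<integral>\<^sup>+x. ennreal (\<rho> (inv g <# (g <# x))) * indicator W (g <# x) \<partial>m)"
  proof (rule nn_integral_cong)
    fix x assume x: "x \<in> space m"
    then have "inv g <# (g <# x) = x"
      by (auto elim!: cosetE simp: coset_translate simp flip: m_assoc)
    then show "ennreal (\<rho> x) * indicator ((\<lambda>x. g <# x) -` W \<inter> space m) x
        = ennreal (\<rho> (inv g <# (g <# x))) * indicator W (g <# x)"
      using x by (auto split: split_indicator)
  qed
  also have "\<dots> = (\<integral>\<^sup>+x. ennreal (\<rho> (inv g <# x)) * indicator W x \<partial>distr m m (\<lambda>x. g <# x))"
    by (intro nn_integral_distr[symmetric] measurable_translate) (use W in measurable)
  also have "\<dots> = emeasure (density m (\<lambda>x. ennreal (\<rho> (inv g <# x)))) W"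
    unfolding translate_preserves using W by (intro emeasure_density[symmetric]) measurable
  finally show "emeasure (translate_measure G \<Gamma> g (density m (\<lambda>x. ennreal (\<rho> x)))) W
      = emeasure (density m (\<lambda>x. ennreal (\<rho> (inv g <# x)))) W" .
qed

lemma sqrt_density_sq_int:
  assumes "prob_space \<nu>" "density_version m \<nu> \<rho>"
  shows "(\<lambda>x. complex_of_real (sqrt (\<rho> x))) \<in> sq_int m" "sq_norm m (\<lambda>x. complex_of_real (sqrt (\<rho> x))) = 1"
    "integrable m \<rho>"
proof -
  have \<rho>: "\<rho> \<in> borel_measurable m" "\<And>x. 0 \<le> \<rho> x" "\<nu> = density m (\<lambda>x. ennreal (\<rho> x))"
    using assms(2) by (auto simp: density_version_def)
  note [measurable] = \<rho>(1)
  have "(\<integral>\<^sup>+x. ennreal (\<rho> x) \<partial>m) = emeasure \<nu> (space \<nu>)"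
    unfolding \<rho>(3) using sets.top[of m] by (subst emeasure_density) (auto intro!: nn_integral_cong)
  also have "\<dots> = 1"
    using assms(1) by (rule prob_space.emeasure_space_1)
  finally have one: "(\<integral>\<^sup>+x. ennreal (\<rho> x) \<partial>m) = 1" .
  then show int: "integrable m \<rho>"
    using \<rho>(2) by (intro integrableI_nonneg) auto
  then show "(\<lambda>x. complex_of_real (sqrt (\<rho> x))) \<in> sq_int m"
    using \<rho>(2) by (simp add: sq_int_def)
  have "ennreal (\<integral>x. \<rho> x \<partial>m) = 1"
    using one nn_integral_eq_integral[OF int] \<rho>(2) by simp
  then show "sq_norm m (\<lambda>x. complex_of_real (sqrt (\<rho> x))) = 1"
    using \<rho>(2) by (simp add: sq_norm_def)
qed

lemma sqrt_density_almost_invariant: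
  assumes \<nu>: "prob_space \<nu>" "density_version m \<nu> \<rho>"
    and ac: "absolutely_continuous (translate_measure G \<Gamma> g \<nu>) \<nu>"
    and W1: "W1 (density_ratio G \<rho> g) (translate_measure G \<Gamma> g \<nu>) \<nu> \<le> \<epsilon>"
  shows "sq_norm m (\<lambda>x. complex_of_real (sqrt (\<rho> (inv g <# x))) - complex_of_real (sqrt (\<rho> x))) \<le> \<epsilon>"
proof -
  have \<rho>: "\<rho> \<in> borel_measurable m" "\<And>x. 0 \<le> \<rho> x" "\<nu> = density m (\<lambda>x. ennreal (\<rho> x))"
    using \<nu>(2) by (auto simp: density_version_def)
  note [measurable] = \<rho>(1) measurable_translate
  define \<sigma> where "\<sigma> x = \<rho> (inv g <# x)" for x
  have \<sigma>_meas [measurable]: "\<sigma> \<in> borel_measurable m"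
    unfolding \<sigma>_def by measurable
  have \<sigma>_nonneg: "0 \<le> \<sigma> x" for x
    by (simp add: \<sigma>_def \<rho>(2))
  have g\<nu>: "translate_measure G \<Gamma> g \<nu> = density m (\<lambda>x. ennreal (\<sigma> x))"
    unfolding \<rho>(3) \<sigma>_def by (rule translate_density[OF \<rho>(1)])
  have prob_g\<nu>: "prob_space (translate_measure G \<Gamma> g \<nu>)"
    unfolding translate_measure_def
  proof (rule prob_space.prob_space_distr[OF \<nu>(1)])
    show "(\<lambda>x. g <# x) \<in> measurable \<nu> (coset_borel G \<Gamma>)"
      unfolding \<rho>(3) using measurable_translate[of g] sets_m_coset_borel
      by (simp add: measurable_def sets_eq_imp_space_eq[OF sets_m_coset_borel, symmetric])
  qed
  have \<sigma>_version: "density_version m (translate_measure G \<Gamma> g \<nu>) \<sigma>"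
    using \<sigma>_nonneg by (simp add: density_version_def g\<nu>)
  note int_\<rho> = sqrt_density_sq_int(3)[OF \<nu>]
  note int_\<sigma> = sqrt_density_sq_int(3)[OF prob_g\<nu> \<sigma>_version]
  \<comment> \<open>Where \<sigma> vanishes, division by zero makes the ratio 0 and the test
    function -1, and the pointwise comparison would read \<rho> \<le> -\<rho>. Absolute continuity
    of \<nu> with respect to its translate rules this out: almost everywhere \<rho> vanishes there
    too.\<close>
  have "AE x in density m (\<lambda>x. ennreal (\<sigma> x)). 0 < \<sigma> x"
    by (subst AE_density) auto
  then have "AE x in \<nu>. 0 < \<sigma> x"
    by (intro absolutely_continuous_AE[OF _ ac[unfolded g\<nu>]]) (simp_all add: \<rho>(3))
  then have pos: "AE x in m. 0 < \<rho> x \<longrightarrow> 0 < \<sigma> x"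
    unfolding \<rho>(3) by (subst (asm) AE_density) auto
  define h where "h x = clamp_test (\<rho> x / \<sigma> x)" for x
  have [measurable]: "h \<in> borel_measurable m"
    unfolding h_def clamp_test_def by measurable
  have ratio: "clamp_test (density_ratio G \<rho> g x) = h x" for x
    by (simp add: density_ratio_def h_def \<sigma>_def)
  have int_h: "integrable m (\<lambda>x. \<tau> x * h x)" if "integrable m \<tau>" for \<tau>
  proof (rule Bochner_Integration.integrable_bound[OF that])
    show "AE x in m. norm (\<tau> x * h x) \<le> norm (\<tau> x)"
      using clamp_test_bounded by (auto simp: h_def abs_mult intro!: AE_I2 mult_left_le)
  qed (use that in measurable)
  have "sq_norm m (\<lambda>x. complex_of_real (sqrt (\<sigma> x)) - complex_of_real (sqrt (\<rho> x)))
      \<le> (\<integral>x. \<rho> x * h x - \<sigma> x * h x \<partial>m)"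
    unfolding sq_norm_def
  proof (rule integral_mono_AE)
    show "integrable m (\<lambda>x. (cmod (complex_of_real (sqrt (\<sigma> x)) - complex_of_real (sqrt (\<rho> x))))\<^sup>2)"
      using sq_int_diff[OF sqrt_density_sq_int(1)[OF prob_g\<nu> \<sigma>_version] sqrt_density_sq_int(1)[OF \<nu>]]
      by (rule sq_intD(2))
    show "integrable m (\<lambda>x. \<rho> x * h x - \<sigma> x * h x)"
      using int_h[OF int_\<rho>] int_h[OF int_\<sigma>] by (rule Bochner_Integration.integrable_diff)
    show "AE x in m. (cmod (complex_of_real (sqrt (\<sigma> x)) - complex_of_real (sqrt (\<rho> x))))\<^sup>2 \<le> \<rho> x * h x - \<sigma> x * h x"
      using pos
    proof eventually_elim
      case (elim x)
      have "cmod (complex_of_real (sqrt (\<sigma> x)) - complex_of_real (sqrt (\<rho> x))) = \<bar>sqrt (\<sigma> x) - sqrt (\<rho> x)\<bar>"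
        by (metis norm_of_real of_real_diff)
      then have "(cmod (complex_of_real (sqrt (\<sigma> x)) - complex_of_real (sqrt (\<rho> x))))\<^sup>2 = (sqrt (\<sigma> x) - sqrt (\<rho> x))\<^sup>2"
        by simp
      also have "\<dots> \<le> \<rho> x * h x - \<sigma> x * h x"
      proof (cases "\<sigma> x > 0")
        case True
        then show ?thesis
          using hellinger_le_clamp_test[OF \<rho>(2) True, of x] by (simp add: h_def algebra_simps)
      next
        case False
        then have "\<sigma> x = 0" "\<rho> x = 0"
          using \<sigma>_nonneg[of x] \<rho>(2)[of x] elim by auto
        then show ?thesis by simp
      qed
      finally show ?case .
    qed
  qed
  also have "\<dots> = (\<integral>x. \<rho> x * h x \<partial>m) - (\<integral>x. \<sigma> x * h x \<partial>m)"
    using int_h[OF int_\<rho>] int_h[OF int_\<sigma>] by (rule Bochner_Integration.integral_diff)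
  also have "\<dots> = (\<integral>x. h x \<partial>\<nu>) - (\<integral>x. h x \<partial>translate_measure G \<Gamma> g \<nu>)"
  proof -
    have "(\<integral>x. h x \<partial>\<nu>) = (\<integral>x. \<rho> x * h x \<partial>m)"
      unfolding \<rho>(3) using \<rho>(2) by (subst integral_density) auto
    moreover have "(\<integral>x. h x \<partial>translate_measure G \<Gamma> g \<nu>) = (\<integral>x. \<sigma> x * h x \<partial>m)"
      unfolding g\<nu> using \<sigma>_nonneg by (subst integral_density) auto
    ultimately show ?thesis
      by simp
  qed
  also have "\<dots> \<le> \<bar>(\<integral>x. h x \<partial>translate_measure G \<Gamma> g \<nu>) - (\<integral>x. h x \<partial>\<nu>)\<bar>"
    by simp
  also have "\<dots> \<le> W1 (density_ratio G \<rho> g) (translate_measure G \<Gamma> g \<nu>) \<nu>"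
    using W1_upper[OF prob_g\<nu> \<nu>(1) clamp_test_lipschitz clamp_test_bounded, of "density_ratio G \<rho> g"]
    by (simp add: ratio)
  finally show ?thesis
    using W1 by (simp add: \<sigma>_def)
qed

text \<open>The squared displacement of a unit vector is small on a neighbourhood of the identity,
  hence on the Kazhdan set, and property (T) then gives an invariant function. Quantifying over
  \<open>v\<close> after the threshold makes the threshold uniform in the density.\<close>

lemma lattice_if_almost_invariant:
  assumes T: "property_T G" and conn: "connected (UNIV :: 'g set)"
    and V: "open V" "\<one> \<in> V" "V \<subseteq> N"
  shows "\<exists>\<epsilon>\<^sub>0>0. \<forall>\<epsilon><\<epsilon>\<^sub>0. \<forall>v. v \<in> sq_int m \<and> sq_norm m v = 1 \<and>
    (\<forall>g\<in>N. sq_norm m (\<lambda>x. v (inv g <# x) - v x) \<le> \<epsilon>) \<longrightarrow> emeasure m (space m) < \<infinity>"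
proof -
  obtain K \<kappa> where K: "compact K" and \<kappa>: "0 < (\<kappa>::real)"
    and T': "\<forall>H \<pi>. unitary_rep G H \<pi> \<and>
      (\<exists>x\<in>H. x \<noteq> (\<lambda>_. 0) \<and> (\<forall>g\<in>K. l2_dist (\<pi> g x) x < \<kappa> * l2_norm x)) \<longrightarrow>
        (\<exists>x\<in>H. x \<noteq> (\<lambda>_. 0) \<and> (\<forall>g\<in>carrier G. \<pi> g x = x))"
    using T unfolding property_T_def by (elim exE conjE)
  obtain C :: real where C: "C \<ge> 0"
    "\<And>q a. \<lbrakk>\<And>g. 0 \<le> q g; \<And>g h. q (g \<otimes> h) \<le> 2 * q g + 2 * q h; \<And>g. g \<in> V \<Longrightarrow> q g \<le> a\<rbrakk>
      \<Longrightarrow> \<forall>g\<in>K. q g \<le> C * a"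
    using quasi_length_bounded_on_compact[OF conn V(1,2) K] by blast
  obtain a where "koopman m a G (\<lambda>g x. g <# x)"
    by (rule koopman_coset_space)
  then interpret koopman m a G "\<lambda>g x. g <#\<^bsub>G\<^esub> x" .
  show ?thesis
  \<comment> \<open>On \<open>K\<close> the squared displacement is at most
    \<open>C * \<epsilon>\<close>, which must lie below \<open>\<kappa>\<^sup>2\<close> since
    \<open>v\<close> has norm 1; \<open>C + 1\<close> avoids division by 0.\<close>
  proof (intro exI[of _ "\<kappa>\<^sup>2 / (C + 1)"] conjI allI impI)
    show "0 < \<kappa>\<^sup>2 / (C + 1)"
      using C(1) \<kappa> by simp
  next
    fix \<epsilon> v assume \<epsilon>: "\<epsilon> < \<kappa>\<^sup>2 / (C + 1)"
      and "v \<in> sq_int m \<and> sq_norm m v = 1 \<and> (\<forall>g\<in>N. sq_norm m (\<lambda>x. v (inv g <# x) - v x) \<le> \<epsilon>)"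
    then have v: "v \<in> sq_int m" "sq_norm m v = 1"
      "\<And>g. g \<in> N \<Longrightarrow> sq_norm m (\<lambda>x. v (inv g <# x) - v x) \<le> \<epsilon>"
      by auto
    define q where "q g = sq_norm m (\<lambda>x. koop g v x - v x)" for g
    have q_nonneg: "0 \<le> q g" for g
      by (simp add: q_def sq_norm_nonneg)
    \<comment> \<open>Split ghv - v into g(hv - v) and gv - v; the first has the norm of hv - v
      because \<open>g\<close> acts isometrically.\<close>
    have q_mult: "q (g \<otimes> h) \<le> 2 * q g + 2 * q h" for g h
    proof -
      have "q (g \<otimes> h) = sq_norm m (\<lambda>x. koop g (koop h v) x - v x)"
        unfolding q_def sq_norm_def
        by (rule Bochner_Integration.integral_cong) (simp_all add: koop_def act_mult inv_mult_group)
      also have "\<dots> \<le> 2 * sq_norm m (\<lambda>x. koop g (koop h v) x - koop g v x) + 2 * sq_norm m (\<lambda>x. koop g v x - v x)"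
        by (intro sq_norm_diff_le koop_sq_int v)
      also have "sq_norm m (\<lambda>x. koop g (koop h v) x - koop g v x) = q h"
        using sq_norm_act[OF sq_int_diff[OF koop_sq_int[OF v(1)] v(1)], of h "inv g"] by (simp add: koop_def q_def)
      finally show ?thesis
        by (simp add: q_def)
    qed
    have q_V: "q g \<le> \<epsilon>" if "g \<in> V" for g
      using v(3)[of g] that V(3) by (auto simp: q_def koop_def)
    \<comment> \<open>The sign of \<epsilon> comes from the displacement at the identity, which is
      nonnegative and at most \<epsilon>.\<close>
    have "0 \<le> \<epsilon>"
      using q_nonneg q_V[OF V(2)] by (rule order_trans)
    have almost: "sqrt (sq_norm m (\<lambda>x. koop g v x - v x)) < \<kappa>" if "g \<in> K" for g
    proof -
      have "q g \<le> C * \<epsilon>"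
        using C(2)[OF q_nonneg q_mult q_V] that by blast
      also have "\<dots> \<le> (C + 1) * \<epsilon>"
        using \<open>0 \<le> \<epsilon>\<close> by (intro mult_right_mono) auto
      also have "\<dots> < \<kappa>\<^sup>2"
        using \<epsilon> C(1) by (simp add: field_simps)
      finally show ?thesis
        using \<kappa> by (simp add: q_def real_less_rsqrt real_sqrt_less_iff real_less_lsqrt sq_norm_nonneg)
    qed
    obtain f where "f \<in> sq_int m" "sq_norm m f \<noteq> 0" "\<And>g. AE x in m. f (g <# x) = f x"
      by (rule exists_invariant_function[where K = K, OF mp[OF spec[OF spec[OF T']], OF conjI] v(1,2) almost]) (assumption+, rule that)
    then show "emeasure m (space m) < \<infinity>"
      by (rule finite_if_invariant_function)
  qed
qed

text \<open>Being a fundamental domain does not refer to the measure on cosets, so one domain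
  computes both measures. It is needed because \<open>lattice_subgroup\<close> asserts finiteness
  for some induced measure.\<close>

lemma induced_measure_unique:
  assumes "induced_measure G \<mu> \<Gamma> m'"
  shows "m' = m"
proof -
  interpret B: coset_action G \<mu> \<Gamma> m'
    by unfold_locales (rule discrete assms)+
  obtain F where F: "fundamental F"
    using fundamental_exists by blast
  show ?thesis
  proof (rule measure_eqI)
    show sets: "sets m' = sets m"
      by (simp add: sets_m_coset_borel B.sets_m_coset_borel)
    fix W assume "W \<in> sets m'"
    then show "emeasure m' W = emeasure m W"
      using B.emeasure_fundamental[OF F] emeasure_fundamental[OF F] sets by simp
  qed
qed

lemma emeasure_space_pos: "emeasure m (space m) \<noteq> 0"
proof
  assume "emeasure m (space m) = 0"
  then have "emeasure \<mu> (\<Union>(space m)) = 0"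
    by (rule null_Union[OF sets.top])
  moreover have "\<Union>(space m) = UNIV"
    using lcosets_part_G[OF subgroup_\<Gamma>] by (simp add: carrier_UNIV)
  ultimately show False
    using emeasure_UNIV_pos by simp
qed

text \<open>The measure is \<open>m\<close> divided by its total mass. Its density is constant, so
  \<open>translate_density\<close> returns the same density and invariance is immediate.\<close>

lemma invariant_probability_measure:
  assumes "emeasure m (space m) < \<infinity>"
  obtains \<nu> \<rho> where "prob_space \<nu>" "absolutely_continuous m \<nu>" "\<And>g. translate_measure G \<Gamma> g \<nu> = \<nu>"
    "density_version m \<nu> \<rho>"
proof -
  define c where "c = 1 / measure m (space m)"
  have m: "emeasure m (space m) = ennreal (measure m (space m))" and pos: "0 < measure m (space m)"
  proof -
    show "emeasure m (space m) = ennreal (measure m (space m))"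
      using assms by (intro emeasure_eq_ennreal_measure) simp
    then show "0 < measure m (space m)"
      using emeasure_space_pos by (metis ennreal_0 measure_nonneg order_le_less)
  qed
  have c: "0 < c"
    using pos by (simp add: c_def)
  define \<nu> where "\<nu> = density m (\<lambda>_. ennreal c)"
  show ?thesis
  proof
    show "prob_space \<nu>"
    proof
      have "emeasure \<nu> (space \<nu>) = ennreal c * emeasure m (space m)"
        by (simp only: \<nu>_def space_density emeasure_density_const[OF sets.top])
      also have "\<dots> = ennreal (c * measure m (space m))"
        using c by (simp only: m ennreal_mult[OF less_imp_le measure_nonneg])
      also have "\<dots> = 1"
        using pos by (simp add: c_def)
      finally show "emeasure \<nu> (space \<nu>) = 1" .
    qed
    show "absolutely_continuous m \<nu>"
      unfolding \<nu>_def by (rule absolutely_continuousI_density) simp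
    show "translate_measure G \<Gamma> g \<nu> = \<nu>" for g
      unfolding \<nu>_def by (rule translate_density) simp
    show "density_version m \<nu> (\<lambda>_. c)"
      using c by (simp add: density_version_def \<nu>_def)
  qed
qed

end

lemma coset_action_lie_group:
  fixes G :: "'g::{second_countable_topology, t2_space} monoid"
    and A :: "('g, 'e::euclidean_space) chart set"
  assumes "lie_group G A" "haar_measure G \<mu>" "discrete_subgroup G \<Gamma>" "induced_measure G \<mu> \<Gamma> m"
  shows "coset_action G \<mu> \<Gamma> m"
proof -
  interpret group G
    using assms(1) by (simp add: lie_group_def)
  show ?thesis
  proof
    show "carrier G = UNIV" "continuous_on UNIV (\<lambda>(x, y). x \<otimes>\<^bsub>G\<^esub> y)" "continuous_on UNIV (\<lambda>x. inv\<^bsub>G\<^esub> x)"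
      using assms(1) by (simp_all add: lie_group_def)
    show "\<exists>U. open U \<and> x \<in> U \<and> emeasure \<mu> U < \<infinity>" for x
    proof -
      have "smooth_atlas A"
        using assms(1) by (simp add: lie_group_def)
      then obtain U K where UK: "open U" "x \<in> U" "U \<subseteq> K" "compact K"
        by (rule smooth_atlas_locally_compact)
      have "emeasure \<mu> U \<le> emeasure \<mu> K"
        using UK assms(2) by (intro emeasure_mono) (auto simp: haar_measure_def compact_imp_closed)
      also have "\<dots> < \<infinity>"
        using UK assms(2) by (simp add: haar_measure_def)
      finally show ?thesis
        using UK by blast
    qed
  qed (use assms in auto)
qed

theorem theorem2:
  fixes G :: "'g::{second_countable_topology, t2_space} monoid"
    and A :: "('g, 'e::euclidean_space) chart set"
    and R :: "('g, 'e) chart \<Rightarrow> 'g \<Rightarrow> 'e \<Rightarrow> 'e \<Rightarrow> real"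
    and \<mu> :: "'g measure" and \<Gamma> :: "'g set" and m :: "'g set measure"
  defines "d \<equiv> riemannian_dist A R"
  defines "G\<^sub>1 \<equiv> unit_ball G d"
  assumes "connected_simple_lie_group G A"
    and "finite (group_centre G)"
    and "2 \<le> real_rank G A"
    and "property_T G"
    and "riemannian_metric A R"
    and "right_invariant_metric G A R"
    and "haar_measure G \<mu>"
    and "discrete_subgroup G \<Gamma>"
    and "induced_measure G \<mu> \<Gamma> m"
  shows
    "(\<exists>\<epsilon>\<^sub>0>0. \<forall>\<epsilon><\<epsilon>\<^sub>0. \<forall>c\<^sub>1 c\<^sub>2 L :: real. \<forall>\<nu> \<rho> X\<^sub>0.
        0 < c\<^sub>1 \<and> c\<^sub>1 < c\<^sub>2 \<and> 0 < L \<and>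
        prob_space \<nu> \<and> absolutely_continuous m \<nu> \<and> density_version m \<nu> \<rho> \<and>
        (\<forall>g\<in>G\<^sub>1. absolutely_continuous (translate_measure G \<Gamma> g \<nu>) \<nu>) \<and>
        X\<^sub>0 \<in> sets m \<and>
        (\<forall>g\<in>G\<^sub>1. 1 - \<epsilon> \<le> measure \<nu> ((\<lambda>x. g <#\<^bsub>G\<^esub> x) ` X\<^sub>0)) \<and>
        (\<forall>g\<in>G\<^sub>1. \<forall>x\<in>X\<^sub>0. c\<^sub>1 \<le> density_ratio G \<rho> g x \<and> density_ratio G \<rho> g x \<le> c\<^sub>2) \<and>
        (\<forall>g\<in>G\<^sub>1. \<forall>x\<in>X\<^sub>0. \<forall>y\<in>X\<^sub>0.
           \<bar>density_ratio G \<rho> g x - density_ratio G \<rho> g y\<bar> \<le> L * coset_dist d x y) \<and>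
        (\<forall>g\<in>G\<^sub>1. W1 (density_ratio G \<rho> g) (translate_measure G \<Gamma> g \<nu>) \<nu> \<le> \<epsilon>)
        \<longrightarrow> lattice_subgroup G \<mu> \<Gamma>) \<and>
     (lattice_subgroup G \<mu> \<Gamma> \<longrightarrow>
        (\<exists>\<nu>. prob_space \<nu> \<and> absolutely_continuous m \<nu> \<and>
           (\<forall>g\<in>carrier G. translate_measure G \<Gamma> g \<nu> = \<nu>) \<and>
           (\<exists>\<rho>. density_version m \<nu> \<rho>) \<and>
           (\<forall>\<rho>. density_version m \<nu> \<rho> \<longrightarrow>
              (\<forall>g\<in>G\<^sub>1. W1 (density_ratio G \<rho> g) (translate_measure G \<Gamma> g \<nu>) \<nu> \<le> 0))))"
    (is "?direct \<and> ?converse")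
proof
  have lie: "lie_group G A" and conn: "connected (carrier G)"
    using assms(3) by (simp_all add: connected_simple_lie_group_def)
  interpret coset_action G \<mu> \<Gamma> m
    by (rule coset_action_lie_group[OF lie assms(9-11)])
  have "smooth_atlas A"
    using lie by (simp add: lie_group_def)
  then obtain V where V: "open V" "\<one>\<^bsub>G\<^esub> \<in> V" "\<And>h. h \<in> V \<Longrightarrow> d \<one>\<^bsub>G\<^esub> h < 1"
    unfolding d_def using riemannian_ball_neighbourhood[OF _ assms(7)] by blast
  have "V \<subseteq> G\<^sub>1"
    using V(3) by (auto simp: G\<^sub>1_def unit_ball_def)
  moreover have "connected (UNIV :: 'g set)"
    using conn by (simp add: carrier_UNIV)
  ultimately obtain \<epsilon>\<^sub>0 where \<epsilon>\<^sub>0: "\<epsilon>\<^sub>0 > 0"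
    "\<And>\<epsilon> v. \<lbrakk>\<epsilon> < \<epsilon>\<^sub>0; v \<in> sq_int m; sq_norm m v = 1;
        \<And>g. g \<in> G\<^sub>1 \<Longrightarrow> sq_norm m (\<lambda>x. v (inv\<^bsub>G\<^esub> g <#\<^bsub>G\<^esub> x) - v x) \<le> \<epsilon>\<rbrakk> \<Longrightarrow> emeasure m (space m) < \<infinity>"
    using lattice_if_almost_invariant[OF assms(6) _ V(1,2), of G\<^sub>1] by blast
  have lattice: "lattice_subgroup G \<mu> \<Gamma>" if "emeasure m (space m) < \<infinity>"
    using that discrete induced unfolding lattice_subgroup_def by blast
  show ?direct
  proof (intro exI[of _ \<epsilon>\<^sub>0] conjI \<epsilon>\<^sub>0(1) allI impI, elim conjE)
    fix \<epsilon> c\<^sub>1 c\<^sub>2 L :: real and \<nu> \<rho> X\<^sub>0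
    assume "\<epsilon> < \<epsilon>\<^sub>0" and \<nu>: "prob_space \<nu>" "density_version m \<nu> \<rho>"
      and "\<forall>g\<in>G\<^sub>1. absolutely_continuous (translate_measure G \<Gamma> g \<nu>) \<nu>"
        "\<forall>g\<in>G\<^sub>1. W1 (density_ratio G \<rho> g) (translate_measure G \<Gamma> g \<nu>) \<nu> \<le> \<epsilon>"
    then show "lattice_subgroup G \<mu> \<Gamma>"
      by (intro lattice \<epsilon>\<^sub>0(2)[OF _ sqrt_density_sq_int(1,2)[OF \<nu>]] sqrt_density_almost_invariant[OF \<nu>]) auto
  qed
  show ?converse
  proof
    assume "lattice_subgroup G \<mu> \<Gamma>"
    then obtain m' where m': "induced_measure G \<mu> \<Gamma> m'" "emeasure m' (space m') < \<infinity>"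
      unfolding lattice_subgroup_def by blast
    \<comment> \<open>The finite measure \<open>m'\<close> furnished by the lattice property is the
      given \<open>m\<close>, by uniqueness.\<close>
    have "emeasure m (space m) < \<infinity>"
      using m'(2) by (simp only: induced_measure_unique[OF m'(1)])
    then obtain \<nu> \<rho> where \<nu>: "prob_space \<nu>" "absolutely_continuous m \<nu>"
      "\<And>g. translate_measure G \<Gamma> g \<nu> = \<nu>" "density_version m \<nu> \<rho>"
      by (rule invariant_probability_measure) (rule that)
    \<comment> \<open>Since \<nu> equals its translates, the distance compares \<nu> with itself and
      is 0 for every function, hence for every version of the density.\<close>
    then show "\<exists>\<nu>. prob_space \<nu> \<and> absolutely_continuous m \<nu> \<and>
           (\<forall>g\<in>carrier G. translate_measure G \<Gamma> g \<nu> = \<nu>) \<and>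
           (\<exists>\<rho>. density_version m \<nu> \<rho>) \<and>
           (\<forall>\<rho>. density_version m \<nu> \<rho> \<longrightarrow>
              (\<forall>g\<in>G\<^sub>1. W1 (density_ratio G \<rho> g) (translate_measure G \<Gamma> g \<nu>) \<nu> \<le> 0))"
      by (intro exI[of _ \<nu>]) (auto simp: W1_self)
  qed
qed

end
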